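(* Let $D$ be a weakly locally finite division ring with center $F$ and let $N$ be a subnormal subgroup of $D^*$. If $N$ is radical over $F$, then $N$ is central, i.e. $N\subseteq F$.
   Context: $D^*$ denotes the multiplicative group of the division ring $D$. A division ring is centrally finite if it is finite-dimensional as a vector space over its center. A division ring $D$ is weakly locally finite if for every finite subset $S$ of $D$, the division subring of $D$ generated by $S$ is centrally finite (i.e. finite-dimensional over its own center). A subset $S\subseteq D$ is radical over a division subring $K$ of $D$ if for every $x\in S$ there is a positive integer $n(x)$, depending on $x$, such that $x^{n(x)}\in K$. *)

theory Defs
  imports "HOL-Algebra.Algebra"
begin

locale skew_field = ring D for D (structure) +
  assumes one_not_zero: "\<one> \<noteq> \<zero>"
    and skew_field_Units: "Units D = carrier D - {\<zero>}"

definition ring_center :: "('a, 'b) ring_scheme \<Rightarrow> 'a set" where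
  "ring_center D = {z \<in> carrier D. \<forall>x \<in> carrier D. z \<otimes>\<^bsub>D\<^esub> x = x \<otimes>\<^bsub>D\<^esub> z}"

definition centrally_finite :: "('a, 'b) ring_scheme \<Rightarrow> bool" where
  "centrally_finite D \<longleftrightarrow> ring.finite_dimension D (ring_center D) (carrier D)"

definition division_subring :: "'a set \<Rightarrow> ('a, 'b) ring_scheme \<Rightarrow> bool" where
  "division_subring K D \<longleftrightarrow> subring K D \<and> skew_field (D\<lparr>carrier := K\<rparr>)"

definition generated_division_subring :: "('a, 'b) ring_scheme \<Rightarrow> 'a set \<Rightarrow> 'a set" where
  "generated_division_subring D S = \<Inter>{K. division_subring K D \<and> S \<subseteq> K}"

text \<open>The center in \<^const>\<open>centrally_finite\<close> is taken in the generated subring itself, not in \<open>D\<close>.\<close>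

definition weakly_locally_finite :: "('a, 'b) ring_scheme \<Rightarrow> bool" where
  "weakly_locally_finite D \<longleftrightarrow>
     (\<forall>S. finite S \<and> S \<subseteq> carrier D \<longrightarrow>
        centrally_finite (D\<lparr>carrier := generated_division_subring D S\<rparr>))"

definition radical_over :: "('a, 'b) ring_scheme \<Rightarrow> 'a set \<Rightarrow> 'a set \<Rightarrow> bool" where
  "radical_over D S K \<longleftrightarrow> (\<forall>x \<in> S. \<exists>n::nat. n > 0 \<and> x [^]\<^bsub>D\<^esub> n \<in> K)"

definition subnormal_subgroup :: "'a set \<Rightarrow> ('a, 'b) monoid_scheme \<Rightarrow> bool" where
  "subnormal_subgroup N G \<longleftrightarrow>
     (\<exists>(r::nat) H. H 0 = N \<and> H r = carrier G \<and>
        (\<forall>i \<le> r. subgroup (H i) G) \<and>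
        (\<forall>i < r. H i \<lhd> G\<lparr>carrier := H (Suc i)\<rparr>))"

end

theory Submission
  imports Defs "HOL-Computational_Algebra.Primes"
begin

text \<open>
  Replacing \<open>D\<close> by the division subring generated by \<open>x \<in> N\<close> and \<open>y \<in> D\<close>, we may assume that \<open>D\<close> has finite
  dimension over its center \<open>F\<close>. Subnormality enters only through the sequence \<open>a\<^sub>0 = a\<close>,
  \<open>a\<^sub>i\<^sub>+\<^sub>1 = a\<^sub>i x a\<^sub>i\<^sup>-\<^sup>1 x\<^sup>-\<^sup>1\<close>, which reaches \<open>N\<close> after a fixed number of steps for all \<open>x \<in> N\<close>, \<open>a \<in> D\<^sup>*\<close>.

  If \<open>F\<close> has positive characteristic and \<open>F\<^sup>*\<close> is torsion, then so is \<open>D\<^sup>*\<close>, and \<open>D\<close> is commutative as in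
  the theorems of Jacobson and Wedderburn. Otherwise \<open>F\<close> carries a nontrivial valuation ring \<open>V\<close>, of positive
  residue characteristic. For the left order \<open>\<Lambda>\<close> of a \<open>V\<close>-lattice in \<open>D\<close> and a suitable nonunit \<open>\<delta>\<close> of \<open>V\<close> the
  group \<open>1 + \<delta>\<Lambda>\<close> is torsion free. Take \<open>a = 1 + \<epsilon>y\<close> so close to \<open>1\<close> that all \<open>a\<^sub>i\<close> lie in this group. Since they
  are eventually radical over \<open>F\<close>, torsion-freeness forces some \<open>a\<^sub>i = 1\<close>; as \<open>x\<close> is radical over \<open>F\<close>, this
  descends to \<open>a\<^sub>1 = 1\<close>, so \<open>x\<close> commutes with \<open>y\<close>. An element \<open>x \<in> N\<close> inseparable over \<open>F\<close> needs a particular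
  \<open>y\<close>, with \<open>x y x\<^sup>-\<^sup>1 = y + 1\<close>, for which all \<open>a\<^sub>i\<close> commute.
\<close>

section \<open>Valuation rings of a field\<close>

text \<open>A power of an element of \<open>N\<close> is only known to be central, not one, so
  torsion-freeness does not apply directly to the last commutator \<open>z\<close>. But conjugation
  by \<open>z\<close> is a center-linear map of finite order close to the identity, and the argument
  against torsion applies to such maps too, except at the characteristic \<open>p\<close>. Hence
  \<open>z\<close> is central, and since \<open>z x\<close> is conjugate to \<open>x\<close>,
  comparing powers gives \<open>z^n = 1\<close>. At \<open>p\<close>, nontrivial inner automorphisms
  of order \<open>p\<close> can be arbitrarily close to the identity; this is why inseparable
  elements are treated apart.

  The valuation ring need not be discrete or complete and need not extend to a valuation of
  \<open>D\<close>. Its substitute on \<open>D\<close> is the primitive multiple: a central scaling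
  that moves a nonzero element into the order, but not into its multiple by any nonunit of the
  valuation ring. The constant \<open>\<delta>\<close> has to stay a nonunit after division by each
  prime \<open>q\<close> that is nonzero in \<open>D\<close>, because a sum of \<open>q\<close>
  congruent terms is compared with \<open>q\<close> times one of them.\<close>

context cring
begin

text \<open>The values at \<open>u\<close> of polynomials over \<open>B\<close> of degree at most
  \<open>n\<close>. The degree bound stays explicit because the valuation argument descends on it
  and because each level is finite when \<open>B\<close> is.\<close>

fun poly_values :: "'a set \<Rightarrow> 'a \<Rightarrow> nat \<Rightarrow> 'a set" where
  "poly_values B u 0 = B"
| "poly_values B u (Suc n) = {v \<oplus> b \<otimes> u [^] Suc n | v b. v \<in> poly_values B u n \<and> b \<in> B}"

context
  fixes B assumes B: "subring B R"
begin

lemma poly_values_closed: "u \<in> carrier R \<Longrightarrow> v \<in> poly_values B u n \<Longrightarrow> v \<in> carrier R"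
  using subringE(1)[OF B] by (induction n arbitrary: v) auto

lemma finite_poly_values: "finite B \<Longrightarrow> finite (poly_values B u n)"
proof (induction n)
  case (Suc n)
  have "poly_values B u (Suc n) = (\<lambda>(v, b). v \<oplus> b \<otimes> u [^] Suc n) ` (poly_values B u n \<times> B)"
    by (auto simp: image_iff)
  then show ?case using Suc by simp
qed simp

lemma poly_values_Suc: "u \<in> carrier R \<Longrightarrow> v \<in> poly_values B u n \<Longrightarrow> v \<in> poly_values B u (Suc n)"
  unfolding poly_values.simps using subringE(2)[OF B] poly_values_closed[of u v n]
  by (intro CollectI exI[of _ v] exI[of _ \<zero>]) (simp del: nat_pow_Suc)

lemma poly_values_mono: "u \<in> carrier R \<Longrightarrow> v \<in> poly_values B u n \<Longrightarrow> n \<le> m \<Longrightarrow> v \<in> poly_values B u m"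
  by (induction m) (use poly_values_Suc in \<open>auto simp del: poly_values.simps simp: le_Suc_eq\<close>)

lemma poly_values_add:
  assumes u: "u \<in> carrier R"
  shows "v \<in> poly_values B u n \<Longrightarrow> w \<in> poly_values B u n \<Longrightarrow> v \<oplus> w \<in> poly_values B u n"
proof (induction n arbitrary: v w)
  case 0 then show ?case using subringE(7)[OF B] by simp
next
  case (Suc n)
  obtain v' b w' c where v: "v = v' \<oplus> b \<otimes> u [^] Suc n" "v' \<in> poly_values B u n" "b \<in> B"
    and w: "w = w' \<oplus> c \<otimes> u [^] Suc n" "w' \<in> poly_values B u n" "c \<in> B"
    using Suc.prems unfolding poly_values.simps by blast
  have c: "v' \<in> carrier R" "w' \<in> carrier R" "b \<in> carrier R" "c \<in> carrier R" "u [^] Suc n \<in> carrier R"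
    using v w u poly_values_closed subringE(1)[OF B] by auto
  have "v \<oplus> w = (v' \<oplus> w') \<oplus> (b \<oplus> c) \<otimes> u [^] Suc n"
    unfolding v(1) w(1) using c by (simp del: nat_pow_Suc add: a_ac l_distr)
  then show ?case unfolding poly_values.simps using Suc.IH[OF v(2) w(2)] subringE(7)[OF B v(3) w(3)] by blast
qed

lemma poly_values_smult:
  assumes u: "u \<in> carrier R" and c: "c \<in> B"
  shows "v \<in> poly_values B u n \<Longrightarrow> c \<otimes> v \<in> poly_values B u n"
proof (induction n arbitrary: v)
  case 0 then show ?case using subringE(6)[OF B] c by simp
next
  case (Suc n)
  obtain v' b where v: "v = v' \<oplus> b \<otimes> u [^] Suc n" "v' \<in> poly_values B u n" "b \<in> B"
    using Suc.prems unfolding poly_values.simps by blast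
  have "v' \<in> carrier R" "b \<in> carrier R" "c \<in> carrier R" "u [^] Suc n \<in> carrier R"
    using v u c poly_values_closed subringE(1)[OF B] by auto
  then have "c \<otimes> v = c \<otimes> v' \<oplus> (c \<otimes> b) \<otimes> u [^] Suc n"
    unfolding v(1) by (simp del: nat_pow_Suc add: m_assoc r_distr)
  then show ?case unfolding poly_values.simps using Suc.IH[OF v(2)] subringE(6)[OF B c v(3)] by blast
qed

lemma poly_values_shift:
  assumes u: "u \<in> carrier R"
  shows "v \<in> poly_values B u n \<Longrightarrow> v \<otimes> u \<in> poly_values B u (Suc n)"
proof (induction n arbitrary: v)
  case 0
  then have "v \<in> carrier R" using subringE(1)[OF B] by auto
  then have "v \<otimes> u = \<zero> \<oplus> v \<otimes> u [^] Suc 0" using u by simp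
  then show ?case unfolding poly_values.simps using 0 subringE(2)[OF B] by auto
next
  case (Suc n)
  obtain v' b where v: "v = v' \<oplus> b \<otimes> u [^] Suc n" "v' \<in> poly_values B u n" "b \<in> B"
    using Suc.prems unfolding poly_values.simps by blast
  have "v' \<in> carrier R" "b \<in> carrier R" "u [^] Suc n \<in> carrier R"
    using v u poly_values_closed subringE(1)[OF B] by auto
  then have "v \<otimes> u = v' \<otimes> u \<oplus> b \<otimes> u [^] Suc (Suc n)"
    unfolding v(1) using u by (simp add: m_assoc l_distr)
  then show ?case using Suc.IH[OF v(2)] v(3) poly_values.simps(2)[of B u "Suc n"] by blast
qed

lemma poly_values_mult:
  assumes u: "u \<in> carrier R" and w: "w \<in> poly_values B u m"
  shows "v \<in> poly_values B u n \<Longrightarrow> v \<otimes> w \<in> poly_values B u (n + m)"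
proof (induction n arbitrary: v)
  case 0 then show ?case using poly_values_smult[OF u _ w] by simp
next
  case (Suc n)
  obtain v' b where v: "v = v' \<oplus> b \<otimes> u [^] Suc n" "v' \<in> poly_values B u n" "b \<in> B"
    using Suc.prems unfolding poly_values.simps by blast
  have c: "v' \<in> carrier R" "b \<in> carrier R" "w \<in> carrier R" "\<And>k. u [^] (k::nat) \<in> carrier R"
    using v w u poly_values_closed subringE(1)[OF B] by auto
  have *: "w \<otimes> u [^] k \<in> poly_values B u (k + m)" for k :: nat
  proof (induction k)
    case (Suc k)
    from poly_values_shift[OF u this] show ?case using c u by (simp add: m_assoc)
  qed (use w c in simp)
  have "v \<otimes> w = v' \<otimes> w \<oplus> b \<otimes> (w \<otimes> u [^] Suc n)"
    unfolding v(1) using c(1-3) c(4)[of "Suc n"] by (simp del: nat_pow_Suc add: m_ac r_distr)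
  then show ?case 
    using poly_values_add[OF u poly_values_Suc[OF u Suc.IH[OF v(2)]], of "b \<otimes> (w \<otimes> u [^] Suc n)"]
      poly_values_smult[OF u v(3) *[of "Suc n"]] by (metis add_Suc)
qed

lemma subring_poly_values:
  assumes u: "u \<in> carrier R"
  shows "subring (\<Union>n. poly_values B u n) R"
proof (rule subringI)
  show "(\<Union>n. poly_values B u n) \<subseteq> carrier R" using poly_values_closed u by auto
  show "\<one> \<in> (\<Union>n. poly_values B u n)" using subringE(3)[OF B] by (auto intro: exI[of _ 0])
next
  fix h assume "h \<in> (\<Union>n. poly_values B u n)"
  then obtain n where "h \<in> poly_values B u n" by auto
  then have "h \<in> carrier R" "\<ominus> \<one> \<otimes> h \<in> poly_values B u n"
    using poly_values_closed poly_values_smult[OF u] subringE(3,5)[OF B] u by auto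
  then show "\<ominus> h \<in> (\<Union>n. poly_values B u n)" by (auto simp: l_minus)
next
  fix h k assume "h \<in> (\<Union>n. poly_values B u n)" "k \<in> (\<Union>n. poly_values B u n)"
  then obtain n m where *: "h \<in> poly_values B u n" "k \<in> poly_values B u m" by auto
  show "h \<otimes> k \<in> (\<Union>n. poly_values B u n)" using poly_values_mult[OF u *(2,1)] by auto
  have "h \<in> poly_values B u (max n m)" "k \<in> poly_values B u (max n m)" using * poly_values_mono[OF u] by auto
  then show "h \<oplus> k \<in> (\<Union>n. poly_values B u n)" using poly_values_add[OF u] by blast
qed

lemma poly_values_power:
  assumes u: "u \<in> carrier R"
  shows "u [^] n \<in> poly_values B u n"
proof (induction n)
  case (Suc n) then show ?case using poly_values_shift[OF u] by simp
qed (use subringE(3)[OF B] in simp)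

lemma poly_values_gen: "u \<in> carrier R \<Longrightarrow> u \<in> poly_values B u 1"
  using poly_values_shift[of u \<one> 0] subringE(3)[OF B] by simp

text \<open>Each monomial \<open>u'^i\<close> becomes \<open>u^(n-i)\<close>: this is how a relation
  in \<open>u'\<close> is turned into one in \<open>u\<close>.\<close>

lemma poly_values_reverse:
  assumes u: "u \<in> carrier R" "u' \<in> carrier R" "u' \<otimes> u = \<one>"
  shows "w \<in> poly_values B u' n \<Longrightarrow> w \<otimes> u [^] n \<in> poly_values B u n"
proof (induction n arbitrary: w)
  case 0 then show ?case using subringE(1)[OF B] by auto
next
  case (Suc n)
  obtain v b where v: "w = v \<oplus> b \<otimes> u' [^] Suc n" "v \<in> poly_values B u' n" "b \<in> B"
    using Suc.prems unfolding poly_values.simps by blast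
  have c: "v \<in> carrier R" "b \<in> carrier R" "u' [^] Suc n \<in> carrier R" "u [^] Suc n \<in> carrier R" "u [^] n \<in> carrier R"
    using v u poly_values_closed subringE(1)[OF B] by auto
  have 1: "u' [^] Suc n \<otimes> u [^] Suc n = \<one>" using u by (metis nat_pow_distrib nat_pow_one)
  have "w \<otimes> u [^] Suc n = v \<otimes> u [^] Suc n \<oplus> b \<otimes> (u' [^] Suc n \<otimes> u [^] Suc n)"
    unfolding v(1) using c by (simp del: nat_pow_Suc add: m_assoc l_distr)
  also have "\<dots> = (v \<otimes> u [^] n) \<otimes> u \<oplus> b" using 1 c u by (simp add: m_assoc)
  finally show ?case
    using poly_values_add[OF u(1) poly_values_shift[OF u(1) Suc.IH[OF v(2)]], of b]
      poly_values_mono[OF u(1), of b 0 "Suc n"] v(3) by simp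
qed

text \<open>Horner form, splitting off the constant term instead of the leading one: the constant
  term \<open>b\<close> of a relation will be absorbed by inverting \<open>1 - s b\<close>.\<close>

lemma poly_values_head:
  assumes u: "u \<in> carrier R"
  shows "w \<in> poly_values B u (Suc n) \<Longrightarrow> \<exists>b\<in>B. \<exists>v\<in>poly_values B u n. w = b \<oplus> v \<otimes> u"
proof (induction n arbitrary: w)
  case 0 then show ?case using u by auto
next
  case (Suc n)
  obtain v b where v: "w = v \<oplus> b \<otimes> u [^] Suc (Suc n)" "v \<in> poly_values B u (Suc n)" "b \<in> B"
    using Suc.prems poly_values.simps(2)[of B u "Suc n"] by blast
  obtain c x where x: "c \<in> B" "x \<in> poly_values B u n" "v = c \<oplus> x \<otimes> u" using Suc.IH[OF v(2)] by blast
  have c: "c \<in> carrier R" "x \<in> carrier R" "b \<in> carrier R" "u [^] Suc n \<in> carrier R"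
    using v x u poly_values_closed subringE(1)[OF B] by auto
  have "w = c \<oplus> (x \<oplus> b \<otimes> u [^] Suc n) \<otimes> u"
    unfolding v(1) x(3) nat_pow_Suc[of u "Suc n"] using c u 
    by (simp del: nat_pow_Suc add: m_assoc l_distr a_assoc)
  moreover have "x \<oplus> b \<otimes> u [^] Suc n \<in> poly_values B u (Suc n)" using x v(3) by auto
  ultimately show ?case using x(1) by blast
qed

end

end

text \<open>A subring that is maximal among those omitting the inverse \<open>t\<close> of \<open>s\<close> is a valuation ring:
  \<open>s\<close> lies in its Jacobson radical, so relations \<open>1 \<in> s B[u]\<close> and \<open>1 \<in> s B[u\<^sup>-\<^sup>1]\<close> of degrees
  \<open>n \<ge> m\<close> can be combined into one of smaller degree.\<close>

lemma (in field) valuation_ring_exists: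
  assumes A: "subring A R" and s: "s \<in> A" "t \<in> carrier R" "s \<otimes> t = \<one>" "t \<notin> A"
  shows "\<exists>V. subring V R \<and> A \<subseteq> V \<and> t \<notin> V \<and> (\<forall>u\<in>carrier R. \<forall>v\<in>carrier R. u \<otimes> v = \<one> \<longrightarrow> u \<in> V \<or> v \<in> V)"
proof -
  define \<A> where "\<A> = {B. subring B R \<and> A \<subseteq> B \<and> t \<notin> B}"
  have "\<exists>M\<in>\<A>. \<forall>Y\<in>\<A>. M \<subseteq> Y \<longrightarrow> Y = M"
  proof (rule subset_Zorn_nonempty)
    show "\<A> \<noteq> {}" using A s(4) by (auto simp: \<A>_def)
    fix C assume C: "C \<noteq> {}" "subset.chain \<A> C"
    then have sub: "\<And>B. B \<in> C \<Longrightarrow> subring B R \<and> A \<subseteq> B \<and> t \<notin> B"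
      and lin: "\<And>B B'. B \<in> C \<Longrightarrow> B' \<in> C \<Longrightarrow> B \<subseteq> B' \<or> B' \<subseteq> B"
      unfolding subset.chain_def \<A>_def by auto
    have "subring (\<Union>C) R"
    proof (rule subringI)
      show "\<Union>C \<subseteq> carrier R" using sub subringE(1)[of _ R] by auto
      show "\<one> \<in> \<Union>C" using C(1) sub subringE(3)[of _ R] by auto
      show "\<ominus> h \<in> \<Union>C" if "h \<in> \<Union>C" for h using that sub subringE(5)[of _ R h] by auto
      show "h1 \<otimes> h2 \<in> \<Union>C" "h1 \<oplus> h2 \<in> \<Union>C" if h: "h1 \<in> \<Union>C" "h2 \<in> \<Union>C" for h1 h2
      proof -
        obtain B where "B \<in> C" "h1 \<in> B" "h2 \<in> B" using h lin by blast
        then show "h1 \<otimes> h2 \<in> \<Union>C" "h1 \<oplus> h2 \<in> \<Union>C" using sub[of B] subringE(6,7)[of B R h1 h2] by auto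
      qed
    qed
    moreover have "A \<subseteq> \<Union>C" "t \<notin> \<Union>C" using sub C(1) by auto
    ultimately show "\<Union>C \<in> \<A>" by (simp add: \<A>_def)
  qed
  then obtain B where B: "subring B R" "A \<subseteq> B" "t \<notin> B" and
    maximal: "\<And>Y. subring Y R \<Longrightarrow> B \<subseteq> Y \<Longrightarrow> t \<notin> Y \<Longrightarrow> Y = B"
    unfolding \<A>_def mem_Collect_eq by (metis (no_types, lifting) mem_Collect_eq order_trans)
  note Bs = subringE[OF B(1)]
  have sc: "s \<in> carrier R" and sB: "s \<in> B" using s B(2) Bs(1) by auto
  have t_eq: "t = b" if "b \<in> carrier R" "s \<otimes> b = \<one>" for b
    using that s(2,3) sc by (metis inv_char m_comm)
  have no: "s \<otimes> b \<noteq> \<one>" if "b \<in> B" for b using t_eq[of b] that B(3) Bs(1) by auto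
  \<comment> \<open>Maximality forces \<open>t\<close> into \<open>B[u]\<close> when
    \<open>u\<close> is outside \<open>B\<close>; this is kept as a relation \<open>s v = 1\<close>
    with a degree attached.\<close>
  have ext: "u \<in> B \<or> (\<exists>n. \<exists>v\<in>poly_values B u n. s \<otimes> v = \<one>)" if u: "u \<in> carrier R" for u
  proof (rule ccontr)
    assume n: "\<not> ?thesis"
    then have "t \<notin> (\<Union>n. poly_values B u n)" using s(3) by auto
    moreover have "B \<subseteq> (\<Union>n. poly_values B u n)" using poly_values.simps(1)[of B u] by blast
    ultimately have "(\<Union>n. poly_values B u n) = B" using maximal[OF subring_poly_values[OF B(1) u]] by blast
    then show False using n poly_values_gen[OF B(1) u] by blast
  qed
  \<comment> \<open>If the inverse \<open>e\<close> of \<open>g = 1 - s b\<close> were outside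
    \<open>B\<close>, then \<open>s v = 1\<close> for some \<open>v\<close> in \<open>B[e]\<close>.
    Multiplying by \<open>g^n\<close> clears \<open>e\<close> and puts \<open>g^n\<close> into
    \<open>s B\<close>, although \<open>g^n\<close> is \<open>1\<close> modulo
    \<open>s B\<close>.\<close>
  have unit: "\<exists>e\<in>B. e \<otimes> (\<one> \<ominus> s \<otimes> b) = \<one>" if b: "b \<in> B" for b
  proof -
    define g where "g = \<one> \<ominus> s \<otimes> b"
    have bc: "b \<in> carrier R" "g \<in> carrier R" using b Bs(1) sc by (auto simp: g_def)
    have gB: "g \<in> B" unfolding g_def a_minus_def using b Bs sB by auto
    have "g \<noteq> \<zero>"
    proof
      assume "g = \<zero>" then have "s \<otimes> b = \<one>" unfolding g_def using bc sc by simp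
      then show False using no[OF b] by simp
    qed
    then have gu: "g \<in> Units R" using bc field_Units by auto
    define e where "e = inv g"
    have e: "e \<in> carrier R" "e \<otimes> g = \<one>" using gu by (auto simp: e_def)
    have "e \<in> B"
    proof (rule ccontr)
      assume "e \<notin> B"
      then obtain n v where v: "v \<in> poly_values B e n" "s \<otimes> v = \<one>" using ext[OF e(1)] by blast
      have gp: "g [^] n \<in> B" for n :: nat by (induction n) (use Bs gB in auto)
      have v1: "v \<otimes> g [^] n \<in> B"
        using v(1)
      proof (induction n arbitrary: v)
        case 0 then show ?case using Bs by auto
      next
        case (Suc n)
        obtain v' c where w: "v = v' \<oplus> c \<otimes> e [^] Suc n" "v' \<in> poly_values B e n" "c \<in> B"
          using Suc.prems unfolding poly_values.simps by blast
        have c: "v' \<in> carrier R" "c \<in> carrier R" "e [^] Suc n \<in> carrier R" "g [^] Suc n \<in> carrier R" "g [^] n \<in> carrier R"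
          using w e bc poly_values_closed[OF B(1)] Bs(1) by auto
        have 1: "e [^] Suc n \<otimes> g [^] Suc n = \<one>" using e bc by (metis nat_pow_distrib nat_pow_one)
        have "v \<otimes> g [^] Suc n = v' \<otimes> g [^] Suc n \<oplus> c \<otimes> (e [^] Suc n \<otimes> g [^] Suc n)"
          unfolding w(1) using c by (simp del: nat_pow_Suc add: m_assoc l_distr)
        also have "\<dots> = (v' \<otimes> g [^] n) \<otimes> g \<oplus> c" using 1 c bc by (simp add: m_assoc)
        finally show ?case using Suc.IH[OF w(2)] w(3) gB Bs by auto
      qed
      have vc: "v \<in> carrier R" using poly_values_closed[OF B(1) e(1) v(1)] .
      have "s \<otimes> (v \<otimes> g [^] n) = g [^] n" using v(2) vc sc bc by (metis l_one m_assoc nat_pow_closed)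
      moreover have "\<exists>c\<in>B. g [^] (k::nat) = \<one> \<ominus> s \<otimes> c" for k
      proof (induction k)
        case 0 show ?case using Bs(2) sc by (intro bexI[of _ \<zero>]) (auto simp: a_minus_def)
      next
        case (Suc k)
        then obtain c where c: "c \<in> B" "g [^] k = \<one> \<ominus> s \<otimes> c" by blast
        have "c \<in> carrier R" using c Bs(1) by auto
        then have "(\<one> \<ominus> s \<otimes> c) \<otimes> (\<one> \<ominus> s \<otimes> b) = \<one> \<ominus> s \<otimes> (c \<oplus> b \<ominus> s \<otimes> c \<otimes> b)"
          using bc(1) sc by algebra
        then have "g [^] Suc k = \<one> \<ominus> s \<otimes> (c \<oplus> b \<ominus> s \<otimes> c \<otimes> b)"
          using c(2) by (simp add: g_def)
        moreover have "c \<oplus> b \<ominus> s \<otimes> c \<otimes> b \<in> B" unfolding a_minus_def using Bs c(1) b sB by auto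
        ultimately show ?case by blast
      qed
      then obtain c where c: "c \<in> B" "g [^] n = \<one> \<ominus> s \<otimes> c" by blast
      have cc: "c \<in> carrier R" "v \<otimes> g [^] n \<in> carrier R" using c Bs(1) v1 by auto
      ultimately have "s \<otimes> (v \<otimes> g [^] n) = \<one> \<ominus> s \<otimes> c" using c by simp
      then have "s \<otimes> (v \<otimes> g [^] n \<oplus> c) = \<one>" using cc sc by algebra
      then show False using no[of "v \<otimes> g [^] n \<oplus> c"] v1 c Bs(7) by auto
    qed
    then show ?thesis using e(2) unfolding g_def by blast
  qed
  have key: False if "u \<in> carrier R" "u' \<in> carrier R" "u \<otimes> u' = \<one>"
      "v \<in> poly_values B u n" "s \<otimes> v = \<one>" "w \<in> poly_values B u' m" "s \<otimes> w = \<one>" for u u' v w n m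
    using that
  proof (induction "n + m" arbitrary: n m u u' v w rule: less_induct)
    case less
    \<comment> \<open>By symmetry in \<open>u\<close> and \<open>u'\<close>, the relation in
      \<open>u\<close> may be taken to have the larger degree; its leading term gets
      eliminated.\<close>
    have *: False if h: "u \<in> carrier R" "u' \<in> carrier R" "u \<otimes> u' = \<one>"
      "v \<in> poly_values B u i" "s \<otimes> v = \<one>" "w \<in> poly_values B u' j" "s \<otimes> w = \<one>" "j \<le> i" "i + j = n + m"
      for u u' v w i j
    proof (cases j)
      case 0 then show ?thesis using h(6,7) no by auto
    next
      case (Suc k)
      obtain b x where b: "b \<in> B" "x \<in> poly_values B u' k" "w = b \<oplus> x \<otimes> u'"
        using poly_values_head[OF B(1) h(2)] h(6) Suc by blast
      obtain e where e: "e \<in> B" "e \<otimes> (\<one> \<ominus> s \<otimes> b) = \<one>" using unit[OF b(1)] by blast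
      define y where "y = e \<otimes> x"
      have y: "y \<in> poly_values B u' k" unfolding y_def using poly_values_smult[OF B(1) h(2) e(1) b(2)] .
      have c: "b \<in> carrier R" "x \<in> carrier R" "e \<in> carrier R" "y \<in> carrier R"
        using b e Bs(1) y poly_values_closed[OF B(1) h(2)] by auto
      have "s \<otimes> (b \<oplus> x \<otimes> u') \<ominus> s \<otimes> b = s \<otimes> x \<otimes> u'" using c sc h(2) by algebra
      then have "\<one> \<ominus> s \<otimes> b = s \<otimes> x \<otimes> u'" using h(7) b(3) by simp
      then have "e \<otimes> (s \<otimes> x \<otimes> u') = \<one>" using e(2) by simp
      then have 1: "s \<otimes> y \<otimes> u' = \<one>" using c sc h(2) unfolding y_def by (simp add: m_ac)
      define z where "z = y \<otimes> u [^] k"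
      have z: "z \<in> poly_values B u k" unfolding z_def
        using poly_values_reverse[OF B(1) h(1,2) _ y] h(3) h(1,2) by (simp add: m_comm)
      have zc: "z \<in> carrier R" using z poly_values_closed[OF B(1) h(1)] by blast
      have uk: "u [^] k \<in> carrier R" using h(1) by simp
      \<comment> \<open>Inverting \<open>1 - s b\<close> has left \<open>s y u' = 1\<close> with
        \<open>y\<close> of degree \<open>k = j - 1\<close> in \<open>u'\<close>. Multiplication by
        \<open>u^j\<close> turns \<open>y\<close> into \<open>z\<close>, of degree at most
        \<open>k\<close> in \<open>u\<close>.\<close>
      have uj: "u [^] j = s \<otimes> z"
      proof -
        have "u [^] j = (s \<otimes> y \<otimes> u') \<otimes> (u [^] k \<otimes> u)" unfolding 1 Suc using h(1) by simp
        also have "\<dots> = (s \<otimes> (y \<otimes> u [^] k)) \<otimes> (u \<otimes> u')" using c h(1,2) sc uk by algebra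
        finally show ?thesis using h(3) zc sc unfolding z_def by simp
      qed
      obtain l where l: "i = Suc l" "k \<le> l" using h(8) Suc by (cases i) auto
      have ui: "u [^] i = s \<otimes> (z \<otimes> u [^] (l - k))"
      proof -
        have "u [^] i = u [^] j \<otimes> u [^] (l - k)" using h(1) l Suc nat_pow_mult[of u j "l - k"] by simp
        then show ?thesis unfolding uj using zc sc h(1) by (simp add: m_assoc)
      qed
      have "u [^] (l - k) \<in> poly_values B u (l - k)"
        using poly_values_power[OF B(1) h(1)] .
      then have zl: "z \<otimes> u [^] (l - k) \<in> poly_values B u l"
        using poly_values_mult[OF B(1) h(1) _ z] l by fastforce
      obtain v' d where v: "v = v' \<oplus> d \<otimes> u [^] Suc l" "v' \<in> poly_values B u l" "d \<in> B"
        using h(4) l(1) unfolding poly_values.simps l(1) by blast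
      \<comment> \<open>The leading power \<open>u^i\<close> is \<open>s\<close> times an expression
        of degree at most \<open>l = i - 1\<close>, so \<open>v\<close> already has degree at most
        \<open>l\<close>.\<close>
      have "v \<in> poly_values B u l" unfolding v(1)
        using poly_values_add[OF B(1) h(1) v(2) poly_values_smult[OF B(1) h(1) v(3) poly_values_smult[OF B(1) h(1) sB zl]]]
         ui l(1) by simp
      from less(1)[OF _ h(1,2,3) this h(5,6,7)] show ?thesis using h(9) l by simp
    qed
    show ?case
    proof (cases "m \<le> n")
      case True then show ?thesis using *[OF less.prems] by simp
    next
      case False
      then show ?thesis using *[OF less.prems(2,1) _ less.prems(6,7,4,5)] less.prems(1-3) by (simp add: m_comm)
    qed
  qed
  show ?thesis
  proof (intro exI[of _ B] conjI ballI impI)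
    fix u v assume "u \<in> carrier R" "v \<in> carrier R" "u \<otimes> v = \<one>"
    then show "u \<in> B \<or> v \<in> B" using ext[of u] ext[of v] key by blast
  qed (use B in auto)
qed

section \<open>Division rings\<close>

context skew_field
begin

lemma nonzero_inv:
  assumes "a \<in> carrier D" "a \<noteq> \<zero>"
  shows "inv a \<in> carrier D" "inv a \<noteq> \<zero>" "a \<otimes> inv a = \<one>" "inv a \<otimes> a = \<one>"
proof -
  have u: "a \<in> Units D" using assms skew_field_Units by auto
  then show "inv a \<in> carrier D" "a \<otimes> inv a = \<one>" "inv a \<otimes> a = \<one>" by auto
  from Units_inv_Units[OF u] show "inv a \<noteq> \<zero>" using skew_field_Units by auto
qed

lemma cancel_left_inv:
  assumes "a \<in> carrier D" "a \<noteq> \<zero>" "b \<in> carrier D"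
  shows "inv a \<otimes> (a \<otimes> b) = b" "a \<otimes> (inv a \<otimes> b) = b"
  using nonzero_inv[OF assms(1,2)] assms by (simp_all flip: m_assoc)

lemma integral:
  assumes "a \<otimes> b = \<zero>" "a \<in> carrier D" "b \<in> carrier D"
  shows "a = \<zero> \<or> b = \<zero>"
proof (rule disjCI)
  assume "b \<noteq> \<zero>"
  then have "a = (a \<otimes> b) \<otimes> inv b" using nonzero_inv[OF assms(3)] assms(2,3) by (simp add: m_assoc)
  then show "a = \<zero>" using nonzero_inv[OF assms(3) \<open>b \<noteq> \<zero>\<close>] assms by simp
qed

lemma mult_nonzero: "a \<in> carrier D \<Longrightarrow> b \<in> carrier D \<Longrightarrow> a \<noteq> \<zero> \<Longrightarrow> b \<noteq> \<zero> \<Longrightarrow> a \<otimes> b \<noteq> \<zero>"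
  using integral by blast

lemma pow_nonzero: "a \<in> carrier D \<Longrightarrow> a \<noteq> \<zero> \<Longrightarrow> a [^] (n::nat) \<noteq> \<zero>"
  by (induction n) (auto simp: one_not_zero mult_nonzero)

lemma inv_eqI: "a \<in> carrier D \<Longrightarrow> b \<in> carrier D \<Longrightarrow> a \<otimes> b = \<one> \<Longrightarrow> inv a = b"
  using nonzero_inv[of a] one_not_zero by (metis cancel_left_inv(1) l_null r_one)

lemma mult_cancel_left:
  "a \<in> carrier D \<Longrightarrow> a \<noteq> \<zero> \<Longrightarrow> b \<in> carrier D \<Longrightarrow> c \<in> carrier D \<Longrightarrow> a \<otimes> b = a \<otimes> c \<longleftrightarrow> b = c"
  by (metis cancel_left_inv(1))

lemma mult_cancel_right:
  assumes "a \<in> carrier D" "a \<noteq> \<zero>" "b \<in> carrier D" "c \<in> carrier D" 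
  shows "b \<otimes> a = c \<otimes> a \<longleftrightarrow> b = c"
proof
  assume "b \<otimes> a = c \<otimes> a"
  then have "b \<otimes> a \<otimes> inv a = c \<otimes> a \<otimes> inv a" by simp
  then show "b = c" using assms nonzero_inv[OF assms(1,2)] by (simp add: m_assoc)
qed simp

lemma inv_mult_distrib:
  assumes "a \<in> carrier D" "b \<in> carrier D" "a \<noteq> \<zero>" "b \<noteq> \<zero>"
  shows "inv (a \<otimes> b) = inv b \<otimes> inv a"
  using assms nonzero_inv by (intro inv_eqI) (simp_all add: m_assoc cancel_left_inv)

lemma center_closed: "c \<in> ring_center D \<Longrightarrow> c \<in> carrier D"
  by (simp add: ring_center_def)

lemma centerI: "c \<in> carrier D \<Longrightarrow> (\<And>d. d \<in> carrier D \<Longrightarrow> c \<otimes> d = d \<otimes> c) \<Longrightarrow> c \<in> ring_center D"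
  by (simp add: ring_center_def)

lemma center_comm: "c \<in> ring_center D \<Longrightarrow> a \<in> carrier D \<Longrightarrow> a \<otimes> c = c \<otimes> a"
  by (simp add: ring_center_def)

lemma center_left_comm:
  "c \<in> ring_center D \<Longrightarrow> a \<in> carrier D \<Longrightarrow> b \<in> carrier D \<Longrightarrow> a \<otimes> (c \<otimes> b) = c \<otimes> (a \<otimes> b)"
  using center_comm[of c a] center_closed[of c] by (simp flip: m_assoc)

lemma subring_center: "subring (ring_center D) D"
proof (rule subringI)
  fix a b assume ab: "a \<in> ring_center D" "b \<in> ring_center D"
  have "a \<otimes> b \<otimes> d = d \<otimes> (a \<otimes> b)" if d: "d \<in> carrier D" for d
    using center_left_comm[OF ab(1) d] center_comm[OF ab(2) d] ab d center_closed by (simp add: m_assoc)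
  then show "a \<otimes> b \<in> ring_center D" using ab center_closed by (intro centerI) auto
  have "(a \<oplus> b) \<otimes> d = d \<otimes> (a \<oplus> b)" if d: "d \<in> carrier D" for d
    using center_comm[OF ab(1) d] center_comm[OF ab(2) d] ab d center_closed by (simp add: l_distr r_distr)
  then show "a \<oplus> b \<in> ring_center D" using ab center_closed by (intro centerI) auto
next
  fix a assume a: "a \<in> ring_center D"
  have "\<ominus> a \<otimes> d = d \<otimes> \<ominus> a" if d: "d \<in> carrier D" for d
    using center_comm[OF a d] a d center_closed by (simp add: l_minus r_minus)
  then show "\<ominus> a \<in> ring_center D" using a center_closed by (intro centerI) auto
qed (auto simp: center_closed intro: centerI)

lemma inv_commute:
  assumes "a \<in> carrier D" "a \<noteq> \<zero>" "b \<in> carrier D" "a \<otimes> b = b \<otimes> a"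
  shows "inv a \<otimes> b = b \<otimes> inv a"
proof -
  have "inv a \<otimes> b = inv a \<otimes> ((b \<otimes> a) \<otimes> inv a)"
    using nonzero_inv[OF assms(1,2)] assms(1-3) by (simp add: m_assoc)
  also have "\<dots> = inv a \<otimes> ((a \<otimes> b) \<otimes> inv a)" using assms(4) by simp
  also have "\<dots> = b \<otimes> inv a"
    using nonzero_inv[OF assms(1,2)] assms(1-3) by (simp add: m_assoc cancel_left_inv)
  finally show ?thesis .
qed

lemma inv_center: "c \<in> ring_center D \<Longrightarrow> c \<noteq> \<zero> \<Longrightarrow> inv c \<in> ring_center D"
  using nonzero_inv[of c] inv_commute[of c] center_closed[of c] center_comm[of c] by (intro centerI) auto

lemma field_center: "field (D\<lparr>carrier := ring_center D\<rparr>)"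
proof -
  interpret C: ring "D\<lparr>carrier := ring_center D\<rparr>" using subring_is_ring[OF subring_center] .
  have "cring (D\<lparr>carrier := ring_center D\<rparr>)"
    by unfold_locales (auto intro: center_comm center_closed)
  then interpret C: cring "D\<lparr>carrier := ring_center D\<rparr>" .
  show ?thesis
  proof (rule C.cring_fieldI2)
    fix a assume a: "a \<in> carrier (D\<lparr>carrier := ring_center D\<rparr>)" "a \<noteq> \<zero>\<^bsub>D\<lparr>carrier := ring_center D\<rparr>\<^esub>"
    then show "\<exists>b\<in>carrier (D\<lparr>carrier := ring_center D\<rparr>). a \<otimes>\<^bsub>D\<lparr>carrier := ring_center D\<rparr>\<^esub> b = \<one>\<^bsub>D\<lparr>carrier := ring_center D\<rparr>\<^esub>"
      using inv_center[of a] nonzero_inv[of a] center_closed by auto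
  qed (use one_not_zero in simp)
qed

lemma subfield_center: "subfield (ring_center D) D"
  using subfield_iff(1)[OF field_center] center_closed by auto

section \<open>Natural multiples of one and the characteristic\<close>

abbreviation nmult :: "nat \<Rightarrow> 'a \<Rightarrow> 'a" where
  "nmult n a \<equiv> add_pow D n a"

lemma nat_multiple: "a \<in> carrier D \<Longrightarrow> nmult n a = (nmult n \<one>) \<otimes> a"
  by (simp add: add_pow_ldistr)

lemma nat_multiple_center: "nmult n \<one> \<in> ring_center D"
  by (induction n) (use subringE(2,3,7)[OF subring_center] in auto)

lemma nat_multiple_mult: "(nmult m \<one>) \<otimes> (nmult n \<one>) = nmult (m * n) \<one>"
  by (metis add.nat_pow_closed add.nat_pow_pow mult.commute nat_multiple one_closed)

lemma characteristic_prime: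
  assumes "(n::nat) > 0" "nmult n \<one> = \<zero>"
  shows "\<exists>p::nat. Factorial_Ring.prime p \<and> p dvd n \<and> nmult p \<one> = \<zero>"
  using assms
proof (induction n rule: less_induct)
  case (less n)
  have "n \<noteq> 1" using less.prems one_not_zero by auto
  then obtain q where q: "Factorial_Ring.prime q" "q dvd n" using prime_factor_nat by blast
  then obtain m where m: "n = q * m" by blast
  have "(nmult q \<one>) \<otimes> (nmult m \<one>) = \<zero>" using less.prems m nat_multiple_mult by simp
  then consider "nmult q \<one> = \<zero>" | "nmult m \<one> = \<zero>" using integral by auto
  then show ?case
  proof cases
    case 2
    have "m < n" "m > 0" using m less.prems q prime_gt_1_nat[OF q(1)] by auto
    then show ?thesis using less.IH[OF _ _ 2] m by auto
  qed (use q in blast)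
qed

section \<open>Inner automorphisms\<close>

definition conjugate :: "'a \<Rightarrow> 'a \<Rightarrow> 'a" where
  "conjugate x d = x \<otimes> d \<otimes> inv x"

context
  fixes x assumes x: "x \<in> carrier D" "x \<noteq> \<zero>"
begin

lemma conj_closed [simp]: "d \<in> carrier D \<Longrightarrow> conjugate x d \<in> carrier D"
  using x nonzero_inv[OF x] by (simp add: conjugate_def)

lemma conj_add: "a \<in> carrier D \<Longrightarrow> b \<in> carrier D \<Longrightarrow> conjugate x (a \<oplus> b) = conjugate x a \<oplus> conjugate x b"
  using x nonzero_inv[OF x] by (simp add: conjugate_def l_distr r_distr)

lemma conj_mult: "a \<in> carrier D \<Longrightarrow> b \<in> carrier D \<Longrightarrow> conjugate x (a \<otimes> b) = conjugate x a \<otimes> conjugate x b"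
  using x nonzero_inv[OF x] by (simp add: conjugate_def m_assoc cancel_left_inv)

lemma conj_center: "c \<in> ring_center D \<Longrightarrow> conjugate x c = c"
  using x nonzero_inv[OF x] center_closed[of c] by (simp add: conjugate_def center_comm m_assoc)

lemma conj_scale: "c \<in> ring_center D \<Longrightarrow> a \<in> carrier D \<Longrightarrow> conjugate x (c \<otimes> a) = c \<otimes> conjugate x a"
  using conj_mult[of c a] conj_center center_closed by simp

lemma conj_eq_iff:
  assumes "d \<in> carrier D" "e \<in> carrier D"
  shows "conjugate x d = e \<longleftrightarrow> x \<otimes> d = e \<otimes> x"
proof -
  have "conjugate x d \<otimes> x = x \<otimes> d" using assms x nonzero_inv[OF x] by (simp add: conjugate_def m_assoc)
  then show ?thesis using mult_cancel_right[OF x conj_closed[OF assms(1)] assms(2)] by simp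
qed

lemma conj_pow: "d \<in> carrier D \<Longrightarrow> conjugate x (d [^] (n::nat)) = conjugate x d [^] n"
  by (induction n) (use x nonzero_inv[OF x] in \<open>auto simp: conj_mult, simp add: conjugate_def\<close>)

lemma conj_nonzero: "d \<in> carrier D \<Longrightarrow> d \<noteq> \<zero> \<Longrightarrow> conjugate x d \<noteq> \<zero>"
  using x nonzero_inv[OF x] by (simp add: conjugate_def mult_nonzero)

lemma conj_inv: "d \<in> carrier D \<Longrightarrow> d \<noteq> \<zero> \<Longrightarrow> conjugate x (inv d) = inv (conjugate x d)"
  using nonzero_inv[of d] conj_mult[of d "inv d"] x nonzero_inv[OF x]
  by (intro inv_eqI[symmetric]) (auto simp: conj_center, simp add: conjugate_def)

lemma conj_inj: "d \<in> carrier D \<Longrightarrow> e \<in> carrier D \<Longrightarrow> conjugate x d = conjugate x e \<Longrightarrow> d = e"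
  unfolding conjugate_def using x nonzero_inv[OF x] by (simp add: mult_cancel_left mult_cancel_right)

lemma conj_iterate: "d \<in> carrier D \<Longrightarrow> (conjugate x ^^ n) d = conjugate (x [^] n) d"
proof (induction n)
  case 0 then show ?case by (simp add: conjugate_def)
next
  case (Suc n)
  define y where "y = x [^] n"
  have y: "y \<in> carrier D" "y \<noteq> \<zero>" using x pow_nonzero by (auto simp: y_def)
  have "x [^] Suc n = x \<otimes> y" unfolding y_def by (rule nat_pow_Suc2[OF x(1)])
  then have "conjugate x (conjugate y d) = conjugate (x [^] Suc n) d"
    using Suc.prems x y nonzero_inv[OF x] nonzero_inv[OF y]
    by (simp add: conjugate_def m_assoc inv_mult_distrib)
  then show ?case using Suc.IH[OF Suc.prems] by (simp add: y_def)
qed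

end

lemma pow_mult_commute:
  assumes "a \<in> carrier D" "b \<in> carrier D" "a \<otimes> b = b \<otimes> a"
  shows "(a \<otimes> b) [^] (n::nat) = a [^] n \<otimes> b [^] n"
  using pow_mult_distrib[OF assms(3,1,2)] .

section \<open>Additive maps, a common setting for conjugations and left multiplications\<close>

definition additive_map :: "('a \<Rightarrow> 'a) \<Rightarrow> bool" where
  "additive_map f \<longleftrightarrow> f \<in> carrier D \<rightarrow> carrier D \<and>
     (\<forall>a\<in>carrier D. \<forall>b\<in>carrier D. f (a \<oplus> b) = f a \<oplus> f b)"

lemma additive_map_conj: "x \<in> carrier D \<Longrightarrow> x \<noteq> \<zero> \<Longrightarrow> additive_map (conjugate x)"
  by (simp add: additive_map_def conj_add)

lemma additive_map_mult: "x \<in> carrier D \<Longrightarrow> additive_map ((\<otimes>) x)"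
  by (simp add: additive_map_def r_distr)

context
  fixes f assumes f: "additive_map f"
begin

lemma additive_closed: "d \<in> carrier D \<Longrightarrow> f d \<in> carrier D"
  using f by (auto simp: additive_map_def)

lemma additive_add: "a \<in> carrier D \<Longrightarrow> b \<in> carrier D \<Longrightarrow> f (a \<oplus> b) = f a \<oplus> f b"
  using f by (auto simp: additive_map_def)

lemma additive_zero: "f \<zero> = \<zero>"
  using additive_add[of \<zero> \<zero>] additive_closed[of \<zero>] by (simp add: add.r_cancel_one')

lemma additive_minus: "a \<in> carrier D \<Longrightarrow> f (\<ominus> a) = \<ominus> f a"
  using additive_add[of "\<ominus> a" a] additive_zero additive_closed by (simp add: l_neg minus_equality)

lemma additive_nat_multiple: "a \<in> carrier D \<Longrightarrow> f (nmult n a) = nmult n (f a)"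
  by (induction n) (auto simp: additive_zero additive_add)

lemma additive_iterate: "additive_map (f ^^ n)"
  by (induction n) (use f in \<open>auto simp: additive_map_def Pi_iff\<close>)

lemma additive_finsum:
  assumes "finite I" "g \<in> I \<rightarrow> carrier D"
  shows "f (\<Oplus>i\<in>I. g i) = (\<Oplus>i\<in>I. f (g i))"
  using assms
proof (induction I rule: finite_induct)
  case (insert i I)
  then have "g \<in> I \<rightarrow> carrier D" "g i \<in> carrier D" "(\<lambda>i. f (g i)) \<in> I \<rightarrow> carrier D" 
    using additive_closed by auto
  then have "f (\<Oplus>j\<in>insert i I. g j) = f (g i) \<oplus> f (\<Oplus>j\<in>I. g j)"
    using insert.hyps by (simp add: additive_add)
  also have "f (\<Oplus>j\<in>I. g j) = (\<Oplus>j\<in>I. f (g j))" using insert.IH \<open>g \<in> I \<rightarrow> carrier D\<close> by simp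
  finally show ?case using insert.hyps \<open>(\<lambda>i. f (g i)) \<in> I \<rightarrow> carrier D\<close> \<open>g i \<in> carrier D\<close> additive_closed by simp
qed (simp add: additive_zero)

end

text \<open>\<open>f = 1 + (f - 1)\<close>, expanded by the binomial theorem.\<close>

lemma iterate_binomial:
  assumes f: "additive_map f" and g: "\<And>d. g d = f d \<ominus> d" and d: "d \<in> carrier D"
  shows "(f ^^ n) d = (\<Oplus>k\<in>{..n}. nmult (n choose k) ((g ^^ k) d))"
proof -
  have ag: "additive_map g"
    using additive_closed[OF f] unfolding additive_map_def g
    by (auto simp: additive_add[OF f] a_minus_def minus_add a_ac)
  define h where "h k = (g ^^ k) d" for k
  have hc: "h k \<in> carrier D" for k
    unfolding h_def by (induction k) (use d g additive_closed[OF f] in auto)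
  have h0: "h 0 = d" and gh: "g (h k) = h (Suc k)" for k by (simp_all add: h_def)
  have "(f ^^ n) d = (\<Oplus>k\<in>{..n}. nmult (n choose k) (h k))"
  proof (induction n)
    case 0 then show ?case using d h0 by simp
  next
    case (Suc n)
    let ?A = "\<Oplus>k\<in>{..n}. nmult (n choose k) (h k)"
    let ?B = "\<Oplus>k\<in>{..n}. nmult (n choose k) (h (Suc k))"
    let ?C = "\<Oplus>k\<in>{..n}. nmult (n choose Suc k) (h (Suc k))"
    have A: "?A \<in> carrier D" and BC: "?B \<in> carrier D" "?C \<in> carrier D"
      using hc by (auto intro!: finsum_closed)
    have "f ?A = ?A \<oplus> g ?A" unfolding g using A additive_closed[OF f, of ?A]
      by (simp add: a_minus_def a_lcomm[of ?A] r_neg)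
    also have "g ?A = ?B"
      using hc by (subst additive_finsum[OF ag]) (auto simp: Pi_iff additive_nat_multiple[OF ag] gh)
    finally have fA: "f ?A = ?A \<oplus> ?B" .
    have "?A = ?C \<oplus> d"
    proof -
      have "(\<Oplus>k\<in>{..Suc n}. nmult (n choose k) (h k)) = ?A"
        using hc by (subst finsum_Suc) (auto simp: binomial_eq_0)
      moreover have "(\<Oplus>k\<in>{..Suc n}. nmult (n choose k) (h k)) = ?C \<oplus> d"
        using hc d h0 by (subst finsum_Suc2) auto
      ultimately show ?thesis by simp
    qed
    then have "?A \<oplus> ?B = ?C \<oplus> d \<oplus> ?B" by (rule arg_cong)
    also have "?C \<oplus> d \<oplus> ?B = (?C \<oplus> ?B) \<oplus> d" using BC d by (simp add: a_ac)
    also have "?C \<oplus> ?B = (\<Oplus>k\<in>{..n}. nmult (n choose Suc k) (h (Suc k)) \<oplus> nmult (n choose k) (h (Suc k)))"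
      using hc by (intro finsum_addf[symmetric]) auto
    also have "\<dots> = (\<Oplus>k\<in>{..n}. nmult (Suc n choose Suc k) (h (Suc k)))"
      using hc by (intro finsum_cong') (auto simp: add.nat_pow_mult add.commute)
    also have "\<dots> \<oplus> d = (\<Oplus>k\<in>{..Suc n}. nmult (Suc n choose k) (h k))"
      using hc d h0 by (subst finsum_Suc2) auto
    finally show ?case using Suc fA by simp
  qed
  then show ?thesis by (simp add: h_def)
qed

text \<open>In characteristic \<open>p\<close> the inner binomial coefficients vanish, so
  \<open>f^p = 1\<close> becomes \<open>(f - 1)^p = 0\<close>. The last two nonzero terms of the
  sequence \<open>d\<close>, \<open>(f - 1) d\<close>, ... are \<open>e\<close> and its fixed
  difference.\<close>

lemma additive_unipotent:
  assumes f: "additive_map f" and p: "Factorial_Ring.prime p" "nmult p \<one> = \<zero>"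
    and fp: "\<And>d. d \<in> carrier D \<Longrightarrow> (f ^^ p) d = d"
    and d: "d \<in> carrier D" "f d \<noteq> d"
  shows "\<exists>e\<in>carrier D. f e \<noteq> e \<and> f (f e \<ominus> e) = f e \<ominus> e"
proof -
  define g where "g = (\<lambda>d. f d \<ominus> d)"
  have gc: "(g ^^ k) d \<in> carrier D" for k
    by (induction k) (use d g_def additive_closed[OF f] in auto)
  \<comment> \<open>With \<open>p = q + 2\<close>, the sum without its first and last terms runs
    over \<open>Suc k\<close> for \<open>k \<le> q\<close>, that is, from \<open>1\<close> to
    \<open>p - 1\<close>.\<close>
  obtain q where q: "p = Suc (Suc q)" using prime_ge_2_nat[OF p(1)] by (metis Suc_le_D numeral_2_eq_2 Suc_le_mono)
  have pz: "nmult (p * m) a = \<zero>" if "a \<in> carrier D" for m a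
    using that p(2) nat_multiple[of a p] by (simp flip: add.nat_pow_pow)
  have "(f ^^ p) d = (\<Oplus>k\<in>{..p}. nmult (p choose k) ((g ^^ k) d))"
    using iterate_binomial[OF f _ d(1), of g] by (simp add: g_def)
  also have "\<dots> = (g ^^ p) d \<oplus> ((\<Oplus>k\<in>{..q}. nmult (p choose Suc k) ((g ^^ Suc k) d)) \<oplus> d)"
    unfolding q using gc gc[of "Suc _"] d
    by (subst finsum_Suc, simp del: funpow.simps, subst finsum_Suc2) (auto simp del: funpow.simps binomial_Suc_Suc)
  also have "(\<Oplus>k\<in>{..q}. nmult (p choose Suc k) ((g ^^ Suc k) d)) = (\<Oplus>k\<in>{..q}. \<zero>)"
  proof (intro finsum_cong')
    fix k assume "k \<in> {..q}"
    then have "p dvd (p choose Suc k)" using p(1) q by (intro dvd_choose_prime) auto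
    then show "nmult (p choose Suc k) ((g ^^ Suc k) d) = \<zero>" using pz gc[of "Suc k"] by (auto elim!: dvdE)
  qed auto
  finally have "d = (g ^^ p) d \<oplus> d" using fp[OF d(1)] d(1) by simp
  then have "(g ^^ p) d = \<zero>" using d gc[of p] by (metis add.r_cancel_one')
  define k where "k = (LEAST k. (g ^^ k) d = \<zero>)"
  have k: "(g ^^ k) d = \<zero>" unfolding k_def by (rule LeastI) fact
  have least: "(g ^^ j) d \<noteq> \<zero>" if "j < k" for j using that not_less_Least unfolding k_def by blast
  have fg: "f a = a \<longleftrightarrow> g a = \<zero>" if "a \<in> carrier D" for a
    unfolding g_def using that additive_closed[OF f] by simp
  have "k \<noteq> 0" using k d additive_zero[OF f] by (metis funpow_0)
  moreover have "k \<noteq> 1" using k d fg by auto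
  ultimately obtain j where j: "k = Suc (Suc j)" by (metis One_nat_def nat.exhaust)
  let ?e = "(g ^^ j) d"
  have "f ?e \<noteq> ?e" using fg[OF gc] least[of "Suc j"] j by simp
  moreover have "f (g ?e) = g ?e" using fg[OF gc, of "Suc j"] k j by simp
  ultimately show ?thesis using gc unfolding g_def by blast
qed

text \<open>If \<open>y\<close> differed from one, left multiplication by it would be unipotent and
  nontrivial, and would fix a nonzero \<open>y e - e\<close>, which can be cancelled.\<close>

lemma prime_root_of_one:
  assumes p: "Factorial_Ring.prime p" "nmult p \<one> = \<zero>" and y: "y \<in> carrier D" "y [^] p = \<one>"
  shows "y = \<one>"
proof (rule ccontr)
  assume "y \<noteq> \<one>"
  have iter: "((\<otimes>) y ^^ j) d = y [^] j \<otimes> d" if "d \<in> carrier D" for j d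
    by (induction j) (use that y nat_pow_Suc2[OF y(1)] in \<open>auto simp: m_assoc simp del: nat_pow_Suc\<close>)
  have "y \<otimes> \<one> \<noteq> \<one>" using y \<open>y \<noteq> \<one>\<close> by simp
  then obtain e where e: "e \<in> carrier D" "y \<otimes> e \<noteq> e" "y \<otimes> (y \<otimes> e \<ominus> e) = y \<otimes> e \<ominus> e"
    using additive_unipotent[OF additive_map_mult[OF y(1)] p, of \<one>] iter y by auto
  have "y \<otimes> e \<ominus> e \<noteq> \<zero>" using e y by simp
  then have "y = \<one>" using e y mult_cancel_right[of "y \<otimes> e \<ominus> e" y \<one>] by simp
  then show False using \<open>y \<noteq> \<one>\<close> by simp
qed

end

section \<open>Congruence subgroups of an order\<close>

text \<open>Smallness in \<open>D\<close> is measured by the order alone.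
  \<open>primitive_multiple\<close> replaces scaling an element to value zero: the scaled element
  lies in \<open>\<Lambda>\<close> and is divisible there by no nonunit of \<open>V\<close>.
  \<open>delta_prime\<close> makes \<open>\<delta> / q\<close> a nonunit, which is what excludes
  \<open>q\<close>-torsion near one.\<close>

locale valued_order = skew_field D for D (structure) +
  fixes V \<Lambda> :: "'a set" and \<delta> :: 'a
  assumes V_subring: "subring V D" and V_central: "V \<subseteq> ring_center D"
    and valuation: "\<lbrakk>u \<in> ring_center D; v \<in> ring_center D; u \<otimes> v = \<one>\<rbrakk> \<Longrightarrow> u \<in> V \<or> v \<in> V"
    and order_subring: "subring \<Lambda> D" and V_order: "V \<subseteq> \<Lambda>"
    and scaling: "d \<in> carrier D \<Longrightarrow> \<exists>s\<in>V. s \<noteq> \<zero> \<and> s \<otimes> d \<in> \<Lambda>"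
    and primitive_multiple: "\<lbrakk>d \<in> carrier D; d \<noteq> \<zero>\<rbrakk> \<Longrightarrow>
      \<exists>c\<in>ring_center D. c \<otimes> d \<in> \<Lambda> \<and> (\<forall>m\<in>V. (\<forall>v\<in>V. m \<otimes> v \<noteq> \<one>) \<longrightarrow> (\<forall>l\<in>\<Lambda>. c \<otimes> d \<noteq> m \<otimes> l))"
    and delta: "\<delta> \<in> V" "\<delta> \<noteq> \<zero>" "\<And>v. v \<in> V \<Longrightarrow> \<delta> \<otimes> v \<noteq> \<one>"
    and delta_prime: "\<And>q. Factorial_Ring.prime q \<Longrightarrow> nmult q \<one> \<noteq> \<zero> \<Longrightarrow>
      \<exists>m\<in>V. (\<forall>v\<in>V. m \<otimes> v \<noteq> \<one>) \<and> \<delta> = nmult q \<one> \<otimes> m"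
begin

lemmas order_closed = subsetD[OF subringE(1)[OF order_subring]]
lemmas V_center = subsetD[OF V_central]
lemmas V_in_order = subsetD[OF V_order]
lemmas V_closed = center_closed[OF V_center]
lemmas order_props = subringE(2,3,5,6,7)[OF order_subring]
lemmas V_props = subringE(2,3,5,6,7)[OF V_subring]

definition congruence :: "'a \<Rightarrow> 'a set" where
  "congruence e = {\<one> \<oplus> e \<otimes> l | l. l \<in> \<Lambda>}"

lemma congruence_closed: "e \<in> V \<Longrightarrow> g \<in> congruence e \<Longrightarrow> g \<in> carrier D"
  using order_closed V_closed unfolding congruence_def by auto

lemma congruence_one: "e \<in> V \<Longrightarrow> \<one> \<in> congruence e"
  unfolding congruence_def using order_props V_closed by (intro CollectI exI[of _ \<zero>]) auto

lemma congruence_mult: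
  assumes e: "e \<in> V" and g: "g \<in> congruence e" and h: "h \<in> congruence e"
  shows "g \<otimes> h \<in> congruence e"
proof -
  obtain l m where l: "g = \<one> \<oplus> e \<otimes> l" "l \<in> \<Lambda>" and m: "h = \<one> \<oplus> e \<otimes> m" "m \<in> \<Lambda>"
    using g h unfolding congruence_def by blast
  have c: "e \<in> carrier D" "l \<in> carrier D" "m \<in> carrier D" using e l m V_closed order_closed by auto
  have "g \<otimes> h = \<one> \<oplus> e \<otimes> (l \<oplus> m \<oplus> l \<otimes> (e \<otimes> m))"
    unfolding l m using c by (simp add: l_distr r_distr m_assoc a_ac)
  moreover have "l \<oplus> m \<oplus> l \<otimes> (e \<otimes> m) \<in> \<Lambda>" using l m V_in_order[OF e] order_props by auto
  ultimately show ?thesis unfolding congruence_def by blast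
qed

lemma congruence_pow: "e \<in> V \<Longrightarrow> g \<in> congruence e \<Longrightarrow> g [^] (n::nat) \<in> congruence e"
  by (induction n) (auto simp: congruence_one congruence_mult)

lemma congruence_weaken:
  assumes "s \<in> V" "e \<in> V" "g \<in> congruence (s \<otimes> e)"
  shows "g \<in> congruence e"
proof -
  obtain l where l: "g = \<one> \<oplus> s \<otimes> e \<otimes> l" "l \<in> \<Lambda>" using assms(3) unfolding congruence_def by blast
  have "s \<otimes> e \<otimes> l = e \<otimes> (s \<otimes> l)"
    using center_left_comm[OF V_center[OF assms(2)], of s l] V_closed assms order_closed[OF l(2)] by (simp add: m_assoc)
  moreover have "s \<otimes> l \<in> \<Lambda>" using V_in_order assms l order_props by auto
  ultimately show ?thesis unfolding congruence_def l(1) by auto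
qed

text \<open>Scale the inverse \<open>z\<close> by \<open>k\<close> to a primitive element; then
  \<open>k z = k - e w\<close> with \<open>w\<close> in \<open>\<Lambda>\<close>. If
  \<open>inv k\<close> were not in \<open>V\<close>, then \<open>k\<close> would be a nonunit of
  \<open>V\<close>, one of the nonunits \<open>k\<close> and \<open>e\<close> would divide the
  other, and it would divide \<open>k z\<close> against primitivity. So \<open>inv k\<close> lies in
  \<open>V\<close> and \<open>z\<close> in \<open>\<Lambda>\<close>.\<close>

lemma congruence_inv:
  assumes e: "e \<in> V" "\<And>v. v \<in> V \<Longrightarrow> e \<otimes> v \<noteq> \<one>" and g: "g \<in> congruence e"
  shows "g \<noteq> \<zero>" "inv g \<in> congruence e"
proof -
  obtain l where l: "g = \<one> \<oplus> e \<otimes> l" "l \<in> \<Lambda>" using g unfolding congruence_def by blast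
  have c: "e \<in> carrier D" "l \<in> carrier D" "g \<in> carrier D" "e \<in> ring_center D"
    using e l V_closed order_closed congruence_closed[OF e(1) g] V_center by auto
  show g0: "g \<noteq> \<zero>"
  proof
    assume "g = \<zero>"
    then have "\<one> = e \<otimes> (\<ominus> l)" using l c by (simp add: r_minus minus_equality)
    obtain k where k: "k \<in> ring_center D" "k \<otimes> \<one> \<in> \<Lambda>" "\<And>l. l \<in> \<Lambda> \<Longrightarrow> k \<otimes> \<one> \<noteq> e \<otimes> l"
      using primitive_multiple[of \<one>] one_not_zero e by auto
    have kc: "k \<in> carrier D" using k center_closed by auto
    have "k \<otimes> \<one> = e \<otimes> (k \<otimes> (\<ominus> l))"
      using \<open>\<one> = e \<otimes> (\<ominus> l)\<close> center_left_comm[OF c(4) kc, of "\<ominus> l"] c by simp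
    moreover have "k \<otimes> (\<ominus> l) \<in> \<Lambda>" using k kc l order_props by auto
    ultimately show False using k by blast
  qed
  define z where "z = inv g"
  have z: "z \<in> carrier D" "z \<noteq> \<zero>" "g \<otimes> z = \<one>" using nonzero_inv[OF c(3) g0] by (auto simp: z_def)
  obtain k where k: "k \<in> ring_center D" "k \<otimes> z \<in> \<Lambda>"
    "\<And>m l. m \<in> V \<Longrightarrow> \<forall>v\<in>V. m \<otimes> v \<noteq> \<one> \<Longrightarrow> l \<in> \<Lambda> \<Longrightarrow> k \<otimes> z \<noteq> m \<otimes> l"
    using primitive_multiple[OF z(1,2)] by blast
  have kc: "k \<in> carrier D" using k center_closed by auto
  have k0: "k \<noteq> \<zero>" using k(3)[OF e(1) _ order_props(1)] e z c by auto
  have "g \<otimes> (k \<otimes> z) = k" using center_left_comm[OF k(1) c(3) z(1)] z kc by simp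
  then have eq: "k \<otimes> z \<oplus> e \<otimes> (l \<otimes> (k \<otimes> z)) = k"
    using c kc z unfolding l by (simp add: l_distr m_assoc)
  define w where "w = l \<otimes> (k \<otimes> z)"
  have w: "w \<in> \<Lambda>" "w \<in> carrier D" using k l order_props order_closed by (auto simp: w_def)
  have kz: "k \<otimes> z = k \<ominus> e \<otimes> w" using eq c w kc z unfolding w_def[symmetric]
    by (metis add.inv_solve_right a_minus_def m_closed)
  have "inv k \<in> V"
  proof (rule ccontr)
    assume n: "inv k \<notin> V"
    note ki = nonzero_inv[OF kc k0]
    have kV: "k \<in> V" using n valuation[OF k(1) inv_center[OF k(1) k0]] ki by auto
    have ku: "k \<otimes> v \<noteq> \<one>" if "v \<in> V" for v using that n inv_eqI[OF kc V_closed[OF that]] by auto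
    show False
    proof (cases "e = \<zero>")
      case True
      then have "k \<otimes> z = k \<otimes> \<one>" using kz kc w by (simp add: a_minus_def)
      then show False using k(3)[OF kV _ order_props(2)] ku by auto
    next
      case False
      note ei = nonzero_inv[OF c(1) False]
      have cen: "k \<otimes> inv e \<in> ring_center D" "e \<otimes> inv k \<in> ring_center D"
        using k(1) c(4) inv_center[OF k(1) k0] inv_center[OF c(4) False] subringE(6)[OF subring_center] by auto
      have "(k \<otimes> inv e) \<otimes> (e \<otimes> inv k) = \<one>" using ei ki kc c by (simp add: m_assoc cancel_left_inv False)
      from valuation[OF cen this] show False
      proof
        assume a: "k \<otimes> inv e \<in> V"
        have "k = e \<otimes> (k \<otimes> inv e)" using center_comm[OF c(4), of "k \<otimes> inv e"] ei kc c by (simp add: m_assoc)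
        then have "k \<otimes> z = e \<otimes> (k \<otimes> inv e \<ominus> w)"
          using kz c w V_closed[OF a] by (metis a_minus_def a_inv_closed r_distr r_minus)
        moreover have "k \<otimes> inv e \<ominus> w \<in> \<Lambda>" unfolding a_minus_def using V_in_order[OF a] w order_props by auto
        ultimately show False using k(3)[OF e(1)] e(2) by blast
      next
        assume a: "e \<otimes> inv k \<in> V"
        have "e = k \<otimes> (e \<otimes> inv k)" using center_comm[OF k(1), of "e \<otimes> inv k"] ki kc c by (simp add: m_assoc)
        then have "e \<otimes> w = k \<otimes> ((e \<otimes> inv k) \<otimes> w)" using kc w V_closed[OF a] by (metis m_assoc)
        then have "k \<otimes> z = k \<otimes> (\<one> \<ominus> (e \<otimes> inv k) \<otimes> w)"
          using kz kc w V_closed[OF a] by (simp add: a_minus_def r_distr r_minus)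
        moreover have "\<one> \<ominus> (e \<otimes> inv k) \<otimes> w \<in> \<Lambda>" unfolding a_minus_def using V_in_order[OF a] w order_props by auto
        ultimately show False using k(3)[OF kV] ku by blast
      qed
    qed
  qed
  then have "inv k \<otimes> (k \<otimes> z) \<in> \<Lambda>" using V_in_order k(2) order_props by auto
  then have zL: "z \<in> \<Lambda>" using cancel_left_inv(1)[OF kc k0 z(1)] by simp
  have "z \<oplus> e \<otimes> (l \<otimes> z) = \<one>" using z c unfolding l by (simp add: l_distr m_assoc)
  then have "z = \<one> \<oplus> e \<otimes> (\<ominus> (l \<otimes> z))" using c z
    by (metis a_minus_def add.inv_solve_right m_closed one_closed r_minus)
  moreover have "\<ominus> (l \<otimes> z) \<in> \<Lambda>" using zL l order_props by auto
  ultimately show "inv g \<in> congruence e" unfolding congruence_def z_def by blast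
qed

text \<open>Conjugation by \<open>x\<close> need not preserve \<open>\<Lambda>\<close>, but
  multiples \<open>s x\<close> and \<open>t inv x\<close> lie in \<open>\<Lambda>\<close>, so the
  loss is bounded by the single factor \<open>s t\<close>.\<close>

lemma conj_denominator:
  assumes x: "x \<in> carrier D" "x \<noteq> \<zero>"
  shows "\<exists>s\<in>V. s \<noteq> \<zero> \<and> (\<forall>l\<in>\<Lambda>. s \<otimes> conjugate x l \<in> \<Lambda>)"
proof -
  note xi = nonzero_inv[OF x]
  obtain s where s: "s \<in> V" "s \<noteq> \<zero>" "s \<otimes> x \<in> \<Lambda>" using scaling[OF x(1)] by blast
  obtain t where t: "t \<in> V" "t \<noteq> \<zero>" "t \<otimes> inv x \<in> \<Lambda>" using scaling[OF xi(1)] by blast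
  have "s \<otimes> t \<otimes> conjugate x l \<in> \<Lambda>" if l: "l \<in> \<Lambda>" for l
  proof -
    have c: "s \<in> carrier D" "t \<in> carrier D" "l \<in> carrier D" using s t l V_closed order_closed by auto
    have "s \<otimes> t \<otimes> conjugate x l = (s \<otimes> x) \<otimes> l \<otimes> (t \<otimes> inv x)"
      using c x xi center_left_comm[OF V_center[OF t(1)]] by (simp add: conjugate_def m_assoc)
    then show ?thesis using s t l order_props by auto
  qed
  moreover have "s \<otimes> t \<in> V" "s \<otimes> t \<noteq> \<zero>" using s t V_props V_closed mult_nonzero by auto
  ultimately show ?thesis by blast
qed

lemma congruence_conj:
  assumes x: "x \<in> carrier D" "x \<noteq> \<zero>" and s: "s \<in> V" "\<And>l. l \<in> \<Lambda> \<Longrightarrow> s \<otimes> conjugate x l \<in> \<Lambda>"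
    and e: "e \<in> V" and g: "g \<in> congruence (s \<otimes> e)"
  shows "conjugate x g \<in> congruence e"
proof -
  obtain l where l: "g = \<one> \<oplus> s \<otimes> e \<otimes> l" "l \<in> \<Lambda>" using g unfolding congruence_def by blast
  have c: "s \<in> carrier D" "e \<in> carrier D" "l \<in> carrier D" using s e l V_closed order_closed by auto
  have "conjugate x g = conjugate x \<one> \<oplus> conjugate x (s \<otimes> e \<otimes> l)" unfolding l using c x by (simp add: conj_add)
  also have "conjugate x \<one> = \<one>" using x subringE(3)[OF subring_center] by (simp add: conj_center)
  also have "conjugate x (s \<otimes> e \<otimes> l) = s \<otimes> e \<otimes> conjugate x l"
    using x s e l c V_center subringE(6)[OF subring_center] by (intro conj_scale) auto
  also have "\<dots> = e \<otimes> (s \<otimes> conjugate x l)"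
    using c x center_left_comm[OF V_center[OF e], of s] by (simp add: m_assoc)
  finally show ?thesis using s(2)[OF l(2)] unfolding congruence_def by blast
qed

text \<open>With \<open>u = f d - d\<close> the sum \<open>u + f u + \<dots> + f\<^sup>q\<^sup>-\<^sup>1 u\<close> vanishes, but it is congruent to \<open>q u\<close> modulo
  \<open>\<delta>\<Lambda>\<close> once \<open>u\<close> is scaled to be primitive.\<close>

lemma torsion_map_trivial:
  assumes f: "additive_map f" and lin: "\<And>c d. c \<in> ring_center D \<Longrightarrow> d \<in> carrier D \<Longrightarrow> f (c \<otimes> d) = c \<otimes> f d"
    and near: "\<And>l. l \<in> \<Lambda> \<Longrightarrow> \<exists>m\<in>\<Lambda>. f l = l \<oplus> \<delta> \<otimes> m"
    and q: "Factorial_Ring.prime q" "nmult q \<one> \<noteq> \<zero>" and fq: "\<And>d. d \<in> carrier D \<Longrightarrow> (f ^^ q) d = d"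
    and d: "d \<in> carrier D"
  shows "f d = d"
proof (rule ccontr)
  assume n: "f d \<noteq> d"
  note fc = additive_closed[OF f]
  define u where "u = f d \<ominus> d"
  have u: "u \<in> carrier D" "u \<noteq> \<zero>" using d fc n by (auto simp: u_def)
  obtain k where k: "k \<in> ring_center D" "k \<otimes> u \<in> \<Lambda>"
    "\<And>m l. m \<in> V \<Longrightarrow> \<forall>v\<in>V. m \<otimes> v \<noteq> \<one> \<Longrightarrow> l \<in> \<Lambda> \<Longrightarrow> k \<otimes> u \<noteq> m \<otimes> l"
    using primitive_multiple[OF u] by blast
  have kc: "k \<in> carrier D" using k center_closed by auto
  have dc: "\<delta> \<in> carrier D" using delta V_closed by auto
  define a where "a = k \<otimes> d"
  define w where "w = k \<otimes> u"
  have a: "a \<in> carrier D" and w: "w \<in> \<Lambda>" "w \<in> carrier D" using kc d u k by (auto simp: a_def w_def)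
  \<comment> \<open>Scaling by the central \<open>k\<close> commutes with \<open>f\<close>, so the
    difference \<open>w\<close> of \<open>f a\<close> and \<open>a\<close> is primitive.\<close>
  have fa: "f a = a \<oplus> w" using lin[OF k(1) d] kc d fc unfolding a_def w_def u_def
    by (simp add: a_minus_def r_distr r_minus a_lcomm[of "k \<otimes> d"] r_neg)
  have fw: "\<exists>m\<in>\<Lambda>. (f ^^ j) w = w \<oplus> \<delta> \<otimes> m" for j
  proof (induction j)
    case 0 then show ?case using order_props dc w by (intro bexI[of _ \<zero>]) auto
  next
    case (Suc j)
    then obtain m where m: "m \<in> \<Lambda>" "(f ^^ j) w = w \<oplus> \<delta> \<otimes> m" by blast
    obtain m1 where m1: "m1 \<in> \<Lambda>" "f w = w \<oplus> \<delta> \<otimes> m1" using near w by blast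
    obtain m2 where m2: "m2 \<in> \<Lambda>" "f m = m \<oplus> \<delta> \<otimes> m2" using near m by blast
    have c: "m \<in> carrier D" "m1 \<in> carrier D" "m2 \<in> carrier D" using m m1 m2 order_closed by auto
    have "(f ^^ Suc j) w = f w \<oplus> \<delta> \<otimes> f m"
      using m c w dc V_center[OF delta(1)] by (simp add: additive_add[OF f] lin)
    also have "\<dots> = w \<oplus> \<delta> \<otimes> (m1 \<oplus> (m \<oplus> \<delta> \<otimes> m2))"
      unfolding m1 m2 using c w dc by (simp add: r_distr a_assoc)
    finally show ?case using m m1 m2 order_props V_in_order[OF delta(1)] by (intro bexI[of _ "m1 \<oplus> (m \<oplus> \<delta> \<otimes> m2)"]) auto
  qed
  have "\<exists>m\<in>\<Lambda>. (f ^^ j) a = a \<oplus> (nmult j w \<oplus> \<delta> \<otimes> m)" for j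
  proof (induction j)
    case 0 then show ?case using order_props dc a by (intro bexI[of _ \<zero>]) auto
  next
    case (Suc j)
    then obtain m where m: "m \<in> \<Lambda>" "(f ^^ j) a = a \<oplus> (nmult j w \<oplus> \<delta> \<otimes> m)" by blast
    obtain m1 where m1: "m1 \<in> \<Lambda>" "(f ^^ j) w = w \<oplus> \<delta> \<otimes> m1" using fw by blast
    have c: "m \<in> carrier D" "m1 \<in> carrier D" using m m1 order_closed by auto
    have "(f ^^ Suc j) a = (f ^^ j) a \<oplus> (f ^^ j) w"
      using fa a w additive_add[OF additive_iterate[OF f]] by (simp add: funpow_swap1)
    also have "\<dots> = a \<oplus> (nmult (Suc j) w \<oplus> \<delta> \<otimes> (m \<oplus> m1))"
      unfolding m m1 using c a w dc by (simp add: r_distr a_ac)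
    finally show ?case using m m1 order_props by blast
  qed
  from this[of q] obtain m where m: "m \<in> \<Lambda>" "a = a \<oplus> (nmult q w \<oplus> \<delta> \<otimes> m)" using fq[OF a] by auto
  have mc: "m \<in> carrier D" using m order_closed by auto
  have z: "nmult q w \<oplus> \<delta> \<otimes> m = \<zero>"
  proof -
    let ?y = "nmult q w \<oplus> \<delta> \<otimes> m"
    have "?y = \<ominus> a \<oplus> (a \<oplus> ?y)" using a w mc dc by (simp add: r_neg1)
    then show ?thesis using m(2)[symmetric] a by (simp add: l_neg)
  qed
  \<comment> \<open>Dividing \<open>q w + \<delta> m = 0\<close> by \<open>q\<close> leaves
    \<open>w\<close> a multiple of the nonunit \<open>\<mu> = \<delta> / q\<close>, against
    primitivity.\<close>
  obtain \<mu> where mu: "\<mu> \<in> V" "\<forall>v\<in>V. \<mu> \<otimes> v \<noteq> \<one>" "\<delta> = nmult q \<one> \<otimes> \<mu>" using delta_prime[OF q] by blast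
  have muc: "\<mu> \<in> carrier D" using mu V_closed by auto
  have "nmult q \<one> \<otimes> (w \<oplus> \<mu> \<otimes> m) = \<zero>"
    using z nat_multiple[OF w(2), of q] mu(3) muc mc w by (simp add: r_distr m_assoc)
  then have "w \<oplus> \<mu> \<otimes> m = \<zero>" using integral[of "nmult q \<one>" "w \<oplus> \<mu> \<otimes> m"] q(2) w muc mc by simp
  then have "w = \<mu> \<otimes> (\<ominus> m)" using w muc mc by (simp add: r_minus minus_equality)
  then show False using k(3)[OF mu(1,2), of "\<ominus> m"] m order_props unfolding w_def by auto
qed

text \<open>Prime by prime: for \<open>q\<close> nonzero in \<open>D\<close>, left multiplication by
  a \<open>q\<close>-th root of one in this group is a center-linear torsion map close to the
  identity, hence trivial; if \<open>q\<close> is the characteristic, one is the only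
  \<open>q\<close>-th root of one in all of \<open>D\<close>.\<close>

lemma congruence_torsion_free:
  assumes z: "z \<in> congruence \<delta>" "z [^] n = \<one>" "(n::nat) > 0"
  shows "z = \<one>"
  using assms
proof (induction n rule: less_induct)
  case (less n)
  have zc: "z \<in> carrier D" using congruence_closed[OF delta(1)] less.prems by auto
  show ?case
  proof (cases "n = 1")
    case True then show ?thesis using less.prems zc by simp
  next
    case False
    then obtain q where q: "Factorial_Ring.prime q" "q dvd n" using prime_factor_nat by blast
    then obtain m where m: "n = m * q" by (metis dvd_def mult.commute)
    define y where "y = z [^] m"
    have y: "y \<in> congruence \<delta>" "y \<in> carrier D" "y [^] q = \<one>"
      using less.prems congruence_pow[OF delta(1)] zc by (auto simp: y_def m nat_pow_pow)
    have yn: "((\<otimes>) y ^^ j) d = y [^] j \<otimes> d" if "d \<in> carrier D" for j d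
      by (induction j) (use that y nat_pow_Suc2[OF y(2)] in \<open>auto simp: m_assoc simp del: nat_pow_Suc\<close>)
    have "y = \<one>"
    proof (cases "nmult q \<one> = \<zero>")
      case False
      obtain l where l: "y = \<one> \<oplus> \<delta> \<otimes> l" "l \<in> \<Lambda>" using y(1) unfolding congruence_def by blast
      have "y \<otimes> \<one> = \<one>"
      proof (rule torsion_map_trivial[OF additive_map_mult[OF y(2)] _ _ q(1) False])
        fix m assume "m \<in> \<Lambda>"
        then show "\<exists>k\<in>\<Lambda>. y \<otimes> m = m \<oplus> \<delta> \<otimes> k"
          using l order_props order_closed V_closed[OF delta(1)]
          by (intro bexI[of _ "l \<otimes> m"]) (auto simp: l_distr m_assoc)
      qed (use yn y center_left_comm in auto)
      then show ?thesis using y by simp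
    next
      case True
      then show ?thesis using prime_root_of_one[OF q(1) _ y(2,3)] by simp
    qed
    moreover have "m < n" "m > 0" using m less.prems prime_gt_1_nat[OF q(1)] by auto
    ultimately show ?thesis using less.IH[of m] less.prems y_def by auto
  qed
qed

end

section \<open>Iterated commutators near one\<close>

context skew_field
begin

fun iterated_commutator :: "'a \<Rightarrow> 'a \<Rightarrow> nat \<Rightarrow> 'a" where
  "iterated_commutator x a 0 = a"
| "iterated_commutator x a (Suc n) =
     iterated_commutator x a n \<otimes> inv (conjugate x (iterated_commutator x a n))"

lemma iterated_commutator_closed:
  assumes "x \<in> carrier D" "x \<noteq> \<zero>" "a \<in> carrier D" "a \<noteq> \<zero>"
  shows "iterated_commutator x a n \<in> carrier D" "iterated_commutator x a n \<noteq> \<zero>"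
proof -
  have "iterated_commutator x a n \<in> carrier D \<and> iterated_commutator x a n \<noteq> \<zero>"
  proof (induction n)
    case (Suc n)
    then have "conjugate x (iterated_commutator x a n) \<in> carrier D" "conjugate x (iterated_commutator x a n) \<noteq> \<zero>"
      using conj_closed conj_nonzero assms(1,2) by auto
    from nonzero_inv[OF this] show ?case using Suc mult_nonzero by auto
  qed (use assms in auto)
  then show "iterated_commutator x a n \<in> carrier D" "iterated_commutator x a n \<noteq> \<zero>" by auto
qed

text \<open>The commutator bracketed the other way, as a conjugate of \<open>x\<close> times
  \<open>inv x\<close>. The defining form keeps it near one, this form keeps it in the subnormal
  series; moreover its product with \<open>x\<close> shares with \<open>x\<close> every central
  power of \<open>x\<close>.\<close>

lemma iterated_commutator_Suc_mult:
  assumes "x \<in> carrier D" "x \<noteq> \<zero>" "a \<in> carrier D" "a \<noteq> \<zero>"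
  shows "iterated_commutator x a (Suc n) \<otimes> x = conjugate (iterated_commutator x a n) x"
proof -
  define b where "b = iterated_commutator x a n"
  have b: "b \<in> carrier D" "b \<noteq> \<zero>" using iterated_commutator_closed[OF assms] by (auto simp: b_def)
  note i = nonzero_inv[OF b] nonzero_inv[OF assms(1,2)]
  have "inv (conjugate x b) = conjugate x (inv b)" using conj_inv[OF assms(1,2) b] by simp
  then have "iterated_commutator x a (Suc n) \<otimes> x = b \<otimes> (x \<otimes> inv b \<otimes> inv x) \<otimes> x"
    by (simp add: b_def conjugate_def)
  also have "\<dots> = conjugate b x" using i b assms by (simp add: conjugate_def m_assoc)
  finally show ?thesis by (simp add: b_def)
qed

declare iterated_commutator.simps(2) [simp del]

end

context valued_order
begin

text \<open>Each commutator conjugates by \<open>x\<close> once, which costs the denominator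
  \<open>s\<close>. So the start lies \<open>k\<close> factors of \<open>s\<close> deeper than
  \<open>\<delta>\<close>, and \<open>t\<close> clears the denominator of \<open>y\<close>.\<close>

lemma iterated_commutator_near_one:
  assumes x: "x \<in> carrier D" "x \<noteq> \<zero>" and y: "y \<in> carrier D"
  shows "\<exists>\<epsilon>\<in>V. \<epsilon> \<noteq> \<zero> \<and> \<one> \<oplus> \<epsilon> \<otimes> y \<noteq> \<zero> \<and> (\<forall>j\<le>k. iterated_commutator x (\<one> \<oplus> \<epsilon> \<otimes> y) j \<in> congruence \<delta>)"
proof -
  obtain s where s: "s \<in> V" "s \<noteq> \<zero>" "\<And>l. l \<in> \<Lambda> \<Longrightarrow> s \<otimes> conjugate x l \<in> \<Lambda>"
    using conj_denominator[OF x] by blast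
  obtain t where t: "t \<in> V" "t \<noteq> \<zero>" "t \<otimes> y \<in> \<Lambda>" using scaling[OF y] by blast
  have c: "s \<in> carrier D" "t \<in> carrier D" "\<delta> \<in> carrier D" using s t delta V_closed by auto
  have sV: "s [^] n \<in> V" for n :: nat by (induction n) (use s V_props in auto)
  have V: "s [^] n \<otimes> \<delta> \<in> V" for n :: nat using sV delta V_props by auto
  have nu: "s [^] n \<otimes> \<delta> \<otimes> v \<noteq> \<one>" if "v \<in> V" for n :: nat and v
  proof
    assume "s [^] n \<otimes> \<delta> \<otimes> v = \<one>"
    then have "\<delta> \<otimes> (s [^] n \<otimes> v) = \<one>"
      using center_left_comm[OF V_center[OF delta(1)], of "s [^] n" v] c V_closed[OF that] by (simp add: m_assoc)
    then show False using delta(3)[of "s [^] n \<otimes> v"] sV that V_props by auto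
  qed
  define \<epsilon> where "\<epsilon> = s [^] k \<otimes> \<delta> \<otimes> t"
  have e: "\<epsilon> \<in> V" "\<epsilon> \<noteq> \<zero>"
    using V[of k] t V_props(4) mult_nonzero[OF _ c(2)] mult_nonzero[OF _ c(3)] pow_nonzero[OF c(1) s(2)] c delta(2)
    by (auto simp: \<epsilon>_def)
  define a where "a = \<one> \<oplus> \<epsilon> \<otimes> y"
  have "a \<in> congruence (s [^] k \<otimes> \<delta>)"
    unfolding a_def \<epsilon>_def congruence_def using t y c by (intro CollectI exI[of _ "t \<otimes> y"]) (simp add: m_assoc)
  then have "iterated_commutator x a j \<in> congruence (s [^] (k - j) \<otimes> \<delta>)" if "j \<le> k" for j
    using that
  proof (induction j)
    case (Suc j)
    define b where "b = iterated_commutator x a j"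
    let ?e = "s [^] (k - Suc j) \<otimes> \<delta>"
    have "k - j = Suc (k - Suc j)" using Suc.prems by auto
    then have "s [^] (k - j) = s \<otimes> s [^] (k - Suc j)" using nat_pow_Suc2[OF c(1)] by simp
    then have b: "b \<in> congruence (s \<otimes> ?e)" using Suc c by (simp add: b_def m_assoc)
    have "b \<in> congruence ?e" using congruence_weaken[OF s(1) V b] .
    moreover have "conjugate x b \<in> congruence ?e" using congruence_conj[OF x s(1,3) V b] .
    then have "inv (conjugate x b) \<in> congruence ?e" using congruence_inv[OF V nu] by blast
    ultimately show ?case using congruence_mult[OF V] by (simp add: b_def iterated_commutator.simps(2))
  qed simp
  then have "iterated_commutator x a j \<in> congruence \<delta>" if "j \<le> k" for j
    using that congruence_weaken[OF sV delta(1)] by blast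
  moreover from this[of 0] have "a \<noteq> \<zero>" using congruence_inv(1)[OF delta(1,3)] by simp
  ultimately show ?thesis using e unfolding a_def by blast
qed

text \<open>If \<open>b\<^sub>i\<^sub>+\<^sub>1 = 1\<close>, then \<open>b\<^sub>i\<close> commutes with \<open>x\<close>; since \<open>b\<^sub>i x\<close> is conjugate to \<open>x\<close> and \<open>x\<^sup>n\<close> is
  central, \<open>b\<^sub>i\<^sup>n = 1\<close>.\<close>

lemma iterated_commutator_trivial:
  assumes x: "x \<in> carrier D" "x \<noteq> \<zero>" "(n::nat) > 0" "x [^] n \<in> ring_center D"
    and a: "a \<in> carrier D" "a \<noteq> \<zero>"
    and near: "\<And>j. j \<le> k \<Longrightarrow> iterated_commutator x a j \<in> congruence \<delta>"
    and k: "k > 0" "iterated_commutator x a k = \<one>"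
  shows "conjugate x a = a"
proof -
  let ?b = "iterated_commutator x a"
  note b = iterated_commutator_closed[OF x(1,2) a]
  have fixed: "conjugate x (?b j) = ?b j" if "?b (Suc j) = \<one>" for j
  proof -
    have "conjugate (?b j) x = x" using iterated_commutator_Suc_mult[OF x(1,2) a, of j] that x by simp
    then show ?thesis using conj_eq_iff[OF b x(1,1)] conj_eq_iff[OF x(1,2) b(1,1)] by metis
  qed
  have "?b (Suc i) = \<one>" if "Suc i \<le> k" for i
    using that
  proof (induction "k - Suc i" arbitrary: i)
    case 0
    then have "k = Suc i" by simp
    then show ?case using k by simp
  next
    case (Suc d)
    have "?b (Suc (Suc i)) = \<one>" using Suc.hyps(1)[of "Suc i"] Suc.hyps(2) by simp
    then have c: "?b (Suc i) \<otimes> x = x \<otimes> ?b (Suc i)"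
      using fixed conj_eq_iff[OF x(1,2) b(1,1)] by metis
    have "(?b (Suc i) \<otimes> x) [^] n = ?b (Suc i) [^] n \<otimes> x [^] n"
      using pow_mult_commute[OF b(1) x(1) c] .
    moreover have "(?b (Suc i) \<otimes> x) [^] n = x [^] n"
      using conj_pow[OF b x(1), of i n] conj_center[OF b x(4), of i]
      by (simp add: iterated_commutator_Suc_mult[OF x(1,2) a])
    ultimately have "?b (Suc i) [^] n \<otimes> x [^] n = \<one> \<otimes> x [^] n" using x by simp
    then have "?b (Suc i) [^] n = \<one>"
      using mult_cancel_right[of "x [^] n"] x pow_nonzero b(1) nat_pow_closed one_closed by metis
    then show ?case using congruence_torsion_free[OF near _ x(3)] Suc.prems by blast
  qed
  \<comment> \<open>The descent stops at index one: \<open>a\<close> itself is not a commutator, and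
    \<open>a x\<close> need not be conjugate to \<open>x\<close>. Only commutation of
    \<open>a\<close> with \<open>x\<close> follows.\<close>
  then have "?b (Suc 0) = \<one>" using k by auto
  then show ?thesis using fixed[of 0] by simp
qed

text \<open>Of \<open>N\<close> only closure under powers and long commutators is asked, so that the
  result applies to the part of \<open>N\<close> in a division subring without a subnormal series
  there. The case split isolates inseparability: a noncentral element of \<open>N\<close> with
  central \<open>p\<close>-th power, where \<open>p\<close> is the characteristic.\<close>

lemma radical_central:
  assumes N: "\<And>w. w \<in> N \<Longrightarrow> w \<in> carrier D" "\<And>w. w \<in> N \<Longrightarrow> w \<noteq> \<zero>"
    and pow: "\<And>w n. w \<in> N \<Longrightarrow> w [^] (n::nat) \<in> N"
    and rad: "\<And>w. w \<in> N \<Longrightarrow> \<exists>n::nat. n > 0 \<and> w [^] n \<in> ring_center D"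
    and comm: "\<And>x a. x \<in> N \<Longrightarrow> a \<in> carrier D \<Longrightarrow> a \<noteq> \<zero> \<Longrightarrow> iterated_commutator x a (Suc r) \<in> N"
  shows "N \<subseteq> ring_center D"
proof (cases "\<forall>w\<in>N. \<forall>p. Factorial_Ring.prime p \<longrightarrow> nmult p \<one> = \<zero> \<longrightarrow> w [^] p \<in> ring_center D \<longrightarrow> w \<in> ring_center D")
  case True
  \<comment> \<open>Primes are removed from the exponent \<open>n\<close> one at a time. For
    \<open>q\<close> nonzero in \<open>D\<close>, conjugation by \<open>v\<close> is a torsion map
    close to the identity, hence trivial; for \<open>q\<close> the characteristic, the case
    hypothesis applies.\<close>
  have near_central: "w \<in> ring_center D" if "w \<in> N" "w \<in> congruence \<delta>" "(n::nat) > 0" "w [^] n \<in> ring_center D" for w n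
    using that
  proof (induction n rule: less_induct)
    case (less n)
    have wc: "w \<in> carrier D" using N less.prems by auto
    show ?case
    proof (cases "n = 1")
      case True then show ?thesis using less.prems wc by simp
    next
      case False
      then obtain q where q: "Factorial_Ring.prime q" "q dvd n" using prime_factor_nat by blast
      then obtain m where m: "n = m * q" by (metis dvd_def mult.commute)
      define v where "v = w [^] m"
      have v: "v \<in> N" "v \<in> carrier D" "v \<noteq> \<zero>" "v \<in> congruence \<delta>" "v [^] q \<in> ring_center D"
        using less.prems pow N congruence_pow[OF delta(1)] wc by (auto simp: v_def m nat_pow_pow)
      have "v \<in> ring_center D"
      proof (cases "nmult q \<one> = \<zero>")
        case True then show ?thesis using \<open>\<forall>w\<in>N. _ w\<close> v q by blast
      next
        case False
        obtain l where l: "v = \<one> \<oplus> \<delta> \<otimes> l" "l \<in> \<Lambda>" using v(4) unfolding congruence_def by blast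
        obtain l' where l': "inv v = \<one> \<oplus> \<delta> \<otimes> l'" "l' \<in> \<Lambda>"
          using congruence_inv(2)[OF delta(1,3) v(4)] unfolding congruence_def by blast
        have dc: "\<delta> \<in> carrier D" using delta V_closed by auto
        have vq: "v [^] q \<noteq> \<zero>" "v [^] q \<in> carrier D" using v pow_nonzero by auto
        have iter: "(conjugate v ^^ q) d = d" if "d \<in> carrier D" for d
          using that conj_iterate[OF v(2,3) that] conj_eq_iff[OF vq(2,1) that that] center_comm[OF v(5) that] by simp
        \<comment> \<open>Both \<open>v\<close> and its inverse are one modulo
          \<open>\<delta>\<Lambda>\<close>, and \<open>\<delta>\<close> is central.\<close>
        have near: "\<exists>k\<in>\<Lambda>. conjugate v m = m \<oplus> \<delta> \<otimes> k" if m: "m \<in> \<Lambda>" for m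
        proof -
          have c: "m \<in> carrier D" "l \<in> carrier D" "l' \<in> carrier D" using m l l' order_closed by auto
          have "conjugate v m = (m \<oplus> \<delta> \<otimes> (l \<otimes> m)) \<oplus> (m \<oplus> \<delta> \<otimes> (l \<otimes> m)) \<otimes> (\<delta> \<otimes> l')"
          proof -
            have "v \<otimes> m = m \<oplus> \<delta> \<otimes> (l \<otimes> m)" unfolding l using c dc by (simp add: l_distr m_assoc)
            then show ?thesis unfolding conjugate_def l' using c dc by (simp add: r_distr)
          qed
          also have "(m \<oplus> \<delta> \<otimes> (l \<otimes> m)) \<otimes> (\<delta> \<otimes> l') = \<delta> \<otimes> ((m \<oplus> \<delta> \<otimes> (l \<otimes> m)) \<otimes> l')"
            using c dc center_left_comm[OF V_center[OF delta(1)]] by simp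
          also have "(m \<oplus> \<delta> \<otimes> (l \<otimes> m)) \<oplus> \<dots> = m \<oplus> \<delta> \<otimes> (l \<otimes> m \<oplus> (m \<oplus> \<delta> \<otimes> (l \<otimes> m)) \<otimes> l')"
            using c dc by (simp add: r_distr a_assoc)
          finally show ?thesis using m l l' order_props V_in_order[OF delta(1)]
            by (intro bexI[of _ "l \<otimes> m \<oplus> (m \<oplus> \<delta> \<otimes> (l \<otimes> m)) \<otimes> l'"]) auto
        qed
        have "conjugate v d = d" if "d \<in> carrier D" for d
          using torsion_map_trivial[OF additive_map_conj[OF v(2,3)] conj_scale[OF v(2,3)] near q(1) False iter that] by simp
        then show ?thesis using v conj_eq_iff[OF v(2,3)] by (intro centerI) auto
      qed
      moreover have "m < n" "m > 0" using m less.prems prime_gt_1_nat[OF q(1)] by auto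
      ultimately show ?thesis using less.IH[of m] less.prems v_def by auto
    qed
  qed
  show ?thesis
  proof
    fix x assume xN: "x \<in> N"
    have x: "x \<in> carrier D" "x \<noteq> \<zero>" using N xN by auto
    obtain n :: nat where n: "n > 0" "x [^] n \<in> ring_center D" using rad[OF xN] by blast
    have "x \<otimes> y = y \<otimes> x" if y: "y \<in> carrier D" for y
    proof -
      obtain \<epsilon> where e: "\<epsilon> \<in> V" "\<epsilon> \<noteq> \<zero>" "\<one> \<oplus> \<epsilon> \<otimes> y \<noteq> \<zero>"
        and near: "\<And>j. j \<le> Suc r \<Longrightarrow> iterated_commutator x (\<one> \<oplus> \<epsilon> \<otimes> y) j \<in> congruence \<delta>"
        using iterated_commutator_near_one[OF x y, of "Suc r"] by blast
      have ec: "\<epsilon> \<in> carrier D" using e V_closed by auto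
      define a where "a = \<one> \<oplus> \<epsilon> \<otimes> y"
      have a: "a \<in> carrier D" "a \<noteq> \<zero>" using e y ec by (auto simp: a_def)
      define z where "z = iterated_commutator x a (Suc r)"
      note b = iterated_commutator_closed[OF x a, of r]
      have zN: "z \<in> N" using comm[OF xN a] by (simp add: z_def)
      have z\<delta>: "z \<in> congruence \<delta>" using near[of "Suc r"] unfolding z_def a_def by simp
      obtain m :: nat where m: "m > 0" "z [^] m \<in> ring_center D" using rad[OF zN] by blast
      have zF: "z \<in> ring_center D" using near_central[OF zN z\<delta> m] .
      then have zc: "z \<in> carrier D" using center_closed by auto
      have zx: "z \<otimes> x = conjugate (iterated_commutator x a r) x"
        using iterated_commutator_Suc_mult[OF x a] by (simp add: z_def)
      \<comment> \<open>Centrality of \<open>z\<close> starts the descent: \<open>z\<close> commutes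
        with \<open>x\<close>, and \<open>z x\<close>, being conjugate to \<open>x\<close>, has the
        same central \<open>n\<close>-th power.\<close>
      have "z [^] n \<otimes> x [^] n = (z \<otimes> x) [^] n"
        using pow_mult_commute[OF zc x(1)] center_comm[OF zF x(1)] by simp
      also have "\<dots> = x [^] n"
        using conj_pow[OF b x(1), of n] conj_center[OF b n(2)] x by (simp add: zx)
      finally have "z [^] n \<otimes> x [^] n = \<one> \<otimes> x [^] n" using x by simp
      then have "z [^] n = \<one>"
        using mult_cancel_right[of "x [^] n"] x pow_nonzero zc nat_pow_closed one_closed by metis
      then have "z = \<one>" using congruence_torsion_free[OF z\<delta> _ n(1)] by simp
      then have "conjugate x a = a"
        using iterated_commutator_trivial[OF x n a near[folded a_def]] by (simp add: z_def)
      then have "x \<otimes> a = a \<otimes> x" using conj_eq_iff[OF x a(1) a(1)] by simp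
      then have "x \<oplus> \<epsilon> \<otimes> (x \<otimes> y) = x \<oplus> \<epsilon> \<otimes> (y \<otimes> x)"
        using x y ec center_left_comm[OF V_center[OF e(1)], of x y] by (simp add: a_def l_distr r_distr m_assoc)
      then have "\<epsilon> \<otimes> (x \<otimes> y) = \<epsilon> \<otimes> (y \<otimes> x)"
        using add.l_cancel[of x "\<epsilon> \<otimes> (x \<otimes> y)" "\<epsilon> \<otimes> (y \<otimes> x)"] x y ec by blast
      then show ?thesis using mult_cancel_left[OF ec e(2)] x y by simp
    qed
    then show "x \<in> ring_center D" using x by (intro centerI) auto
  qed
next
  case False
  then obtain x p where xN: "x \<in> N" and p: "Factorial_Ring.prime p" "nmult p \<one> = \<zero>"
    and xp: "x [^] p \<in> ring_center D" "x \<notin> ring_center D" by blast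
  have x: "x \<in> carrier D" "x \<noteq> \<zero>" using N xN by auto
  have p0: "p > 0" using prime_gt_0_nat p by blast
  have xpc: "x [^] p \<in> carrier D" "x [^] p \<noteq> \<zero>" using x pow_nonzero by auto
  obtain d where d: "d \<in> carrier D" "x \<otimes> d \<noteq> d \<otimes> x" using centerI[OF x(1)] xp by blast
  have iter: "(conjugate x ^^ p) d = d" if "d \<in> carrier D" for d
    using conj_iterate[OF x that] conj_eq_iff[OF xpc that that] center_comm[OF xp(1) that] by simp
  obtain e where e: "e \<in> carrier D" "conjugate x e \<noteq> e" "conjugate x (conjugate x e \<ominus> e) = conjugate x e \<ominus> e"
    using additive_unipotent[OF additive_map_conj[OF x] p iter d(1)] conj_eq_iff[OF x d(1) d(1)] d(2) by blast
  define u where "u = conjugate x e \<ominus> e"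
  have u: "u \<in> carrier D" "u \<noteq> \<zero>" "conjugate x u = u" using e x by (auto simp: u_def)
  note ui = nonzero_inv[OF u(1,2)]
  \<comment> \<open>Artin-Schreier normalization: conjugation by \<open>x\<close> fixes
    \<open>u\<close> and adds it to \<open>e\<close>, so it adds \<open>1\<close> to the
    quotient.\<close>
  define y where "y = e \<otimes> inv u"
  have y: "y \<in> carrier D" using e ui by (simp add: y_def)
  have "conjugate x e = e \<oplus> u" unfolding u_def using e x by (simp add: a_minus_def a_lcomm[of e] r_neg)
  then have yx: "conjugate x y = y \<oplus> \<one>"
    unfolding y_def using e u ui x by (simp add: conj_mult conj_inv l_distr)
  \<comment> \<open>The double centralizer of \<open>y\<close>. It commutes with \<open>y\<close>,
    hence with itself. Conjugation by \<open>x\<close> maps \<open>y\<close> to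
    \<open>y + 1\<close>, so it preserves the centralizer of \<open>y\<close> and with it
    \<open>C\<close>; therefore all iterated commutators of an element of \<open>C\<close> stay in
    \<open>C\<close>.\<close>
  define C where "C = {b \<in> carrier D. \<forall>c\<in>carrier D. c \<otimes> y = y \<otimes> c \<longrightarrow> c \<otimes> b = b \<otimes> c}"
  have CI: "b \<in> C" if "b \<in> carrier D" "\<And>c. c \<in> carrier D \<Longrightarrow> c \<otimes> y = y \<otimes> c \<Longrightarrow> c \<otimes> b = b \<otimes> c" for b
    using that by (simp add: C_def)
  have CD: "c \<otimes> b = b \<otimes> c" if "b \<in> C" "c \<in> carrier D" "c \<otimes> y = y \<otimes> c" for b c
    using that unfolding C_def by blast
  have Cc: "b \<in> carrier D" if "b \<in> C" for b using that by (simp add: C_def)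
  have C_comm: "b \<otimes> c = c \<otimes> b" if "b \<in> C" "c \<in> C" for b c
    using CD[OF that(2) Cc[OF that(1)]] CD[OF that(1) y] by simp
  have C_mult: "b \<otimes> c \<in> C" if "b \<in> C" "c \<in> C" for b c
  proof (rule CI)
    fix g assume g: "g \<in> carrier D" "g \<otimes> y = y \<otimes> g"
    have "g \<otimes> (b \<otimes> c) = b \<otimes> (g \<otimes> c)" using CD[OF that(1) g] g that Cc by (simp flip: m_assoc)
    then show "g \<otimes> (b \<otimes> c) = b \<otimes> c \<otimes> g" using CD[OF that(2) g] g that Cc by (simp add: m_assoc)
  qed (use that Cc in simp)
  have C_inv: "inv b \<in> C" if "b \<in> C" "b \<noteq> \<zero>" for b
  proof (rule CI)
    fix g assume g: "g \<in> carrier D" "g \<otimes> y = y \<otimes> g"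
    then show "g \<otimes> inv b = inv b \<otimes> g" using inv_commute[OF Cc[OF that(1)] that(2) g(1)] CD[OF that(1) g] by simp
  qed (use that Cc nonzero_inv in simp)
  have C_conj: "conjugate x b \<in> C" if "b \<in> C" for b
  proof (rule CI)
    fix g assume g: "g \<in> carrier D" "g \<otimes> y = y \<otimes> g"
    note xi = nonzero_inv[OF x]
    define h where "h = inv x \<otimes> g \<otimes> x"
    have h: "h \<in> carrier D" "conjugate x h = g"
      using g x xi by (auto simp: h_def conjugate_def m_assoc cancel_left_inv)
    have "conjugate x (h \<otimes> y) = conjugate x (y \<otimes> h)"
      using h y g by (simp add: conj_mult[OF x] yx l_distr r_distr)
    then have "h \<otimes> y = y \<otimes> h" using conj_inj[OF x] h y by simp
    then have "conjugate x (h \<otimes> b) = conjugate x (b \<otimes> h)" using CD[OF that h(1)] by simp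
    then show "g \<otimes> conjugate x b = conjugate x b \<otimes> g" using h Cc[OF that] conj_mult[OF x] by simp
  qed (use that Cc x in simp)
  \<comment> \<open>One commutator beyond the one known to lie in \<open>N\<close>: it is the ratio
    of \<open>w\<close> in \<open>N\<close> and its conjugate \<open>w'\<close>, which commute and
    have the same central \<open>m\<close>-th power, so it is torsion.\<close>
  obtain \<epsilon> where \<epsilon>: "\<epsilon> \<in> V" "\<epsilon> \<noteq> \<zero>" "\<one> \<oplus> \<epsilon> \<otimes> y \<noteq> \<zero>"
    and near: "\<And>j. j \<le> Suc (Suc r) \<Longrightarrow> iterated_commutator x (\<one> \<oplus> \<epsilon> \<otimes> y) j \<in> congruence \<delta>"
    using iterated_commutator_near_one[OF x y, of "Suc (Suc r)"] by blast
  have ec: "\<epsilon> \<in> carrier D" using \<epsilon> V_closed by auto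
  define a where "a = \<one> \<oplus> \<epsilon> \<otimes> y"
  have a: "a \<in> carrier D" "a \<noteq> \<zero>" using \<epsilon> y ec by (auto simp: a_def)
  let ?b = "iterated_commutator x a"
  note b = iterated_commutator_closed[OF x a]
  have "a \<in> C"
  proof (rule CI)
    fix g assume g: "g \<in> carrier D" "g \<otimes> y = y \<otimes> g"
    then show "g \<otimes> a = a \<otimes> g" unfolding a_def
      using center_left_comm[OF V_center[OF \<epsilon>(1)], of g y] y ec by (simp add: l_distr r_distr m_assoc)
  qed (rule a)
  then have bC: "?b n \<in> C" for n
    by (induction n) (use \<open>a \<in> C\<close> C_mult C_inv C_conj b x conj_nonzero in \<open>auto simp: iterated_commutator.simps(2)\<close>)
  define w where "w = ?b (Suc r)"
  have wN: "w \<in> N" using comm[OF xN a] by (simp add: w_def)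
  have w: "w \<in> carrier D" "w \<noteq> \<zero>" "w \<in> C" using b bC by (auto simp: w_def)
  define w' where "w' = conjugate x w"
  have w': "w' \<in> carrier D" "w' \<noteq> \<zero>" "w' \<in> C" using w x conj_nonzero C_conj by (auto simp: w'_def)
  note w'i = nonzero_inv[OF w'(1,2)]
  obtain m :: nat where m: "m > 0" "w [^] m \<in> ring_center D" using rad[OF wN] by blast
  have wm: "w' [^] m = w [^] m" using conj_pow[OF x w(1), of m] conj_center[OF x m(2)] by (simp add: w'_def)
  have "(w \<otimes> inv w') [^] m = w [^] m \<otimes> inv w' [^] m"
    using pow_mult_commute[OF w(1) w'i(1) C_comm[OF w(3) C_inv[OF w'(3,2)]]] .
  also have "\<dots> = (w' \<otimes> inv w') [^] m"
    using pow_mult_commute[OF w'(1) w'i(1), of m] w'i(3,4) by (simp only: wm)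
  also have "\<dots> = \<one>" using w'i(3) by simp
  finally have "?b (Suc (Suc r)) [^] m = \<one>" by (simp add: w_def w'_def iterated_commutator.simps(2))
  then have "?b (Suc (Suc r)) = \<one>"
    using congruence_torsion_free[OF near[of "Suc (Suc r)", folded a_def] _ m(1)] by simp
  then have "conjugate x a = a"
    using iterated_commutator_trivial[OF x p0 xp(1) a near[folded a_def]] by simp
  moreover have "conjugate x a = \<one> \<oplus> \<epsilon> \<otimes> (y \<oplus> \<one>)"
    unfolding a_def using x y ec V_center[OF \<epsilon>(1)] subringE(3)[OF subring_center]
    by (simp add: conj_add conj_scale conj_center yx)
  ultimately have "\<one> \<oplus> \<epsilon> \<otimes> (y \<oplus> \<one>) = \<one> \<oplus> \<epsilon> \<otimes> y" by (simp add: a_def)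
  then have "\<epsilon> \<otimes> (y \<oplus> \<one>) = \<epsilon> \<otimes> y"
    using add.l_cancel[of \<one> "\<epsilon> \<otimes> (y \<oplus> \<one>)" "\<epsilon> \<otimes> y"] y ec by blast
  then have "y \<oplus> \<one> = y" using mult_cancel_left[OF ec \<epsilon>(2)] y by simp
  then have "y \<oplus> \<one> = y \<oplus> \<zero>" using y by simp
  then have False using add.l_cancel[of y \<one> \<zero>] y one_not_zero by blast
  then show ?thesis ..
qed

end

section \<open>Orders over a valuation ring of the center\<close>

context skew_field
begin

lemma torsion_of_finite_orbit:
  assumes d: "d \<in> carrier D" "d \<noteq> \<zero>" and u: "u \<in> carrier D" "u \<noteq> \<zero>"
    and W: "finite W" "\<And>j::nat. d [^] j \<otimes> u \<in> W"
  shows "\<exists>n::nat. n > 0 \<and> d [^] n = \<one>"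
proof -
  have "\<not> inj (\<lambda>j::nat. d [^] j \<otimes> u)"
  proof
    assume "inj (\<lambda>j::nat. d [^] j \<otimes> u)"
    moreover have "finite (range (\<lambda>j::nat. d [^] j \<otimes> u))" using W by (auto intro: finite_subset)
    ultimately show False using finite_imageD infinite_UNIV_nat by blast
  qed
  then obtain i j :: nat where ij: "d [^] i \<otimes> u = d [^] j \<otimes> u" "i < j" unfolding inj_def by (metis nat_neq_iff)
  then have "d [^] i = d [^] j" using mult_cancel_right[OF u] d by simp
  also have "\<dots> = d [^] i \<otimes> d [^] (j - i)" using ij d by (simp add: nat_pow_mult)
  finally have "d [^] (j - i) = \<one>"
    using mult_cancel_left[of "d [^] i" "d [^] (j - i)" \<one>] d pow_nonzero by simp
  then show ?thesis using ij by (intro exI[of _ "j - i"]) simp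
qed

lemma central_subring_iff:
  "A \<subseteq> ring_center D \<Longrightarrow> subring A (D\<lparr>carrier := ring_center D\<rparr>) \<longleftrightarrow> subring A D"
  using subring_iff[of A] ring.subring_iff[OF subring_is_ring[OF subring_center], of A] center_closed by auto

lemma central_valuation_ring_exists:
  assumes A: "subring A D" "A \<subseteq> ring_center D" and s: "s \<in> A" "t \<in> ring_center D" "s \<otimes> t = \<one>" "t \<notin> A"
  obtains V where "subring V D" "A \<subseteq> V" "V \<subseteq> ring_center D" "t \<notin> V"
    "\<And>u v. u \<in> ring_center D \<Longrightarrow> v \<in> ring_center D \<Longrightarrow> u \<otimes> v = \<one> \<Longrightarrow> u \<in> V \<or> v \<in> V"
proof -
  interpret C: field "D\<lparr>carrier := ring_center D\<rparr>" by (rule field_center)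
  obtain V where V: "subring V (D\<lparr>carrier := ring_center D\<rparr>)" "A \<subseteq> V" "t \<notin> V"
    "\<forall>u\<in>ring_center D. \<forall>v\<in>ring_center D. u \<otimes> v = \<one> \<longrightarrow> u \<in> V \<or> v \<in> V"
    using C.valuation_ring_exists[of A s t] A s central_subring_iff by auto
  then have "V \<subseteq> ring_center D" using subringE(1) by fastforce
  then have "subring V D" using V(1) central_subring_iff by simp
  show ?thesis
    by (rule that[OF \<open>subring V D\<close> V(2) \<open>V \<subseteq> ring_center D\<close> V(3)]) (use V(4) in auto)
qed

lemma basis_has_nonzero:
  assumes "set Us \<subseteq> carrier D" "set Ks \<subseteq> carrier D" "combine Ks Us \<noteq> \<zero>"
  shows "\<exists>u\<in>set Us. u \<noteq> \<zero>"
  using assms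
proof (induction Ks Us rule: combine.induct)
  case (1 k Ks u Us)
  then show ?case by (cases "u = \<zero>") auto
qed auto

text \<open>Over a valuation ring this is the lattice spanned by \<open>Us\<close>, over a finite
  ring a finite set; both occur.\<close>

definition coefficient_span :: "'a set \<Rightarrow> 'a list \<Rightarrow> 'a set" where
  "coefficient_span R Us = {combine Ks Us | Ks. set Ks \<subseteq> R \<and> length Ks = length Us}"

context
  fixes R Us assumes R: "subring R D" "R \<subseteq> ring_center D" and Us: "set Us \<subseteq> carrier D"
begin

lemma coefficients_closed: "set Ks \<subseteq> R \<Longrightarrow> set Ks \<subseteq> carrier D"
  using subringE(1)[OF R(1)] by auto

lemma coefficient_span_closed: "a \<in> coefficient_span R Us \<Longrightarrow> a \<in> carrier D"
  unfolding coefficient_span_def using Us coefficients_closed by auto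

lemma coefficient_span_zero: "\<zero> \<in> coefficient_span R Us"
  unfolding coefficient_span_def using combine_replicate[OF Us] subringE(2)[OF R(1)]
  by (intro CollectI exI[of _ "replicate (length Us) \<zero>"]) auto

lemma coefficient_span_add:
  assumes "a \<in> coefficient_span R Us" "b \<in> coefficient_span R Us"
  shows "a \<oplus> b \<in> coefficient_span R Us"
proof -
  obtain Ks Js where k: "a = combine Ks Us" "set Ks \<subseteq> R" "length Ks = length Us"
    and j: "b = combine Js Us" "set Js \<subseteq> R" "length Js = length Us"
    using assms unfolding coefficient_span_def by blast
  have "a \<oplus> b = combine (map2 (\<oplus>) Ks Js) Us"
    unfolding k j using combine_add k j Us coefficients_closed by auto
  moreover have "set (map2 (\<oplus>) Ks Js) \<subseteq> R"
  proof
    fix z assume "z \<in> set (map2 (\<oplus>) Ks Js)"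
    then obtain p where p: "p \<in> set (zip Ks Js)" "z = fst p \<oplus> snd p" by (auto simp: case_prod_beta)
    then have "fst p \<in> R" "snd p \<in> R" using k j set_zip_leftD[of "fst p" "snd p"] set_zip_rightD[of "fst p" "snd p"] by auto
    then show "z \<in> R" using p subringE(7)[OF R(1)] by simp
  qed
  ultimately show ?thesis using k j unfolding coefficient_span_def
    by (intro CollectI exI[of _ "map2 (\<oplus>) Ks Js"]) auto
qed

lemma coefficient_span_scale:
  assumes "c \<in> R" "a \<in> coefficient_span R Us"
  shows "c \<otimes> a \<in> coefficient_span R Us"
proof -
  obtain Ks where k: "a = combine Ks Us" "set Ks \<subseteq> R" "length Ks = length Us"
    using assms unfolding coefficient_span_def by blast
  have "c \<otimes> a = combine (map ((\<otimes>) c) Ks) Us"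
    unfolding k using k Us coefficients_closed assms subringE(1)[OF R(1)] by (intro combine_r_distr) auto
  then show ?thesis using k assms subringE(6)[OF R(1)] unfolding coefficient_span_def
    by (intro CollectI exI[of _ "map ((\<otimes>) c) Ks"]) auto
qed

lemma coefficient_span_generator: "u \<in> set Us \<Longrightarrow> u \<in> coefficient_span R Us"
  using Us
proof (induction Us)
  case (Cons v Vs)
  have v: "v \<in> carrier D" "set Vs \<subseteq> carrier D" using Cons.prems by auto
  show ?case
  proof (cases "u = v")
    case True
    have "combine (\<one> # replicate (length Vs) \<zero>) (v # Vs) = u" using True v combine_replicate[OF v(2)] by simp
    then show ?thesis using subringE(2,3)[OF R(1)] unfolding coefficient_span_def
      by (intro CollectI exI[of _ "\<one> # replicate (length Vs) \<zero>"]) auto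
  next
    case False
    then obtain Ks where k: "u = combine Ks Vs" "set Ks \<subseteq> R" "length Ks = length Vs"
      using Cons v unfolding coefficient_span_def by auto
    have "combine (\<zero> # Ks) (v # Vs) = u" using k v coefficients_closed[OF k(2)] by simp
    then show ?thesis using k subringE(2)[OF R(1)] unfolding coefficient_span_def
      by (intro CollectI exI[of _ "\<zero> # Ks"]) auto
  qed
qed simp

lemma coefficient_span_mult:
  assumes d: "d \<in> carrier D" "\<And>u. u \<in> set Us \<Longrightarrow> d \<otimes> u \<in> coefficient_span R Us"
    and a: "a \<in> coefficient_span R Us"
  shows "d \<otimes> a \<in> coefficient_span R Us"
proof -
  obtain Ks where k: "a = combine Ks Us" "set Ks \<subseteq> R" using a unfolding coefficient_span_def by blast
  have "d \<otimes> combine Ks Vs \<in> coefficient_span R Us" if "set Ks \<subseteq> R" "set Vs \<subseteq> set Us" for Ks Vs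
    using that
  proof (induction Ks Vs rule: combine.induct)
    case (1 k Ks v Vs)
    have c: "k \<in> carrier D" "v \<in> carrier D" "combine Ks Vs \<in> carrier D" "k \<in> ring_center D"
      using 1 Us R coefficients_closed[of Ks] subringE(1)[OF R(1)] by auto
    have "d \<otimes> combine (k # Ks) (v # Vs) = k \<otimes> (d \<otimes> v) \<oplus> d \<otimes> combine Ks Vs"
      using c d(1) center_left_comm[OF c(4) d(1) c(2)] by (simp add: r_distr)
    then show ?case using 1 coefficient_span_add coefficient_span_scale d(2) by auto
  qed (use coefficient_span_zero d in auto)
  then show ?thesis using k by blast
qed

lemma finite_coefficient_span: "finite R \<Longrightarrow> finite (coefficient_span R Us)"
  unfolding coefficient_span_def setcompr_eq_image using finite_lists_length_eq[of R "length Us"] by simp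

end

context
  fixes V assumes V: "subring V D" "V \<subseteq> ring_center D"
    and valuation: "\<And>u v. u \<in> ring_center D \<Longrightarrow> v \<in> ring_center D \<Longrightarrow> u \<otimes> v = \<one> \<Longrightarrow> u \<in> V \<or> v \<in> V"
begin

text \<open>Divisibility with quotients in \<open>V\<close> is a total preorder on the nonzero
  elements of the center, so a finite set has an entry of least value; no value group is
  needed.\<close>

lemma valuation_dominant:
  assumes "finite K" "K \<subseteq> ring_center D" "\<exists>k\<in>K. k \<noteq> \<zero>"
  shows "\<exists>c\<in>K. c \<noteq> \<zero> \<and> (\<forall>k\<in>K. inv c \<otimes> k \<in> V)"
  using assms
proof (induction K rule: finite_induct)
  case (insert a K)
  note Vp = subringE[OF V(1)]
  have a: "a \<in> ring_center D" "a \<in> carrier D" using insert.prems center_closed by auto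
  have one: "inv a \<otimes> a = \<one>" if "a \<noteq> \<zero>" using nonzero_inv[OF a(2) that] by simp
  show ?case
  proof (cases "\<exists>k\<in>K. k \<noteq> \<zero>")
    case False
    then have "\<forall>k\<in>insert a K. k = a \<or> k = \<zero>" "a \<noteq> \<zero>" using insert.prems by auto
    then show ?thesis using one nonzero_inv[OF a(2)] Vp(2,3) by (intro bexI[of _ a]) auto
  next
    case True
    then obtain c where c: "c \<in> K" "c \<noteq> \<zero>" "\<forall>k\<in>K. inv c \<otimes> k \<in> V" using insert by auto
    have cc: "c \<in> ring_center D" "c \<in> carrier D" using c insert.prems center_closed by auto
    note ci = nonzero_inv[OF cc(2) c(2)]
    show ?thesis
    proof (cases "inv c \<otimes> a \<in> V")
      case True then show ?thesis using c by (intro bexI[of _ c]) auto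
    next
      case False
      then have a0: "a \<noteq> \<zero>" using Vp(2) ci by auto
      note ai = nonzero_inv[OF a(2) a0]
      have "(inv a \<otimes> c) \<otimes> (inv c \<otimes> a) = \<one>" using ai ci cc a c by (simp add: m_assoc cancel_left_inv)
      then have ac: "inv a \<otimes> c \<in> V" using False valuation[of "inv a \<otimes> c" "inv c \<otimes> a"]
          a cc inv_center[OF a(1) a0] inv_center[OF cc(1) c(2)] subringE(6)[OF subring_center] by auto
      have "inv a \<otimes> k \<in> V" if "k \<in> K" for k
      proof -
        have "k \<in> carrier D" using that insert.prems center_closed by auto
        then have "inv a \<otimes> k = (inv a \<otimes> c) \<otimes> (inv c \<otimes> k)" using ai ci cc c by (simp add: m_assoc cancel_left_inv)
        then show ?thesis using ac c(3) that Vp(6) by auto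
      qed
      then show ?thesis using a0 one Vp(3) by (intro bexI[of _ a]) auto
    qed
  qed
qed simp

text \<open>\<open>P\<close> is left open because denominators are cleared twice: of coordinates,
  with \<open>P = V\<close>, and of vectors, with \<open>P\<close> the lattice.\<close>

lemma common_denominator:
  assumes "finite S" "S \<subseteq> carrier D" and P: "\<And>c a. c \<in> V \<Longrightarrow> a \<in> P \<Longrightarrow> c \<otimes> a \<in> P"
    and "\<And>a. a \<in> S \<Longrightarrow> \<exists>s\<in>V. s \<noteq> \<zero> \<and> s \<otimes> a \<in> P"
  shows "\<exists>s\<in>V. s \<noteq> \<zero> \<and> (\<forall>a\<in>S. s \<otimes> a \<in> P)"
  using assms(1,2,4)
proof (induction S rule: finite_induct)
  case empty then show ?case using subringE(3)[OF V(1)] one_not_zero by auto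
next
  case (insert b S)
  obtain s where s: "s \<in> V" "s \<noteq> \<zero>" "\<forall>a\<in>S. s \<otimes> a \<in> P" using insert by auto
  obtain t where t: "t \<in> V" "t \<noteq> \<zero>" "t \<otimes> b \<in> P" using insert.prems by auto
  have c: "s \<in> carrier D" "t \<in> carrier D" "t \<in> ring_center D" using s t V center_closed by auto
  have "t \<otimes> s \<otimes> a \<in> P" if "a \<in> insert b S" for a
  proof (cases "a \<in> S")
    case True
    then show ?thesis using P[OF t(1)] s(3) c insert.prems by (simp add: m_assoc subset_iff)
  next
    case False
    then show ?thesis using that P[OF s(1) t(3)] c insert.prems center_left_comm[OF c(3,1)] by (simp add: m_assoc)
  qed
  moreover have "t \<otimes> s \<in> V" "t \<otimes> s \<noteq> \<zero>" using s t c subringE(6)[OF V(1)] mult_nonzero by auto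
  ultimately show ?case by blast
qed

text \<open>\<open>\<Lambda>\<close> is the left order of the \<open>V\<close>-lattice spanned by a basis of \<open>D\<close> over its center.\<close>

lemma valued_order_exists:
  assumes fin: "finite_dimension (ring_center D) (carrier D)"
    and delta: "\<delta> \<in> V" "\<delta> \<noteq> \<zero>" "\<And>v. v \<in> V \<Longrightarrow> \<delta> \<otimes> v \<noteq> \<one>"
    and delta_prime: "\<And>q. Factorial_Ring.prime q \<Longrightarrow> nmult q \<one> \<noteq> \<zero> \<Longrightarrow>
      \<exists>m\<in>V. (\<forall>v\<in>V. m \<otimes> v \<noteq> \<one>) \<and> \<delta> = nmult q \<one> \<otimes> m"
  shows "\<exists>\<Lambda>. valued_order D V \<Lambda> \<delta>"
proof -
  let ?F = "ring_center D"
  note Vp = subringE[OF V(1)]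
  obtain n where "dimension n ?F (carrier D)" using fin unfolding finite_dimension_def by blast
  then obtain Us where Us: "set Us \<subseteq> carrier D" "independent ?F Us" "Span ?F Us = carrier D"
    using exists_base[OF subfield_center] by blast
  define L where "L = coefficient_span V Us"
  note Lsmult = coefficient_span_scale[OF V Us(1), folded L_def]
  note Ladd = coefficient_span_add[OF V Us(1), folded L_def]
  note Lzero = coefficient_span_zero[OF V Us(1), folded L_def]
  note Lgen = coefficient_span_generator[OF V Us(1), folded L_def]
  note Lmult = coefficient_span_mult[OF V Us(1), folded L_def]
  have Lc: "L \<subseteq> carrier D" using coefficient_span_closed[OF V Us(1)] by (auto simp: L_def)
  have coords: "\<exists>Ks. set Ks \<subseteq> ?F \<and> length Ks = length Us \<and> a = combine Ks Us" if "a \<in> carrier D" for a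
    using Span_mem_iff_length_version[OF subfield_center Us(1)] Us(3) that by blast
  have spanning_nonzero: "\<exists>u\<in>set Us. u \<noteq> \<zero>"
    using basis_has_nonzero[OF Us(1)] coords[OF one_closed] center_closed one_not_zero by (metis subset_eq)
  define \<Lambda> where "\<Lambda> = {d \<in> carrier D. \<forall>l\<in>L. d \<otimes> l \<in> L}"
  have \<Lambda>I: "d \<in> \<Lambda>" if "d \<in> carrier D" "\<And>u. u \<in> set Us \<Longrightarrow> d \<otimes> u \<in> L" for d
    using Lmult that by (auto simp: \<Lambda>_def)
  have sub: "subring \<Lambda> D"
  proof (rule subringI)
    fix d assume d: "d \<in> \<Lambda>"
    have "\<ominus> d \<otimes> l \<in> L" if "l \<in> L" for l
    proof -
      have "\<ominus> d \<otimes> l = (\<ominus> \<one>) \<otimes> (d \<otimes> l)" using d that Lc by (auto simp: \<Lambda>_def l_minus)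
      then show ?thesis using Lsmult[of "\<ominus> \<one>" "d \<otimes> l"] Vp(3,5) d that by (auto simp: \<Lambda>_def)
    qed
    then show "\<ominus> d \<in> \<Lambda>" using d by (simp add: \<Lambda>_def)
  next
    fix d e assume de: "d \<in> \<Lambda>" "e \<in> \<Lambda>"
    show "d \<otimes> e \<in> \<Lambda>" using de Lc by (auto simp: \<Lambda>_def m_assoc subset_iff)
    show "d \<oplus> e \<in> \<Lambda>" using de Lc Ladd by (auto simp: \<Lambda>_def l_distr subset_iff)
  qed (use Lc in \<open>auto simp: \<Lambda>_def\<close>)
  have V\<Lambda>: "V \<subseteq> \<Lambda>" using Lsmult Vp(1) by (auto simp: \<Lambda>_def)
  have scaling: "\<exists>s\<in>V. s \<noteq> \<zero> \<and> s \<otimes> d \<in> \<Lambda>" if d: "d \<in> carrier D" for d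
  proof -
    have "\<exists>s\<in>V. s \<noteq> \<zero> \<and> s \<otimes> a \<in> L" if a: "a \<in> carrier D" for a
    proof -
      obtain Ks where k: "set Ks \<subseteq> ?F" "length Ks = length Us" "a = combine Ks Us" using coords[OF a] by blast
      have "\<exists>s\<in>V. s \<noteq> \<zero> \<and> s \<otimes> k \<in> V" if "k \<in> set Ks" for k
      proof (cases "k \<in> V")
        case True then show ?thesis using Vp(1,3) one_not_zero by (intro bexI[of _ \<one>]) auto
      next
        case False
        then have k0: "k \<noteq> \<zero>" using Vp(2) by auto
        have kc: "k \<in> ?F" "k \<in> carrier D" using k that center_closed by auto
        note ki = nonzero_inv[OF kc(2) k0]
        have "inv k \<in> V" using valuation[OF kc(1) inv_center[OF kc(1) k0]] False ki by auto
        then show ?thesis using ki Vp(3) by (intro bexI[of _ "inv k"]) auto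
      qed
      then have "\<exists>s\<in>V. s \<noteq> \<zero> \<and> (\<forall>k\<in>set Ks. s \<otimes> k \<in> V)"
        using k(1) center_closed Vp(6) by (intro common_denominator) auto
      then obtain s where s: "s \<in> V" "s \<noteq> \<zero>" "\<forall>k\<in>set Ks. s \<otimes> k \<in> V" by blast
      have "s \<otimes> a = combine (map ((\<otimes>) s) Ks) Us"
        unfolding k(3) using k Us(1) center_closed s Vp(1) by (intro combine_r_distr) auto
      then show ?thesis using s k(2) unfolding L_def coefficient_span_def
        by (intro bexI[of _ s] conjI CollectI exI[of _ "map ((\<otimes>) s) Ks"]) auto
    qed
    then have "\<exists>s\<in>V. s \<noteq> \<zero> \<and> (\<forall>a\<in>(\<lambda>u. d \<otimes> u) ` set Us. s \<otimes> a \<in> L)"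
      using Us(1) d Lsmult by (intro common_denominator) auto
    then obtain s where s: "s \<in> V" "s \<noteq> \<zero>" "\<And>u. u \<in> set Us \<Longrightarrow> s \<otimes> (d \<otimes> u) \<in> L" by auto
    have "s \<otimes> d \<in> \<Lambda>" using s d Vp(1) Us(1) by (intro \<Lambda>I) (auto simp: m_assoc subset_iff)
    then show ?thesis using s by blast
  qed
  have primitive: "\<exists>c\<in>?F. c \<otimes> d \<in> \<Lambda> \<and> (\<forall>m\<in>V. (\<forall>v\<in>V. m \<otimes> v \<noteq> \<one>) \<longrightarrow> (\<forall>l\<in>\<Lambda>. c \<otimes> d \<noteq> m \<otimes> l))"
    if d: "d \<in> carrier D" "d \<noteq> \<zero>" for d
  proof -
    \<comment> \<open>The lists \<open>Ks u\<close> are the columns of the matrix of left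
      multiplication by \<open>d\<close>; primitivity is read off from its entries.\<close>
    have "\<exists>Ks. \<forall>u\<in>set Us. set (Ks u) \<subseteq> ?F \<and> length (Ks u) = length Us \<and> d \<otimes> u = combine (Ks u) Us"
      using coords d Us(1) by (intro bchoice) auto
    then obtain Ks where k: "\<And>u. u \<in> set Us \<Longrightarrow> set (Ks u) \<subseteq> ?F" "\<And>u. u \<in> set Us \<Longrightarrow> length (Ks u) = length Us"
      "\<And>u. u \<in> set Us \<Longrightarrow> d \<otimes> u = combine (Ks u) Us" by metis
    define K where "K = (\<Union>u\<in>set Us. set (Ks u))"
    have K: "finite K" "K \<subseteq> ?F" using k by (auto simp: K_def)
    have "\<exists>k\<in>K. k \<noteq> \<zero>"
    proof (rule ccontr)
      assume n: "\<not> (\<exists>k\<in>K. k \<noteq> \<zero>)"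
      have "u = \<zero>" if u: "u \<in> set Us" for u
      proof -
        have "Ks u = replicate (length Us) \<zero>" using n u k(2)[OF u] by (auto simp: K_def intro!: replicate_eqI)
        then have "d \<otimes> u = \<zero>" using k(3)[OF u] combine_replicate[OF Us(1)] by simp
        then show "u = \<zero>" using integral d u Us(1) by blast
      qed
      then show False using spanning_nonzero by blast
    qed
    \<comment> \<open>Division by an entry \<open>c\<close> of least value puts all entries into
      \<open>V\<close> and makes one of them \<open>1\<close>.\<close>
    then obtain c where c: "c \<in> K" "c \<noteq> \<zero>" "\<forall>k\<in>K. inv c \<otimes> k \<in> V" using valuation_dominant[OF K] by blast
    then obtain u where u: "u \<in> set Us" "c \<in> set (Ks u)" by (auto simp: K_def)
    have cc: "c \<in> ?F" "c \<in> carrier D" using c K center_closed by auto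
    note ci = nonzero_inv[OF cc(2) c(2)] 
    have icF: "inv c \<in> ?F" using inv_center cc c by blast
    have du: "inv c \<otimes> d \<otimes> u = combine (map ((\<otimes>) (inv c)) (Ks u)) Us" if "u \<in> set Us" for u
    proof -
      have "inv c \<otimes> d \<otimes> u = inv c \<otimes> combine (Ks u) Us" using k(3)[OF that] that ci d Us(1) by (auto simp: m_assoc)
      then show ?thesis using combine_r_distr[of "Ks u" Us "inv c"] k(1)[OF that] ci Us(1) center_closed by auto
    qed
    have 1: "inv c \<otimes> d \<in> \<Lambda>"
    proof (rule \<Lambda>I)
      fix u assume u: "u \<in> set Us"
      show "inv c \<otimes> d \<otimes> u \<in> L" unfolding du[OF u] L_def coefficient_span_def
        using c(3) u k(2)[OF u] by (auto simp: K_def intro!: exI[of _ "map ((\<otimes>) (inv c)) (Ks u)"])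
    qed (use ci d in simp)
    \<comment> \<open>By uniqueness of coordinates, an equation \<open>inv c d = m l\<close> would
      make every entry of the column of \<open>u\<close> divisible by \<open>m\<close>, including
      the entry \<open>1\<close>.\<close>
    have 2: "inv c \<otimes> d \<noteq> m \<otimes> l" if m: "m \<in> V" "\<forall>v\<in>V. m \<otimes> v \<noteq> \<one>" and l: "l \<in> \<Lambda>" for m l
    proof
      assume eq: "inv c \<otimes> d = m \<otimes> l"
      have "l \<otimes> u \<in> L" using l Lgen[OF u(1)] by (auto simp: \<Lambda>_def)
      then obtain Js where j: "l \<otimes> u = combine Js Us" "set Js \<subseteq> V" "length Js = length Us"
        unfolding L_def coefficient_span_def by blast
      have cl: "m \<in> carrier D" "l \<in> carrier D" "u \<in> carrier D" using m Vp(1) l u Us(1) by (auto simp: \<Lambda>_def)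
      have "m \<otimes> l \<otimes> u = combine (map ((\<otimes>) m) Js) Us"
        using j combine_r_distr[of Js Us m] cl Vp(1) Us(1) by (auto simp: m_assoc)
      then have e2: "combine (map ((\<otimes>) m) Js) Us = combine (map ((\<otimes>) (inv c)) (Ks u)) Us"
        using du[OF u(1)] eq by simp
      have "inv c \<otimes> d \<otimes> u \<in> Span ?F Us" using Us(3) ci d cl by simp
      from unique_decomposition[OF subfield_center Us(2) this]
      have uniq: "Xs = Ys" if "set Xs \<subseteq> ?F" "length Xs = length Us" "inv c \<otimes> d \<otimes> u = combine Xs Us"
        "set Ys \<subseteq> ?F" "length Ys = length Us" "inv c \<otimes> d \<otimes> u = combine Ys Us" for Xs Ys
        using that by blast
      have mj: "set (map ((\<otimes>) m) Js) \<subseteq> ?F" "set (map ((\<otimes>) (inv c)) (Ks u)) \<subseteq> ?F"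
        using subsetD[OF V(2) m(1)] subset_trans[OF j(2) V(2)] subringE(6)[OF subring_center] k(1)[OF u(1)] icF
        by auto
      have "map ((\<otimes>) m) Js = map ((\<otimes>) (inv c)) (Ks u)"
        using uniq[OF mj(1) _ _ mj(2)] j(3) k(2)[OF u(1)] du[OF u(1)] e2 by simp
      moreover have "\<one> \<in> set (map ((\<otimes>) (inv c)) (Ks u))" using u(2) ci by force
      ultimately have "\<one> \<in> (\<otimes>) m ` set Js" by (metis list.set_map)
      then show False using m j(2) by auto
    qed
    show ?thesis using 1 2 icF by (intro bexI[of _ "inv c"]) auto
  qed
  have "valued_order D V \<Lambda> \<delta>"
    by (intro valued_order.intro valued_order_axioms.intro)
      (fact skew_field_axioms V valuation sub V\<Lambda> scaling primitive delta delta_prime)+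
  then show ?thesis ..
qed

text \<open>The residue characteristic is two, so odd integers become units. Concretely,
  \<open>q / 2 = k + 1 / 2\<close> is not in \<open>V\<close>, hence \<open>2 / q\<close> is, and
  \<open>1 / q = 1 - k (2 / q)\<close>.\<close>

lemma odd_inverse_in_valuation_ring:
  assumes t: "t \<in> ring_center D" "nmult 2 \<one> \<otimes> t = \<one>" "t \<notin> V"
    and q: "odd q" "nmult q \<one> \<noteq> \<zero>"
  shows "inv (nmult q \<one>) \<in> V"
proof -
  note Vp = subringE[OF V(1)]
  let ?n = "\<lambda>n. nmult n \<one>"
  have nV: "?n n \<in> V" for n by (induction n) (use Vp in auto)
  note nF = nat_multiple_center
  have nc: "?n n \<in> carrier D" for n by simp
  have tc: "t \<in> carrier D" using t center_closed by auto
  note qi = nonzero_inv[OF nc q(2)]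
  have iF: "inv (?n q) \<in> ring_center D" using inv_center[OF nF q(2)] .
  obtain k where k: "q = 2 * k + 1" using q(1) by (metis oddE)
  have qn: "?n q = ?n k \<otimes> ?n 2 \<oplus> \<one>" unfolding k nat_multiple_mult by (simp add: mult.commute)
  have c1: "t \<otimes> ?n 2 = \<one>" using center_comm[OF nF tc] t(2) by simp
  have "(?n q \<otimes> t) \<otimes> (?n 2 \<otimes> inv (?n q)) = ?n q \<otimes> (t \<otimes> ?n 2) \<otimes> inv (?n q)"
    using tc qi nc by (simp add: m_assoc)
  then have "(?n q \<otimes> t) \<otimes> (?n 2 \<otimes> inv (?n q)) = \<one>" using c1 qi by simp
  from valuation[OF _ _ this] show ?thesis
  proof
    assume a: "?n q \<otimes> t \<in> V"
    have "?n q \<otimes> t = ?n k \<oplus> t" unfolding qn using tc t(2) nc by (simp add: l_distr m_assoc)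
    then have "t = \<ominus> ?n k \<oplus> (?n q \<otimes> t)" using tc nc by (simp add: r_neg1)
    then have "t \<in> V" using a nV[of k] Vp(5,7) by metis
    then show ?thesis using t by simp
  next
    assume a: "?n 2 \<otimes> inv (?n q) \<in> V"
    have "\<one> = ?n k \<otimes> (?n 2 \<otimes> inv (?n q)) \<oplus> inv (?n q)"
      using qi(3) qi(1) nc unfolding qn by (metis l_distr l_one m_assoc m_closed one_closed)
    then have "inv (?n q) = \<ominus> (?n k \<otimes> (?n 2 \<otimes> inv (?n q))) \<oplus> \<one>"
      using qi(1) nc by (metis m_closed r_neg1)
    then show ?thesis using a nV[of k] Vp(3,5,6,7) by metis
  qed (use nF iF t subringE(6)[OF subring_center] in auto)
qed

end

text \<open>Here \<open>\<delta> = 4\<close> for a valuation ring in which \<open>2\<close> is not a unit: \<open>\<delta> / q\<close> must be a nonunit also for \<open>q = 2\<close>.\<close>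

lemma valued_order_char_zero:
  assumes fin: "finite_dimension (ring_center D) (carrier D)"
    and char: "\<And>n. n > 0 \<Longrightarrow> nmult n \<one> \<noteq> \<zero>"
  shows "\<exists>V \<Lambda> \<delta>. valued_order D V \<Lambda> \<delta>"
proof -
  let ?n = "\<lambda>n. nmult n \<one>"
  define s where "s = ?n 2"
  have s: "s \<in> ring_center D" "s \<in> carrier D" "s \<noteq> \<zero>"
    using nat_multiple_center char by (auto simp: s_def)
  define t where "t = inv s"
  have t: "t \<in> ring_center D" "t \<in> carrier D" "s \<otimes> t = \<one>"
    using nonzero_inv[OF s(2,3)] inv_center[OF s(1,3)] by (auto simp: t_def)
  define A where "A = range (\<lambda>k::int. add_pow D k \<one>)"
  have AF: "A \<subseteq> ring_center D"
  proof
    fix a assume "a \<in> A"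
    then obtain k :: int where k: "a = add_pow D k \<one>" by (auto simp: A_def)
    then show "a \<in> ring_center D"
      using nat_multiple_center subringE(5)[OF subring_center] add_pow_int_ge[of k D \<one>] add_pow_int_lt[of k D \<one>]
      by (cases "k \<ge> 0") auto
  qed
  have A: "subring A D"
  proof (rule subringI)
    show "A \<subseteq> carrier D" using AF center_closed by blast
    show "\<one> \<in> A" unfolding A_def by (rule range_eqI[of _ _ 1]) simp
    fix a assume "a \<in> A"
    then obtain k :: int where "a = add_pow D k \<one>" by (auto simp: A_def)
    then have "\<ominus> a = add_pow D (- k) \<one>" by (simp add: add.int_pow_neg)
    then show "\<ominus> a \<in> A" by (auto simp: A_def)
  next
    fix a b assume "a \<in> A" "b \<in> A"
    then obtain j k :: int where "a = add_pow D j \<one>" "b = add_pow D k \<one>" by (auto simp: A_def)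
    then have "a \<oplus> b = add_pow D (j + k) \<one>" "a \<otimes> b = add_pow D (k * j) \<one>"
      by (simp_all add: add.int_pow_mult add_pow_ldistr_int add.int_pow_pow)
    then show "a \<oplus> b \<in> A" "a \<otimes> b \<in> A" by (auto simp: A_def)
  qed
  have sA: "s \<in> A" unfolding A_def s_def by (rule range_eqI[of _ _ 2]) (simp add: add_pow_int_ge)
  \<comment> \<open>If an integer \<open>k\<close> were \<open>1 / 2\<close>, the odd integer
    \<open>2 k - 1\<close> would vanish in \<open>D\<close>.\<close>
  have tA: "t \<notin> A"
  proof
    assume "t \<in> A"
    then obtain k :: int where k: "t = add_pow D k \<one>" by (auto simp: A_def)
    have "s \<otimes> t = add_pow D k s" unfolding k using s by (simp add: add_pow_rdistr_int)
    also have "\<dots> = add_pow D k (add_pow D (2::int) \<one>)" by (simp add: s_def add_pow_int_ge)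
    also have "\<dots> = add_pow D (2 * k) \<one>" by (simp add: add.int_pow_pow)
    finally have "add_pow D (2 * k) \<one> = \<one>" using t by simp
    then have z: "add_pow D (2 * k - 1) \<one> = \<zero>" using add.int_pow_diff[of \<one> "2 * k" 1] by (simp add: r_neg)
    show False
    proof (cases "2 * k - 1 \<ge> 0")
      case True
      then have "nat (2 * k - 1) > 0" by presburger
      then show False using z char add_pow_int_ge[OF True, of D \<one>] by auto
    next
      case False
      then have "nat (- (2 * k - 1)) > 0" "2 * k - 1 < 0" by auto
      moreover from this have "?n (nat (- (2 * k - 1))) = \<zero>"
        using z add_pow_int_lt[of "2 * k - 1" D \<one>] by (metis add.inv_eq_1_iff add.nat_pow_closed one_closed)
      ultimately show False using char by blast
    qed
  qed
  obtain V where V: "subring V D" "A \<subseteq> V" "V \<subseteq> ring_center D" "t \<notin> V"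
    "\<And>u v. u \<in> ring_center D \<Longrightarrow> v \<in> ring_center D \<Longrightarrow> u \<otimes> v = \<one> \<Longrightarrow> u \<in> V \<or> v \<in> V"
    using central_valuation_ring_exists[OF A AF sA t(1,3) tA] by blast
  note Vp = subringE[OF V(1)]
  have sV: "s \<in> V" using sA V by auto
  have nu: "s \<otimes> v \<noteq> \<one>" if "v \<in> V" for v
    using that V(4) inv_eqI[OF s(2), of v] Vp(1) by (auto simp: t_def)
  have nu2: "s \<otimes> w \<otimes> v \<noteq> \<one>" if "v \<in> V" "w \<in> V" for v w
    using nu[of "w \<otimes> v"] that Vp(1,6) s by (auto simp: m_assoc subset_iff)
  have "\<exists>m\<in>V. (\<forall>v\<in>V. m \<otimes> v \<noteq> \<one>) \<and> s \<otimes> s = ?n q \<otimes> m"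
    if q: "Factorial_Ring.prime q" "?n q \<noteq> \<zero>" for q
  proof (cases "q = 2")
    case True then show ?thesis using nu sV by (auto simp: s_def)
  next
    case False
    then have odd: "odd q" using q(1) prime_odd_nat[of q] prime_ge_2_nat[of q] by auto
    have i: "inv (?n q) \<in> V"
      by (rule odd_inverse_in_valuation_ring[OF V(1,3,5) t(1) t(3)[unfolded s_def] V(4) odd q(2)])
    have qc: "?n q \<in> carrier D" by simp
    note qi = nonzero_inv[OF qc q(2)]
    have "?n q \<otimes> (s \<otimes> (s \<otimes> inv (?n q))) = s \<otimes> (s \<otimes> inv (?n q)) \<otimes> ?n q"
      using center_comm[OF nat_multiple_center, of "s \<otimes> (s \<otimes> inv (?n q))" q] s(2) qi(1) by (simp only: m_closed)
    also have "\<dots> = s \<otimes> (s \<otimes> (inv (?n q) \<otimes> ?n q))" using s(2) qi(1) qc by (simp only: m_assoc m_closed)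
    also have "\<dots> = s \<otimes> s" using s(2) qi(4) by simp
    finally have "?n q \<otimes> (s \<otimes> (s \<otimes> inv (?n q))) = s \<otimes> s" .
    then show ?thesis using nu2[of _ "s \<otimes> inv (?n q)"] i sV Vp(6) by (intro bexI[of _ "s \<otimes> (s \<otimes> inv (?n q))"]) auto
  qed
  then have "\<exists>\<Lambda>. valued_order D V \<Lambda> (s \<otimes> s)"
    by (intro valued_order_exists[OF V(1,3,5) fin Vp(6)[OF sV sV] mult_nonzero[OF s(2,2,3,3)] nu2[OF _ sV]])
  then show ?thesis by blast
qed

lemma prime_subring_exists:
  assumes p: "Factorial_Ring.prime p" "nmult p \<one> = \<zero>"
  shows "\<exists>P. subring P D \<and> P \<subseteq> ring_center D \<and> finite P"
proof -
  let ?n = "\<lambda>n. nmult n \<one>"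
  have pm: "?n (p * m) = \<zero>" for m using nat_multiple_mult[of p m] p by simp
  define P where "P = ?n ` {..<p}"
  have p0: "p > 0" using p prime_gt_0_nat by blast
  have nP: "?n k \<in> P" for k
  proof -
    have "?n k = ?n (p * (k div p) + k mod p)" by simp
    also have "\<dots> = ?n (k mod p)" using pm by (simp only: add.nat_pow_mult[symmetric] one_closed) simp
    finally show ?thesis using p0 by (auto simp: P_def)
  qed
  have PF: "P \<subseteq> ring_center D" using nat_multiple_center by (auto simp: P_def)
  have P: "subring P D"
  proof (rule subringI)
    show "P \<subseteq> carrier D" "\<one> \<in> P" using nP[of 1] by (auto simp: P_def)
    fix a assume "a \<in> P"
    then obtain k where k: "a = ?n k" "k < p" by (auto simp: P_def)
    have "?n k \<oplus> ?n (p - k) = \<zero>" using k p by (simp add: add.nat_pow_mult)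
    then have "\<ominus> a = ?n (p - k)" using k by (simp add: minus_equality a_comm)
    then show "\<ominus> a \<in> P" using nP by simp
  next
    fix a b assume "a \<in> P" "b \<in> P"
    then obtain j k where "a = ?n j" "b = ?n k" by (auto simp: P_def)
    then show "a \<oplus> b \<in> P" "a \<otimes> b \<in> P" using nP nat_multiple_mult by (auto simp: add.nat_pow_mult)
  qed
  show ?thesis using P PF by (auto simp: P_def)
qed

text \<open>Here \<open>\<delta> = c\<close>, for a valuation ring that contains the polynomials in
  \<open>c\<close> over the prime field and omits \<open>1 / c\<close>. Primes other than
  \<open>p\<close> are already units in the prime field, so \<open>\<delta>\<close> may be any
  nonzero nonunit.\<close>

lemma valued_order_char_p:
  assumes fin: "finite_dimension (ring_center D) (carrier D)"
    and p: "Factorial_Ring.prime p" "nmult p \<one> = \<zero>"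
    and c: "c \<in> ring_center D" "c \<noteq> \<zero>" "\<And>n::nat. n > 0 \<Longrightarrow> c [^] n \<noteq> \<one>"
  shows "\<exists>V \<Lambda> \<delta>. valued_order D V \<Lambda> \<delta>"
proof -
  let ?n = "\<lambda>n. nmult n \<one>"
  interpret C: field "D\<lparr>carrier := ring_center D\<rparr>" by (rule field_center)
  have pm: "?n (p * m) = \<zero>" for m using nat_multiple_mult[of p m] p by simp
  obtain P where P: "subring P D" "P \<subseteq> ring_center D" "finite P"
    using prime_subring_exists[OF p] by blast
  have PC: "subring P (D\<lparr>carrier := ring_center D\<rparr>)" using central_subring_iff[OF P(2)] P(1) by simp
  let ?W = "\<lambda>n. C.poly_values P c n"
  have finW: "finite (?W n)" for n by (rule C.finite_poly_values[OF PC P(3)])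
  have cC: "c \<in> carrier (D\<lparr>carrier := ring_center D\<rparr>)" "c \<in> carrier D" using c center_closed by auto
  note ci = nonzero_inv[OF cC(2) c(2)]
  define t where "t = inv c"
  have t: "t \<in> ring_center D" "t \<in> carrier D" "c \<otimes> t = \<one>" "t \<otimes> c = \<one>" "t \<noteq> \<zero>"
    using ci inv_center[OF c(1,2)] by (auto simp: t_def)
  define A where "A = (\<Union>n. ?W n)"
  have A: "subring A (D\<lparr>carrier := ring_center D\<rparr>)" unfolding A_def by (rule C.subring_poly_values[OF PC cC(1)])
  have AF: "A \<subseteq> ring_center D" using subringE(1)[OF A] by simp
  have cA: "c \<in> A" using C.poly_values_gen[OF PC cC(1)] unfolding A_def by blast
  \<comment> \<open>If \<open>1 / c\<close> were a polynomial in \<open>c\<close>, a finite set of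
    polynomials of bounded degree would be stable under multiplication by \<open>1 / c\<close>,
    which lowers degrees and turns the constant term \<open>b\<close> into \<open>b / c\<close>.
    Then \<open>1 / c\<close>, and so \<open>c\<close>, would be torsion.\<close>
  have tA: "t \<notin> A"
  proof
    assume "t \<in> A"
    then obtain m where "t \<in> ?W m" by (auto simp: A_def)
    then have m: "t \<in> ?W (Suc m)" using C.poly_values_Suc[OF PC cC(1)] by blast
    have step: "t \<otimes> w \<in> ?W (Suc m)" if w: "w \<in> ?W (Suc m)" for w
    proof -
      obtain b v where b: "b \<in> P" "v \<in> ?W m" "w = b \<oplus> v \<otimes> c"
        using C.poly_values_head[OF PC cC(1) w] by auto
      have cc: "b \<in> carrier D" "v \<in> carrier D" "v \<in> ring_center D"
        using b P(2) C.poly_values_closed[OF PC cC(1) b(2)] center_closed by auto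
      have "t \<otimes> w = b \<otimes> t \<oplus> v"
      proof -
        have "t \<otimes> w = w \<otimes> t" using center_comm[OF t(1), of w] b(3) cc cC(2) by simp
        then show ?thesis unfolding b(3) using cc t cC(2) by (simp add: l_distr m_assoc)
      qed
      moreover have "b \<otimes> t \<in> ?W (Suc m)" using C.poly_values_smult[OF PC cC(1) b(1) m] by simp
      moreover have "v \<in> ?W (Suc m)" using C.poly_values_Suc[OF PC cC(1) b(2)] .
      ultimately show ?thesis using C.poly_values_add[OF PC cC(1)] by (simp del: C.poly_values.simps)
    qed
    have one: "\<one> \<in> ?W (Suc m)"
      using C.poly_values_mono[OF PC cC(1), of \<one> 0 "Suc m"] subringE(3)[OF P(1)] by simp
    have "t [^] j \<otimes> \<one> \<in> ?W (Suc m)" for j :: nat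
    proof (induction j)
      case (Suc j) then show ?case using step[of "t [^] j"] t nat_pow_Suc2[OF t(2), of j] by simp
    qed (use one in simp)
    then obtain n :: nat where n: "n > 0" "t [^] n = \<one>"
      using torsion_of_finite_orbit[OF t(2,5) one_closed one_not_zero finW] by blast
    have "c [^] n \<otimes> t [^] n = \<one>" using pow_mult_commute[OF cC(2) t(2), of n] t by simp
    then show False using n c(3)[OF n(1)] cC by simp
  qed
  obtain V where V: "subring V D" "A \<subseteq> V" "V \<subseteq> ring_center D" "t \<notin> V"
    "\<And>u v. u \<in> ring_center D \<Longrightarrow> v \<in> ring_center D \<Longrightarrow> u \<otimes> v = \<one> \<Longrightarrow> u \<in> V \<or> v \<in> V"
    using central_valuation_ring_exists[OF _ AF cA t(1,3) tA] A central_subring_iff[OF AF] by blast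
  note Vp = subringE[OF V(1)]
  have cV: "c \<in> V" using cA V by auto
  have nV: "?n n \<in> V" for n by (induction n) (use Vp in auto)
  have nu: "c \<otimes> v \<noteq> \<one>" if "v \<in> V" for v
    using that V(4) inv_eqI[OF cC(2), of v] Vp(1) by (auto simp: t_def)
  have "\<exists>m\<in>V. (\<forall>v\<in>V. m \<otimes> v \<noteq> \<one>) \<and> c = ?n q \<otimes> m"
    if q: "Factorial_Ring.prime q" "?n q \<noteq> \<zero>" for q
  proof -
    have "q \<noteq> p" using p q by auto
    then have "coprime q p" using primes_coprime p(1) q(1) by blast
    \<comment> \<open>Bezout makes the multiple \<open>r\<close> of one the inverse of
      \<open>q\<close> in \<open>D\<close>.\<close>
    then obtain r y where "q * r = p * y + 1" using bezout_nat[of q p] prime_gt_0_nat[OF q(1)] by auto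
    then have "?n (q * r) = ?n (p * y) \<oplus> ?n 1" by (metis add.nat_pow_mult one_closed)
    then have qr: "?n (q * r) = \<one>" using pm by simp
    have "?n q \<otimes> (c \<otimes> ?n r) = c \<otimes> ?n (q * r)"
      using center_left_comm[OF c(1), of "?n q" "?n r"] nat_multiple_mult by simp
    then have "c = ?n q \<otimes> (c \<otimes> ?n r)" using qr cC by simp
    moreover have "c \<otimes> ?n r \<otimes> v \<noteq> \<one>" if "v \<in> V" for v
      using nu[of "?n r \<otimes> v"] that Vp(1,6) nV cC by (auto simp: m_assoc subset_iff)
    ultimately show ?thesis using cV nV Vp(6) by blast
  qed
  then have "\<exists>\<Lambda>. valued_order D V \<Lambda> c"
    by (intro valued_order_exists[OF V(1,3,5) fin cV c(2) nu])
  then show ?thesis by blast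
qed

end

section \<open>Division rings with torsion multiplicative group\<close>

context skew_field
begin

lemma finsum_cyclic_shift:
  assumes "\<And>j. T j \<in> carrier D" "T (Suc n) = T 0"
  shows "(\<Oplus>j\<in>{..n}. T (Suc j)) = (\<Oplus>j\<in>{..n::nat}. T j)"
proof -
  have c: "(\<Oplus>j\<in>{..n}. T (Suc j)) \<in> carrier D" "(\<Oplus>j\<in>{..n}. T j) \<in> carrier D"
    using assms(1) by (auto intro!: finsum_closed)
  have "T (Suc n) \<oplus> (\<Oplus>j\<in>{..n}. T j) = (\<Oplus>j\<in>{..Suc n}. T j)"
    using assms(1) by (subst finsum_Suc) auto
  also have "\<dots> = (\<Oplus>j\<in>{..n}. T (Suc j)) \<oplus> T 0" using assms(1) by (subst finsum_Suc2) auto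
  finally have "T 0 \<oplus> (\<Oplus>j\<in>{..n}. T (Suc j)) = T 0 \<oplus> (\<Oplus>j\<in>{..n}. T j)"
    using c assms a_comm by simp
  then show ?thesis using add.l_cancel[OF _ c assms(1)[of 0]] by blast
qed

text \<open>Subtracting \<open>x a\<close> times relation \<open>j\<close> from relation
  \<open>j + 1\<close> removes \<open>c a\<close> and replaces each other \<open>c i\<close> by
  \<open>(x i - x a) c i\<close>. Only the nodes have to commute with each other; the coefficients
  stand on the right and are arbitrary.\<close>

lemma vandermonde_trivial:
  assumes "finite I" "inj_on x I" "\<And>i. i \<in> I \<Longrightarrow> x i \<in> carrier D" "\<And>i. i \<in> I \<Longrightarrow> c i \<in> carrier D"
    and "\<And>i k. i \<in> I \<Longrightarrow> k \<in> I \<Longrightarrow> x i \<otimes> x k = x k \<otimes> x i"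
    and "\<And>j::nat. (\<Oplus>i\<in>I. x i [^] j \<otimes> c i) = \<zero>" and "i \<in> I"
  shows "c i = \<zero>"
  using assms
proof (induction I arbitrary: c i rule: finite_induct)
  case (insert a I)
  note xc = insert.prems(2) and cc = insert.prems(3) and comm = insert.prems(4)
  have summand: "(\<lambda>i. x i [^] j \<otimes> c i) \<in> I \<rightarrow> carrier D" for j :: nat using xc cc by auto
  have rel: "x a [^] j \<otimes> c a \<oplus> (\<Oplus>i\<in>I. x i [^] j \<otimes> c i) = \<zero>" for j :: nat
    using insert.prems(5)[of j] insert.hyps summand xc cc by simp
  have zero: "(\<Oplus>i\<in>I. x i [^] j \<otimes> ((x i \<ominus> x a) \<otimes> c i)) = \<zero>" for j :: nat
  proof -
    let ?S = "\<lambda>j. \<Oplus>i\<in>I. x i [^] (j::nat) \<otimes> c i"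
    have Sc: "?S j \<in> carrier D" for j using summand by (intro finsum_closed) auto
    have ac: "x a \<in> carrier D" "c a \<in> carrier D" using xc cc by auto
    have comm_pow: "x i [^] j \<otimes> x a = x a \<otimes> x i [^] j" if "i \<in> I" for i
      using that xc comm[of i a] group_commutes_pow by simp
    have "x i [^] j \<otimes> ((x i \<ominus> x a) \<otimes> c i) = x i [^] Suc j \<otimes> c i \<oplus> (\<ominus> x a) \<otimes> (x i [^] j \<otimes> c i)" if "i \<in> I" for i
    proof -
      have c: "x i \<in> carrier D" "c i \<in> carrier D" using that xc cc by auto
      have "x i [^] j \<otimes> ((x i \<ominus> x a) \<otimes> c i) = x i [^] Suc j \<otimes> c i \<oplus> \<ominus> (x i [^] j \<otimes> x a \<otimes> c i)"
        using c ac by (simp add: a_minus_def l_distr r_distr l_minus r_minus m_assoc)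
      then show ?thesis unfolding comm_pow[OF that] using c ac by (simp add: l_minus m_assoc)
    qed
    then have "(\<Oplus>i\<in>I. x i [^] j \<otimes> ((x i \<ominus> x a) \<otimes> c i)) =
        (\<Oplus>i\<in>I. x i [^] Suc j \<otimes> c i \<oplus> (\<ominus> x a) \<otimes> (x i [^] j \<otimes> c i))"
      using xc cc ac by (intro finsum_cong') (auto simp del: nat_pow_Suc)
    also have "\<dots> = ?S (Suc j) \<oplus> (\<Oplus>i\<in>I. (\<ominus> x a) \<otimes> (x i [^] j \<otimes> c i))"
      using xc cc ac by (intro finsum_addf) (auto simp del: nat_pow_Suc)
    also have "(\<Oplus>i\<in>I. (\<ominus> x a) \<otimes> (x i [^] j \<otimes> c i)) = (\<ominus> x a) \<otimes> ?S j"
      using xc cc ac insert.hyps by (intro finsum_rdistr[symmetric]) auto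
    also have "?S (Suc j) = \<ominus> (x a \<otimes> (x a [^] j \<otimes> c a))"
    proof -
      have "x a [^] Suc j \<otimes> c a = x a \<otimes> (x a [^] j \<otimes> c a)"
        using ac nat_pow_Suc2[OF ac(1), of j] by (simp add: m_assoc)
      then show ?thesis using rel[of "Suc j"] ac Sc[of "Suc j"] by (metis minus_equality a_comm m_closed nat_pow_closed)
    qed
    also have "\<ominus> (x a \<otimes> (x a [^] j \<otimes> c a)) \<oplus> (\<ominus> x a) \<otimes> ?S j = (\<ominus> x a) \<otimes> (x a [^] j \<otimes> c a \<oplus> ?S j)"
      using ac Sc by (simp add: r_distr l_minus)
    finally show ?thesis using rel[of j] ac by simp
  qed
  have I: "c k = \<zero>" if k: "k \<in> I" for k
  proof -
    have "(x k \<ominus> x a) \<otimes> c k = \<zero>"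
    proof (rule insert.IH[of "\<lambda>i. (x i \<ominus> x a) \<otimes> c i" k])
      show "inj_on x I" using insert.prems(1) by simp
    qed (use xc cc comm zero k in auto)
    moreover have "x k \<noteq> x a" using insert.prems(1) insert.hyps(2) k by (metis inj_onD insertCI)
    then have "x k \<ominus> x a \<noteq> \<zero>" using xc k by simp
    ultimately show ?thesis using integral[of "x k \<ominus> x a" "c k"] xc cc k by auto
  qed
  have "(\<Oplus>i\<in>I. x i [^] (0::nat) \<otimes> c i) = (\<Oplus>i\<in>I. \<zero>)"
    using I xc by (intro finsum_cong') auto
  then have "c a = \<zero>" using rel[of 0] xc cc by simp
  then show ?case using I insert.prems(6) by auto
qed simp

text \<open>\<open>K\<close> is enlarged one torsion element at a time; over a finite ring the powers of such an element span a
  finite ring.\<close>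

lemma finite_central_subring:
  assumes p: "Factorial_Ring.prime p" "nmult p \<one> = \<zero>"
    and K: "finite K" "K \<subseteq> ring_center D" "\<And>c. c \<in> K \<Longrightarrow> c \<noteq> \<zero> \<Longrightarrow> \<exists>n::nat. n > 0 \<and> c [^] n = \<one>"
  shows "\<exists>R. subring R D \<and> R \<subseteq> ring_center D \<and> finite R \<and> K \<subseteq> R"
  using K
proof (induction K rule: finite_induct)
  case empty then show ?case using prime_subring_exists[OF p] by auto
next
  case (insert c K)
  then obtain R where R: "subring R D" "R \<subseteq> ring_center D" "finite R" "K \<subseteq> R" by auto
  show ?case
  proof (cases "c = \<zero>")
    case True then show ?thesis using R subringE(2)[OF R(1)] by auto
  next
    case False
    then obtain k :: nat where k: "k > 0" "c [^] k = \<one>" using insert.prems by auto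
    interpret C: field "D\<lparr>carrier := ring_center D\<rparr>" by (rule field_center)
    have C_pow: "x [^]\<^bsub>D\<lparr>carrier := ring_center D\<rparr>\<^esub> (n::nat) = x [^] n" for x n
      by (simp add: nat_pow_def)
    have RC: "subring R (D\<lparr>carrier := ring_center D\<rparr>)" using central_subring_iff[OF R(2)] R(1) by simp
    have cC: "c \<in> carrier (D\<lparr>carrier := ring_center D\<rparr>)" "c \<in> carrier D" using insert.prems center_closed by auto
    let ?W = "\<lambda>n. C.poly_values R c n"
    \<comment> \<open>As \<open>c^k = 1\<close>, exponents reduce modulo \<open>k\<close>, and
      degrees beyond \<open>k\<close> give nothing new.\<close>
    have "?W n \<subseteq> ?W k" for n
    proof (induction n)
      case 0 then show ?case using C.poly_values_mono[OF RC cC(1), of _ 0 k] by auto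
    next
      case (Suc n)
      have "c [^] Suc n = c [^] (k * (Suc n div k) + Suc n mod k)" by (simp only: mult_div_mod_eq)
      also have "\<dots> = (c [^] k) [^] (Suc n div k) \<otimes> c [^] (Suc n mod k)"
        by (simp only: nat_pow_mult[OF cC(2), symmetric] nat_pow_pow[OF cC(2), symmetric])
      also have "\<dots> = c [^] (Suc n mod k)" using cC k by simp
      finally have "c [^] Suc n \<in> ?W (Suc n mod k)"
        using C.poly_values_power[OF RC cC(1), of "Suc n mod k"] by (simp add: C_pow del: nat_pow_Suc)
      then have "c [^] Suc n \<in> ?W k"
        using C.poly_values_mono[OF RC cC(1), of _ "Suc n mod k" k] k by (simp add: less_imp_le)
      then show ?case
        using Suc C.poly_values_add[OF RC cC(1)] C.poly_values_smult[OF RC cC(1)]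
        by (auto simp: C_pow simp del: nat_pow_Suc)
    qed
    then have U: "(\<Union>n. ?W n) = ?W k" by auto
    have sub: "subring (?W k) (D\<lparr>carrier := ring_center D\<rparr>)"
      using C.subring_poly_values[OF RC cC(1)] U by simp
    then have F: "?W k \<subseteq> ring_center D" using subringE(1) by fastforce
    have "R \<subseteq> ?W k" using C.poly_values_mono[OF RC cC(1), of _ 0 k] by auto
    moreover have "c \<in> ?W k" using C.poly_values_gen[OF RC cC(1)] U by blast
    moreover have "finite (?W k)" using C.finite_poly_values[OF RC R(3)] .
    ultimately show ?thesis using R(4) F sub central_subring_iff[OF F] by blast
  qed
qed

text \<open>The matrix of left multiplication by \<open>d\<close> has entries in a finite central
  ring \<open>R\<close>. So the \<open>R\<close>-span of the basis is a finite set stable under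
  \<open>d\<close>, and it contains the orbit of a nonzero basis vector.\<close>

lemma torsion_of_central_torsion:
  assumes fin: "finite_dimension (ring_center D) (carrier D)"
    and p: "Factorial_Ring.prime p" "nmult p \<one> = \<zero>"
    and tor: "\<And>c. c \<in> ring_center D \<Longrightarrow> c \<noteq> \<zero> \<Longrightarrow> \<exists>n::nat. n > 0 \<and> c [^] n = \<one>"
    and d: "d \<in> carrier D" "d \<noteq> \<zero>"
  shows "\<exists>n::nat. n > 0 \<and> d [^] n = \<one>"
proof -
  let ?F = "ring_center D"
  obtain n where "dimension n ?F (carrier D)" using fin unfolding finite_dimension_def by blast
  then obtain Us where Us: "set Us \<subseteq> carrier D" "Span ?F Us = carrier D"
    using exists_base[OF subfield_center] by blast
  have coords: "\<exists>Ks. set Ks \<subseteq> ?F \<and> length Ks = length Us \<and> a = combine Ks Us" if "a \<in> carrier D" for a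
    using Span_mem_iff_length_version[OF subfield_center Us(1)] Us(2) that by blast
  have "\<exists>Ks. \<forall>u\<in>set Us. set (Ks u) \<subseteq> ?F \<and> length (Ks u) = length Us \<and> d \<otimes> u = combine (Ks u) Us"
    using coords d Us(1) by (intro bchoice) auto
  then obtain Ks where k: "\<And>u. u \<in> set Us \<Longrightarrow> set (Ks u) \<subseteq> ?F" "\<And>u. u \<in> set Us \<Longrightarrow> length (Ks u) = length Us"
    "\<And>u. u \<in> set Us \<Longrightarrow> d \<otimes> u = combine (Ks u) Us" by metis
  define K where "K = (\<Union>u\<in>set Us. set (Ks u))"
  have K: "finite K" "K \<subseteq> ?F" using k by (auto simp: K_def)
  obtain R where R: "subring R D" "R \<subseteq> ?F" "finite R" "K \<subseteq> R"
    using finite_central_subring[OF p K] tor K(2) by (metis subsetD)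
  obtain u where u: "u \<in> set Us" "u \<noteq> \<zero>"
    using basis_has_nonzero[OF Us(1)] coords[OF one_closed] center_closed one_not_zero by (metis subset_eq)
  have uc: "u \<in> carrier D" using u Us by auto
  have step: "d \<otimes> a \<in> coefficient_span R Us" if "a \<in> coefficient_span R Us" for a
  proof (rule coefficient_span_mult[OF R(1,2) Us(1) d(1) _ that])
    fix v assume v: "v \<in> set Us"
    then have "set (Ks v) \<subseteq> R" using R(4) by (auto simp: K_def)
    then show "d \<otimes> v \<in> coefficient_span R Us"
      using k(2,3)[OF v] unfolding coefficient_span_def by blast
  qed
  have "d [^] j \<otimes> u \<in> coefficient_span R Us" for j :: nat
  proof (induction j)
    case 0 then show ?case using coefficient_span_generator[OF R(1,2) Us(1) u(1)] uc by simp
  next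
    case (Suc j)
    from step[OF this] show ?case using d uc nat_pow_Suc2[OF d(1), of j] by (simp add: m_assoc)
  qed
  then show ?thesis
    using torsion_of_finite_orbit[OF d uc u(2) finite_coefficient_span[OF R(1,2) Us(1) R(3)]] by blast
qed

text \<open>The Fourier coefficients \<open>\<Sum>\<^sub>j x\<^sup>-\<^sup>i\<^sup>j \<sigma>\<^sup>j(d)\<close> with respect to conjugation \<open>\<sigma>\<close> by \<open>x\<close> are eigenvectors of \<open>\<sigma>\<close>,
  and they do not all vanish.\<close>

lemma torsion_normalizing_element:
  assumes x: "x \<in> carrier D" "x \<noteq> \<zero>" "x \<notin> ring_center D" and tor: "(n::nat) > 0" "x [^] n = \<one>"
  shows "\<exists>y\<in>carrier D. \<exists>s::nat. y \<noteq> \<zero> \<and> conjugate y x = x [^] s \<and> conjugate y x \<noteq> x"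
proof -
  define M where "M = (LEAST n::nat. n > 0 \<and> x [^] n = \<one>)"
  have M: "M > 0" "x [^] M = \<one>" using LeastI[of "\<lambda>n. n > 0 \<and> x [^] n = \<one>" n] tor unfolding M_def by auto
  have least: "x [^] k \<noteq> \<one>" if "0 < k" "k < M" for k
    using not_less_Least[of k "\<lambda>n. n > 0 \<and> x [^] n = \<one>"] that unfolding M_def by auto
  obtain m where m: "M = Suc m" using M(1) by (cases M) auto
  \<comment> \<open>The inverse of \<open>x\<close>, written as a power so that the final exponent
    is a natural number.\<close>
  define w where "w = x [^] m"
  have w: "w \<in> carrier D" "w \<noteq> \<zero>" using x pow_nonzero by (auto simp: w_def)
  have wx: "w \<otimes> x = \<one>" "x \<otimes> w = \<one>" using M(2) nat_pow_Suc2[OF x(1), of m] by (auto simp: w_def m)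
  have wj: "x [^] j \<otimes> w [^] j = \<one>" for j :: nat
    using pow_mult_commute[OF x(1) w(1), of j] wx by simp
  have inj: "inj_on (\<lambda>j. w [^] j) {..m}"
  proof (rule linorder_inj_onI')
    fix i j assume ij: "i \<in> {..m}" "j \<in> {..m}" "i < j"
    show "w [^] i \<noteq> w [^] j"
    proof
      assume "w [^] i = w [^] j"
      then have "x [^] j \<otimes> w [^] i = \<one>" using wj by simp
      moreover have "x [^] j = x [^] (j - i) \<otimes> x [^] i" using ij x by (simp add: nat_pow_mult)
      ultimately have "x [^] (j - i) = \<one>" using x w wj[of i] by (simp add: m_assoc)
      moreover have "0 < j - i" "j - i < M" using ij m by auto
      ultimately show False using least by blast
    qed
  qed
  obtain d where d: "d \<in> carrier D" "x \<otimes> d \<noteq> d \<otimes> x" using centerI[OF x(1)] x(3) by blast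
  \<comment> \<open>A difference instead of \<open>d\<close> itself: the sum of its conjugates
    telescopes to zero. This kills the Fourier coefficients with eigenvalue \<open>1\<close>, so a
    nonzero one belongs to \<open>x^i \<noteq> 1\<close>.\<close>
  define e where "e = conjugate x d \<ominus> d"
  have e: "e \<in> carrier D" "e \<noteq> \<zero>"
    using d x conj_eq_iff[OF x(1,2) d(1) d(1)] by (auto simp: e_def)
  define S where "S j a = (conjugate x ^^ j) a" for j a
  note ac = additive_map_conj[OF x(1,2)]
  have Sc: "S j a \<in> carrier D" if "a \<in> carrier D" for j a
    using additive_closed[OF additive_iterate[OF ac]] that by (simp add: S_def)
  have SM: "S M a = a" if "a \<in> carrier D" for a
    using that conj_iterate[OF x(1,2) that, of M] M(2) by (simp add: S_def conjugate_def)
  have sum0: "(\<Oplus>j\<in>{..m}. S j e) = \<zero>"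
  proof -
    have "(\<Oplus>j\<in>{..m}. S j e) \<oplus> (\<Oplus>j\<in>{..m}. S j d) = (\<Oplus>j\<in>{..m}. S j e \<oplus> S j d)"
      using Sc d e by (intro finsum_addf[symmetric]) auto
    also have "\<dots> = (\<Oplus>j\<in>{..m}. S (Suc j) d)"
    proof (intro finsum_cong')
      fix j
      have "e \<oplus> d = conjugate x d" using d x unfolding e_def by (simp add: a_minus_def a_assoc l_neg)
      then have "S j e \<oplus> S j d = (conjugate x ^^ j) (conjugate x d)"
        using additive_add[OF additive_iterate[OF ac] e(1) d(1), of j] by (simp add: S_def)
      then show "S j e \<oplus> S j d = S (Suc j) d" by (simp add: S_def funpow_swap1)
    qed (use Sc d in auto)
    also have "\<dots> = (\<Oplus>j\<in>{..m}. S j d)"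
      using SM[OF d(1)] Sc[OF d(1)] by (intro finsum_cyclic_shift) (auto simp: m S_def)
    finally show ?thesis using Sc d e finsum_closed[of "\<lambda>j. S j d" "{..m}"] finsum_closed[of "\<lambda>j. S j e" "{..m}"]
      by (simp add: Pi_iff)
  qed
  define E where "E i = (\<Oplus>j\<in>{..m}. (w [^] j) [^] i \<otimes> S j e)" for i :: nat
  have "\<exists>i. E i \<noteq> \<zero>"
  proof (rule ccontr)
    assume n: "\<not> (\<exists>i. E i \<noteq> \<zero>)"
    have "S 0 e = \<zero>"
      by (rule vandermonde_trivial[where I = "{..m}" and x = "\<lambda>j. w [^] j" and c = "\<lambda>j. S j e"])
        (use inj w Sc e n E_def in \<open>auto simp: nat_pow_mult add.commute\<close>)
    then show False using e by (simp add: S_def)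
  qed
  then obtain i where i: "E i \<noteq> \<zero>" by blast
  define y where "y = E i"
  have y: "y \<in> carrier D" "y \<noteq> \<zero>" using i w Sc e unfolding y_def E_def by (auto intro!: finsum_closed)
  have xw: "conjugate x (w [^] k) = w [^] k" for k :: nat
    using conj_eq_iff[OF x(1,2), of "w [^] k" "w [^] k"] w x wx group_commutes_pow[of w x k] by simp
  have eigen: "conjugate x y = x [^] i \<otimes> y"
  proof -
    have "conjugate x y = (\<Oplus>j\<in>{..m}. conjugate x ((w [^] j) [^] i \<otimes> S j e))"
      unfolding y_def E_def using w Sc e by (intro additive_finsum[OF ac]) auto
    also have "\<dots> = (\<Oplus>j\<in>{..m}. x [^] i \<otimes> ((w [^] Suc j) [^] i \<otimes> S (Suc j) e))"
    proof (intro finsum_cong')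
      fix j
      have 1: "conjugate x ((w [^] j) [^] i \<otimes> S j e) = (w [^] j) [^] i \<otimes> S (Suc j) e"
        using w Sc[OF e(1)] xw x by (simp add: conj_mult nat_pow_pow S_def)
      have "(w [^] Suc j) [^] i = w [^] i \<otimes> (w [^] j) [^] i"
        using w by (simp only: nat_pow_pow nat_pow_mult) (simp add: algebra_simps)
      then have 2: "(w [^] j) [^] i = x [^] i \<otimes> (w [^] Suc j) [^] i"
        using wj[of i] w x by (simp add: m_assoc[symmetric] del: nat_pow_Suc)
      show "conjugate x ((w [^] j) [^] i \<otimes> S j e) = x [^] i \<otimes> ((w [^] Suc j) [^] i \<otimes> S (Suc j) e)"
        unfolding 1 unfolding 2 using x w Sc[OF e(1)] by (simp add: m_assoc del: nat_pow_Suc)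
    qed (use x w Sc e in \<open>auto simp del: nat_pow_Suc\<close>)
    also have "\<dots> = x [^] i \<otimes> (\<Oplus>j\<in>{..m}. (w [^] Suc j) [^] i \<otimes> S (Suc j) e)"
      using x w Sc e by (intro finsum_rdistr[symmetric]) (auto simp del: nat_pow_Suc)
    also have "(\<Oplus>j\<in>{..m}. (w [^] Suc j) [^] i \<otimes> S (Suc j) e) = y" unfolding y_def E_def
    proof (rule finsum_cyclic_shift)
      have "w [^] Suc m = \<one>" using wj[of M] M(2) w by (simp add: m)
      then show "(w [^] Suc m) [^] i \<otimes> S (Suc m) e = (w [^] (0::nat)) [^] i \<otimes> S 0 e"
        using SM[OF e(1)] by (simp add: m S_def del: nat_pow_Suc)
    qed (use w Sc e in auto)
    finally show ?thesis .
  qed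
  have xi: "x [^] i \<noteq> \<one>"
  proof
    assume a: "x [^] i = \<one>"
    have "(w [^] j) [^] i = \<one>" for j :: nat
    proof -
      have "w [^] i = \<one>" using wj[of i] a w by simp
      moreover have "(w [^] j) [^] i = (w [^] i) [^] j" using w by (simp only: nat_pow_pow mult.commute)
      ultimately show ?thesis by simp
    qed
    then have "y = (\<Oplus>j\<in>{..m}. S j e)" unfolding y_def E_def using Sc e by (intro finsum_cong') auto
    then show False using sum0 y by simp
  qed
  \<comment> \<open>The eigenvector equation \<open>x y = x^i y x\<close>, read from the side of
    \<open>y\<close>, says that \<open>y\<close> conjugates \<open>x\<close> to
    \<open>x^(1-i)\<close>.\<close>
  have "x \<otimes> y = x [^] i \<otimes> y \<otimes> x" using eigen conj_eq_iff[OF x(1,2) y(1), of "x [^] i \<otimes> y"] x y by simp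
  then have "w [^] i \<otimes> (x \<otimes> y) = (w [^] i \<otimes> x [^] i) \<otimes> (y \<otimes> x)"
    using w x y by (simp add: m_assoc)
  moreover have "w [^] i \<otimes> x [^] i = \<one>" using pow_mult_commute[OF w(1) x(1), of i] wx by simp
  ultimately have "w [^] i \<otimes> (x \<otimes> y) = y \<otimes> x" using x y by simp
  then have yx: "y \<otimes> x = w [^] i \<otimes> x \<otimes> y" using x w y by (simp add: m_assoc)
  then have c: "conjugate y x = w [^] i \<otimes> x" using conj_eq_iff[OF y x(1), of "w [^] i \<otimes> x"] x w by simp
  also have "\<dots> = x [^] (m * i + 1)" using x by (simp add: w_def nat_pow_pow nat_pow_mult)
  finally have 1: "conjugate y x = x [^] (m * i + 1)" .
  have "conjugate y x \<noteq> x"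
  proof
    assume "conjugate y x = x"
    then have "w [^] i = \<one>" using c mult_cancel_right[OF x(1,2), of "w [^] i" \<one>] x w by simp
    then show False using wj[of i] xi x by simp
  qed
  then show ?thesis using 1 y by blast
qed

end

section \<open>Finite commutative subrings generated by torsion elements\<close>

context skew_field
begin

lemma skew_field_subring:
  assumes K: "subring K D" "\<And>k. k \<in> K \<Longrightarrow> k \<noteq> \<zero> \<Longrightarrow> inv k \<in> K"
  shows "skew_field (D\<lparr>carrier := K\<rparr>)"
proof -
  interpret K: ring "D\<lparr>carrier := K\<rparr>" using subring_is_ring[OF K(1)] .
  note Kp = subringE[OF K(1)]
  have "Units (D\<lparr>carrier := K\<rparr>) = K - {\<zero>}"
  proof (intro equalityI subsetI)
    fix k assume "k \<in> Units (D\<lparr>carrier := K\<rparr>)"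
    then obtain l where l: "k \<in> K" "l \<in> K" "l \<otimes> k = \<one>" by (auto simp: Units_def)
    then have "k \<noteq> \<zero>" using Kp(1) one_not_zero by (metis r_null subsetD)
    then show "k \<in> K - {\<zero>}" using l by simp
  next
    fix k assume "k \<in> K - {\<zero>}"
    then have "k \<in> K" "inv k \<in> K" "k \<otimes> inv k = \<one>" "inv k \<otimes> k = \<one>"
      using K(2) Kp(1) nonzero_inv[of k] by auto
    then show "k \<in> Units (D\<lparr>carrier := K\<rparr>)" by (auto simp: Units_def)
  qed
  then show ?thesis using one_not_zero by unfold_locales auto
qed

lemma inv_pow: "b \<in> carrier D \<Longrightarrow> b \<noteq> \<zero> \<Longrightarrow> inv (b [^] (i::nat)) = inv b [^] i"
  using nonzero_inv[of b] pow_mult_commute[of b "inv b" i] by (intro inv_eqI) auto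

text \<open>In the common centralizer of \<open>x\<close> and \<open>z\<close>, a division ring,
  both are central, so the result on finite central subrings applies there. Minimality of
  \<open>E\<close> is recorded so that stability under conjugation need only be checked on
  \<open>x\<close> and \<open>z\<close>.\<close>

lemma finite_commuting_subring:
  assumes p: "Factorial_Ring.prime p" "nmult p \<one> = \<zero>"
    and x: "x \<in> carrier D" "(i::nat) > 0" "x [^] i = \<one>" and z: "z \<in> carrier D" "(j::nat) > 0" "z [^] j = \<one>"
    and comm: "x \<otimes> z = z \<otimes> x"
  shows "\<exists>E. subring E D \<and> finite E \<and> x \<in> E \<and> z \<in> E \<and> (\<forall>a\<in>E. \<forall>b\<in>E. a \<otimes> b = b \<otimes> a) \<and>
    (\<forall>R. subring R D \<longrightarrow> x \<in> R \<longrightarrow> z \<in> R \<longrightarrow> E \<subseteq> R)"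
proof -
  define C where "C = {d \<in> carrier D. x \<otimes> d = d \<otimes> x \<and> z \<otimes> d = d \<otimes> z}"
  have mult_comm: "c \<otimes> (a \<otimes> b) = a \<otimes> b \<otimes> c"
    if "c \<in> carrier D" "a \<in> carrier D" "b \<in> carrier D" "c \<otimes> a = a \<otimes> c" "c \<otimes> b = b \<otimes> c" for a b c
  proof -
    have "c \<otimes> (a \<otimes> b) = a \<otimes> (c \<otimes> b)" using that(1-4) by (simp flip: m_assoc)
    then show ?thesis using that by (simp add: m_assoc)
  qed
  have C: "subring C D"
    by (rule subringI) (use x z in \<open>auto simp: C_def mult_comm l_minus r_minus l_distr r_distr\<close>)
  have "skew_field (D\<lparr>carrier := C\<rparr>)"
    using x z nonzero_inv inv_commute by (intro skew_field_subring[OF C]) (auto simp: C_def)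
  then interpret C: skew_field "D\<lparr>carrier := C\<rparr>" .
  have K: "{x, z} \<subseteq> ring_center (D\<lparr>carrier := C\<rparr>)" using x z comm by (auto simp: ring_center_def C_def)
  have pow: "a [^]\<^bsub>D\<lparr>carrier := C\<rparr>\<^esub> (n::nat) = a [^] n" for a n by (simp add: nat_pow_def)
  have mult: "add_pow (D\<lparr>carrier := C\<rparr>) (n::nat) a = nmult n a" for a n by (simp add: add_pow_def nat_pow_def)
  obtain R where R: "subring R (D\<lparr>carrier := C\<rparr>)" "R \<subseteq> ring_center (D\<lparr>carrier := C\<rparr>)" "finite R" "{x, z} \<subseteq> R"
    using C.finite_central_subring[OF p(1) _ _ K] p(2) x z by (auto simp: pow mult)
  have RC: "R \<subseteq> C" using subringE(1)[OF R(1)] by simp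
  have RD: "subring R D"
    using R(1) RC subringE(1)[OF C] subring_iff[of R] ring.subring_iff[OF subring_is_ring[OF C], of R] by auto
  define E where "E = \<Inter>{R. subring R D \<and> x \<in> R \<and> z \<in> R}"
  have "E \<subseteq> R" using RD R(4) by (auto simp: E_def)
  moreover have "subring E D" unfolding E_def using RD R(4) by (intro subring_Inter) auto
  moreover have "a \<otimes> b = b \<otimes> a" if "a \<in> R" "b \<in> R" for a b
    using that R(2) RC by (auto simp: ring_center_def)
  moreover have "x \<in> E" "z \<in> E" "\<And>R. subring R D \<Longrightarrow> x \<in> R \<Longrightarrow> z \<in> R \<Longrightarrow> E \<subseteq> R"
    by (auto simp: E_def)
  ultimately show ?thesis using finite_subset[OF _ R(3)] by (metis subsetD)
qed

lemma finsum_subring: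
  assumes "subring E D" "\<And>i. T i \<in> E"
  shows "(\<Oplus>i\<in>{..n::nat}. T i) \<in> E"
proof (induction n)
  have c: "T i \<in> carrier D" for i using assms subringE(1) by blast
  case 0 then show ?case using c assms(2) by simp
  case (Suc n) then show ?case using c assms(2) subringE(7)[OF assms(1)] by (simp add: finsum_Suc)
qed

end

text \<open>\<open>E\<close> is a finite field on which \<open>y\<close> acts by conjugation, with \<open>t = n + 1\<close> the least exponent for which
  \<open>y\<^sup>t\<close> fixes \<open>x\<close>. Elements \<open>u y\<close> and \<open>v y\<close> (\<open>u, v \<in> E\<^sup>*\<close>) with the same \<open>t\<close>-th power are conjugate under
  \<open>E\<^sup>*\<close> (Hilbert 90), so by counting some \<open>u y\<close> has \<open>t\<close>-th power \<open>1\<close>, which contradicts the linear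
  independence of its powers over \<open>E\<close>.\<close>

locale cyclic_pair = skew_field D for D (structure) +
  fixes E x y and n :: nat
  assumes E: "subring E D" "finite E" "\<And>a b. a \<in> E \<Longrightarrow> b \<in> E \<Longrightarrow> a \<otimes> b = b \<otimes> a"
    and E_inv: "\<And>a. a \<in> E \<Longrightarrow> a \<noteq> \<zero> \<Longrightarrow> inv a \<in> E"
    and x: "x \<in> E" and y: "y \<in> carrier D" "y \<noteq> \<zero>" and yE: "\<And>a. a \<in> E \<Longrightarrow> conjugate y a \<in> E"
    and yx: "conjugate y x \<noteq> x" and yt: "y [^] Suc n \<in> E"
    and least: "\<And>i. 0 < i \<Longrightarrow> i \<le> n \<Longrightarrow> conjugate (y [^] i) x \<noteq> x"
begin

lemmas E_closed = subsetD[OF subringE(1)[OF E(1)]]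
lemmas E_props = subringE(2,3,5,6,7)[OF E(1)]
lemmas x_closed = E_closed[OF x]

lemma pow_y: "y [^] (i::nat) \<in> carrier D" "y [^] (i::nat) \<noteq> \<zero>"
  using y pow_nonzero by auto

lemma conj_y_pow: "a \<in> E \<Longrightarrow> conjugate (y [^] (i::nat)) a \<in> E"
proof -
  assume a: "a \<in> E"
  have "(conjugate y ^^ i) a \<in> E" by (induction i) (use a yE in auto)
  then show ?thesis using conj_iterate[OF y E_closed[OF a]] by simp
qed

context
  fixes u assumes u: "u \<in> E" "u \<noteq> \<zero>"
begin

lemma uy: "u \<otimes> y \<in> carrier D" "u \<otimes> y \<noteq> \<zero>"
  using u y E_closed mult_nonzero by auto

lemma conj_uy: "a \<in> E \<Longrightarrow> conjugate (u \<otimes> y) a = conjugate y a"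
proof -
  assume a: "a \<in> E"
  have c: "u \<in> carrier D" "a \<in> carrier D" "conjugate y a \<in> carrier D" "conjugate y a \<in> E" using u a y yE E_closed by auto
  have "conjugate (u \<otimes> y) a = conjugate u (conjugate y a)"
    using c u y nonzero_inv[OF y] nonzero_inv[OF c(1) u(2)] by (simp add: conjugate_def inv_mult_distrib m_assoc)
  also have "\<dots> = conjugate y a" using conj_eq_iff[OF c(1) u(2) c(3,3)] E(3)[OF u(1) c(4)] by simp
  finally show ?thesis .
qed

lemma conj_uy_pow: "a \<in> E \<Longrightarrow> conjugate ((u \<otimes> y) [^] (i::nat)) a = conjugate (y [^] i) a"
proof -
  assume a: "a \<in> E"
  have "(conjugate (u \<otimes> y) ^^ i) a = (conjugate y ^^ i) a \<and> (conjugate y ^^ i) a \<in> E"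
    by (induction i) (use a yE conj_uy in auto)
  then show ?thesis using conj_iterate[OF y E_closed[OF a]] conj_iterate[OF uy E_closed[OF a]] by simp
qed

text \<open>With \<open>\<sigma>\<close> conjugation by \<open>y\<close>, this ratio is the partial
  norm \<open>u \<sigma>(u) ...\<close> with \<open>i\<close> factors.\<close>

lemma uy_pow_ratio: "(u \<otimes> y) [^] (i::nat) \<otimes> inv (y [^] i) \<in> E"
proof (induction i)
  case 0 then show ?case using E_props by simp
next
  case (Suc i)
  have c: "u \<in> carrier D" "(u \<otimes> y) [^] i \<in> carrier D" using u uy E_closed by auto
  note i = nonzero_inv[OF pow_y, of i] nonzero_inv[OF y]
  have "(u \<otimes> y) [^] Suc i \<otimes> inv (y [^] Suc i) = (u \<otimes> y) [^] i \<otimes> u \<otimes> inv (y [^] i)"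
    using c i y pow_y[of i] by (simp add: inv_mult_distrib m_assoc cancel_left_inv)
  also have "\<dots> = ((u \<otimes> y) [^] i \<otimes> inv (y [^] i)) \<otimes> conjugate (y [^] i) u"
    using c i pow_y[of i] by (simp add: conjugate_def m_assoc cancel_left_inv)
  finally show ?case using Suc conj_y_pow[OF u(1)] E_props by simp
qed

text \<open>\<open>u y\<close> commutes with its own powers and acts on \<open>E\<close> as
  \<open>y\<close> does; so the power, once it lies in \<open>E\<close>, is fixed by
  \<open>y\<close>.\<close>

lemma uy_power: "(u \<otimes> y) [^] Suc n \<in> E" "conjugate y ((u \<otimes> y) [^] Suc n) = (u \<otimes> y) [^] Suc n"
proof -
  let ?a = "(u \<otimes> y) [^] Suc n"
  have c: "?a \<in> carrier D" using uy by simp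
  have "?a = (?a \<otimes> inv (y [^] Suc n)) \<otimes> y [^] Suc n"
    using c nonzero_inv[OF pow_y, of "Suc n"] pow_y(1)[of "Suc n"] by (simp add: m_assoc del: nat_pow_Suc)
  then show a: "?a \<in> E" using uy_pow_ratio[of "Suc n"] yt E_props by metis
  have "conjugate (u \<otimes> y) ?a = ?a"
    using conj_eq_iff[OF uy c c] uy by (simp add: nat_pow_Suc2[symmetric] del: nat_pow_Suc)
      (metis nat_pow_Suc nat_pow_Suc2 uy(1))
  then show "conjugate y ?a = ?a" using conj_uy[OF a] by simp
qed

end

text \<open>Dedekind independence of the automorphisms induced by \<open>y^i\<close>, tested on
  powers of \<open>x\<close> only: by leastness of the exponent the conjugates of \<open>x\<close>
  are distinct, and they commute, so they serve as Vandermonde nodes.\<close>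

lemma powers_x_trivial:
  assumes c: "\<And>i. c i \<in> carrier D" and z: "\<And>j::nat. (\<Oplus>i\<in>{..n}. conjugate (y [^] i) x [^] j \<otimes> c i) = \<zero>"
  shows "c 0 = \<zero>"
proof (rule vandermonde_trivial[where I = "{..n}" and x = "\<lambda>i. conjugate (y [^] i) x" and c = c])
  show "inj_on (\<lambda>i. conjugate (y [^] i) x) {..n}"
  proof (rule linorder_inj_onI')
    fix i j assume ij: "i \<in> {..n}" "j \<in> {..n}" "i < j"
    show "conjugate (y [^] i) x \<noteq> conjugate (y [^] j) x"
    proof
      assume eq: "conjugate (y [^] i) x = conjugate (y [^] j) x"
      have "j = i + (j - i)" using ij by simp
      then have "conjugate (y [^] j) x = conjugate (y [^] i) (conjugate (y [^] (j - i)) x)"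
        using conj_iterate[OF y x_closed] conj_iterate[OF y, of "conjugate (y [^] (j - i)) x" i]
          conj_closed[OF pow_y x_closed] by (metis comp_apply funpow_add)
      then have "x = conjugate (y [^] (j - i)) x"
        using eq conj_inj[OF pow_y x_closed conj_closed[OF pow_y x_closed]] by metis
      moreover have "0 < j - i" "j - i \<le> n" using ij by auto
      ultimately show False using least by metis
    qed
  qed
  show "conjugate (y [^] i) x \<otimes> conjugate (y [^] k) x = conjugate (y [^] k) x \<otimes> conjugate (y [^] i) x" for i k :: nat
    using E(3)[OF conj_y_pow[OF x, of i] conj_y_pow[OF x, of k]] .
  show "conjugate (y [^] i) x \<in> carrier D" for i :: nat by (rule conj_closed[OF pow_y x_closed])
  show "(\<Oplus>i\<in>{..n}. conjugate (y [^] i) x [^] j \<otimes> c i) = \<zero>" for j :: nat by (rule z)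
qed (simp_all add: c)

text \<open>With \<open>a = u y\<close> and \<open>b = v y\<close>, the resolvent \<open>w\<close>,
  the sum of \<open>a^i e b^(-i)\<close>, satisfies \<open>a w = w b\<close>: the shift is cyclic
  since \<open>a\<close> and \<open>b\<close> have the same power in the commutative
  \<open>E\<close>. Independence gives an \<open>e\<close> with \<open>w\<close> nonzero, and
  cancelling \<open>y\<close> yields the claim.\<close>

lemma hilbert_90:
  assumes u: "u \<in> E" "u \<noteq> \<zero>" and v: "v \<in> E" "v \<noteq> \<zero>" and eq: "(u \<otimes> y) [^] Suc n = (v \<otimes> y) [^] Suc n"
  shows "\<exists>w\<in>E. w \<noteq> \<zero> \<and> v = u \<otimes> (conjugate y w \<otimes> inv w)"
proof -
  let ?a = "u \<otimes> y" and ?b = "v \<otimes> y"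
  note a = uy[OF u] and b = uy[OF v]
  define b' where "b' = inv ?b"
  have b': "b' \<in> carrier D" "b' \<noteq> \<zero>" "b' \<otimes> ?b = \<one>" using nonzero_inv[OF b] by (auto simp: b'_def)
  define T where "T e i = ?a [^] i \<otimes> e \<otimes> b' [^] i" for e and i :: nat
  have TE: "T e i \<in> E" if e: "e \<in> E" for e i
  proof -
    have bi: "?b [^] i \<in> carrier D" "?b [^] i \<noteq> \<zero>" "?a [^] i \<in> carrier D" using b a pow_nonzero by auto
    note ii = nonzero_inv[OF bi(1,2)] nonzero_inv[OF pow_y, of i]
    have ec: "e \<in> carrier D" using e E_closed by auto
    have "inv (?b [^] i \<otimes> inv (y [^] i)) = y [^] i \<otimes> inv (?b [^] i)"
      using bi pow_y[of i] ii by (intro inv_eqI) (simp_all add: m_assoc cancel_left_inv)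
    moreover have "?b [^] i \<otimes> inv (y [^] i) \<noteq> \<zero>" using bi ii mult_nonzero by auto
    ultimately have 1: "y [^] i \<otimes> inv (?b [^] i) \<in> E" using E_inv uy_pow_ratio[OF v] by metis
    \<comment> \<open>Inserting \<open>y^(-i) y^i\<close> twice splits the term into factors that
      all lie in \<open>E\<close>.\<close>
    have "T e i = (?a [^] i \<otimes> inv (y [^] i)) \<otimes> conjugate (y [^] i) e \<otimes> (y [^] i \<otimes> inv (?b [^] i))"
      unfolding T_def b'_def inv_pow[OF b, symmetric]
      using bi ii ec pow_y[of i] by (simp add: conjugate_def m_assoc cancel_left_inv)
    then show ?thesis using 1 uy_pow_ratio[OF u] conj_y_pow[OF e] E_props by simp
  qed
  have "\<exists>e\<in>E. (\<Oplus>i\<in>{..n}. T e i) \<noteq> \<zero>"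
  proof (rule ccontr)
    assume none: "\<not> ?thesis"
    have xp: "x [^] j \<in> E" for j :: nat by (induction j) (use x E_props in auto)
    have "?a [^] (0::nat) \<otimes> b' [^] (0::nat) = \<zero>"
    proof (rule powers_x_trivial)
      fix j :: nat
      have "conjugate (y [^] i) x [^] j \<otimes> (?a [^] i \<otimes> b' [^] i) = T (x [^] j) i" for i :: nat
      proof -
        have ai: "?a [^] i \<in> carrier D" "?a [^] i \<noteq> \<zero>" using a pow_nonzero by auto
        have "conjugate (y [^] i) x [^] j = conjugate (?a [^] i) (x [^] j)"
          using conj_uy_pow[OF u xp] conj_pow[OF pow_y x_closed] by simp
        then show ?thesis unfolding T_def conjugate_def
          using ai nonzero_inv[OF ai] x_closed b' by (simp add: m_assoc cancel_left_inv)
      qed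
      then show "(\<Oplus>i\<in>{..n}. conjugate (y [^] i) x [^] j \<otimes> (?a [^] i \<otimes> b' [^] i)) = \<zero>"
        using none xp by simp
    qed (use a b' in auto)
    then show False using one_not_zero by simp
  qed
  then obtain e where e: "e \<in> E" "(\<Oplus>i\<in>{..n}. T e i) \<noteq> \<zero>" by blast
  define w where "w = (\<Oplus>i\<in>{..n}. T e i)"
  have w: "w \<in> E" "w \<noteq> \<zero>" "w \<in> carrier D"
    using e finsum_subring[OF E(1) TE[OF e(1)]] E_closed by (auto simp: w_def)
  have Tc: "T e i \<in> carrier D" for i using TE[OF e(1)] E_closed by blast
  have ec: "e \<in> carrier D" using e E_closed by auto
  have "?a \<otimes> w \<otimes> b' = (\<Oplus>i\<in>{..n}. ?a \<otimes> T e i) \<otimes> b'"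
    unfolding w_def using Tc a by (subst finsum_rdistr) auto
  also have "\<dots> = (\<Oplus>i\<in>{..n}. ?a \<otimes> T e i \<otimes> b')" using Tc a b' by (subst finsum_ldistr) auto
  also have "\<dots> = (\<Oplus>i\<in>{..n}. T e (Suc i))"
  proof (rule finsum_cong')
    fix i
    show "?a \<otimes> T e i \<otimes> b' = T e (Suc i)"
      unfolding T_def nat_pow_Suc2[OF a(1)] using a b' ec by (simp add: m_assoc)
  qed (use Tc in auto)
  also have "\<dots> = w" unfolding w_def
  proof (rule finsum_cyclic_shift[OF Tc])
    let ?c = "?a [^] Suc n"
    have c: "?c \<in> E" "?c \<in> carrier D" "?c \<noteq> \<zero>" using uy_power(1)[OF u] nat_pow_closed[OF a(1), of "Suc n"] pow_nonzero[OF a, of "Suc n"] by blast+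
    have "b' [^] Suc n = inv ?c" unfolding b'_def eq inv_pow[OF b] ..
    moreover have "?c \<otimes> e = e \<otimes> ?c" by (rule E(3)[OF c(1) e(1)])
    ultimately have "T e (Suc n) = e" unfolding T_def using c ec nonzero_inv[OF c(2,3)] by (simp add: m_assoc del: nat_pow_Suc)
    then show "T e (Suc n) = T e 0" using ec by (simp add: T_def)
  qed
  finally have "?a \<otimes> w \<otimes> b' = w" .
  then have "?a \<otimes> w \<otimes> b' \<otimes> ?b = w \<otimes> ?b" by simp
  then have aw: "?a \<otimes> w = w \<otimes> ?b" using a b b' w by (simp add: m_assoc del: m_closed) (metis m_assoc m_closed r_one)
  have cw: "conjugate y w \<in> carrier D" "conjugate y w \<in> E" using w y yE by auto
  have uv: "u \<in> carrier D" "v \<in> carrier D" using u v E_closed by auto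
  have "conjugate y w \<otimes> y = y \<otimes> w" using conj_eq_iff[OF y w(3) cw(1)] by simp
  then have "u \<otimes> conjugate y w \<otimes> y = w \<otimes> v \<otimes> y" using aw uv y w cw by (simp add: m_assoc)
  then have "u \<otimes> conjugate y w = w \<otimes> v" using mult_cancel_right[OF y] uv w cw by simp
  then have "u \<otimes> conjugate y w \<otimes> inv w = v \<otimes> w \<otimes> inv w" using E(3)[OF w(1) v(1)] by simp
  then have "v = u \<otimes> (conjugate y w \<otimes> inv w)" using uv w cw nonzero_inv[OF w(3,2)] by (simp add: m_assoc)
  then show ?thesis using w by blast
qed

text \<open>\<open>f\<close> is the norm times \<open>y^t\<close> and takes values in the fixed
  elements \<open>k\<close>. By Hilbert 90 each nonempty fibre of \<open>f\<close> has at most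
  \<open>card (g\<close>
  S)\<open>elements, while each nonempty fibre of\<close>g\<open>contains a coset of\<close>k\<open>. Comparing both with\<close>card
  S\<open>gives\<close>card k \<le> card (f \<open>S)\<close>, so \<open>f\<close> reaches all of
  \<open>k\<close>, in particular \<open>1\<close>.\<close>

lemma norm_one_exists: "\<exists>u\<in>E. u \<noteq> \<zero> \<and> (u \<otimes> y) [^] Suc n = \<one>"
proof -
  define S where "S = E - {\<zero>}"
  define k where "k = {a \<in> S. conjugate y a = a}"
  define f where "f u = (u \<otimes> y) [^] Suc n" for u
  define g where "g w = conjugate y w \<otimes> inv w" for w
  have Sf: "finite S" and oS: "\<one> \<in> S" using E E_props one_not_zero by (auto simp: S_def)
  have SD: "a \<in> carrier D" "a \<noteq> \<zero>" "a \<in> E" if "a \<in> S" for a using that E_closed by (auto simp: S_def)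
  have fk: "f ` S \<subseteq> k"
  proof
    fix b assume "b \<in> f ` S"
    then obtain u where u: "u \<in> S" "b = f u" by auto
    note uE = SD(3,2)[OF u(1)]
    show "b \<in> k" using uy_power[OF uE] pow_nonzero[OF uy[OF uE], of "Suc n"]
      unfolding k_def S_def u(2) f_def by blast
  qed
  have "card S = (\<Sum>b\<in>f ` S. card {a \<in> S. f a = b})"
    using sum.image_gen[OF Sf, of "\<lambda>_. 1::nat" f] by simp
  also have "\<dots> \<le> (\<Sum>b\<in>f ` S. card (g ` S))"
  proof (rule sum_mono)
    fix b assume "b \<in> f ` S"
    then obtain u where u: "u \<in> S" "b = f u" by auto
    have "{a \<in> S. f a = b} \<subseteq> (\<lambda>c. u \<otimes> c) ` (g ` S)"
    proof
      fix a assume "a \<in> {a \<in> S. f a = b}"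
      then have a: "a \<in> S" "f u = f a" using u by auto
      obtain w where "w \<in> E" "w \<noteq> \<zero>" "a = u \<otimes> g w"
        using hilbert_90[OF SD(3,2)[OF u(1)] SD(3,2)[OF a(1)]] a(2) unfolding f_def g_def by blast
      then show "a \<in> (\<lambda>c. u \<otimes> c) ` (g ` S)" by (simp add: S_def)
    qed
    then show "card {a \<in> S. f a = b} \<le> card (g ` S)"
      using Sf by (meson card_image_le card_mono finite_imageI order_trans)
  qed
  finally have 1: "card S \<le> card (f ` S) * card (g ` S)" by simp
  have "card (g ` S) * card k = (\<Sum>b\<in>g ` S. card k)" by simp
  also have "\<dots> \<le> (\<Sum>b\<in>g ` S. card {a \<in> S. g a = b})"
  proof (rule sum_mono)
    fix b assume "b \<in> g ` S"
    then obtain w where w: "w \<in> S" "b = g w" by auto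
    note wi = nonzero_inv[OF SD(1,2)[OF w(1)]]
    have "(\<lambda>c. w \<otimes> c) ` k \<subseteq> {a \<in> S. g a = b}"
    proof
      fix a assume "a \<in> (\<lambda>c. w \<otimes> c) ` k"
      then obtain c where c: "c \<in> S" "conjugate y c = c" "a = w \<otimes> c" by (auto simp: k_def)
      have wc: "w \<in> carrier D" "c \<in> carrier D" "w \<noteq> \<zero>" "c \<noteq> \<zero>" using w c SD by auto
      note ci = nonzero_inv[OF wc(2,4)]
      have "a \<in> S" unfolding S_def c(3)
        using E_props(4)[OF SD(3)[OF w(1)] SD(3)[OF c(1)]] mult_nonzero[OF wc] by simp
      moreover have "g a = g w"
        unfolding g_def c(3) using wc ci wi y c(2)
        by (simp add: conj_mult inv_mult_distrib m_assoc cancel_left_inv)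
      ultimately show "a \<in> {a \<in> S. g a = b}" using w by simp
    qed
    moreover have "inj_on (\<lambda>c. w \<otimes> c) k"
    proof (rule inj_onI)
      fix c d assume cd: "c \<in> k" "d \<in> k" "w \<otimes> c = w \<otimes> d"
      then have "c \<in> carrier D" "d \<in> carrier D" using SD(1) by (auto simp: k_def)
      then show "c = d" using mult_cancel_left[OF SD(1,2)[OF w(1)]] cd(3) by simp
    qed
    moreover have "finite {a \<in> S. g a = b}" using Sf by simp
    ultimately show "card k \<le> card {a \<in> S. g a = b}" by (metis card_image card_mono)
  qed
  also have "\<dots> = card S"
    using sum.image_gen[OF Sf, of "\<lambda>_. 1::nat" g] by simp
  finally have "card (g ` S) * card k \<le> card (g ` S) * card (f ` S)"
    using 1 by (metis le_trans mult.commute)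
  moreover have "card (g ` S) > 0" using Sf oS by (auto simp: card_gt_0_iff)
  ultimately have "card k \<le> card (f ` S)" by simp
  moreover have "finite k" using Sf by (simp add: k_def)
  ultimately have "f ` S = k" using fk by (simp add: card_seteq)
  moreover have "\<one> \<in> k" using oS y nonzero_inv[OF y] by (simp add: k_def conjugate_def)
  ultimately obtain u where "u \<in> S" "f u = \<one>" by (metis imageE)
  then show ?thesis using SD unfolding f_def by blast
qed

text \<open>\<open>v\<close> moves \<open>x\<close>, so \<open>v \<noteq> 1\<close>, while
  \<open>v S = S\<close> for the sum \<open>S\<close> of its powers; hence \<open>S = 0\<close>.
  Moving \<open>x^j\<close> through \<open>S x^j = 0\<close> gives relations that force the
  coefficient \<open>v^0 = 1\<close> to vanish.\<close>

lemma cyclic_pair_impossible: False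
proof -
  obtain u where u: "u \<in> E" "u \<noteq> \<zero>" "(u \<otimes> y) [^] Suc n = \<one>" using norm_one_exists by blast
  define v where "v = u \<otimes> y"
  have v: "v \<in> carrier D" "v \<noteq> \<zero>" "v [^] Suc n = \<one>" using uy[OF u(1,2)] u(3) by (auto simp: v_def)
  define S where "S = (\<Oplus>i\<in>{..n}. v [^] i)"
  have S: "S \<in> carrier D" unfolding S_def using v by (auto intro!: finsum_closed)
  have "v \<otimes> S = (\<Oplus>i\<in>{..n}. v [^] Suc i)"
    unfolding S_def nat_pow_Suc2[OF v(1)] using v by (intro finsum_rdistr) auto
  also have "\<dots> = S" unfolding S_def using v by (intro finsum_cyclic_shift) (simp_all del: nat_pow_Suc)
  finally have vS: "v \<otimes> S = \<one> \<otimes> S" using S by simp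
  have "v \<noteq> \<one>"
  proof
    assume "v = \<one>"
    then have "conjugate y x = conjugate \<one> x" using conj_uy[OF u(1,2) x] by (simp add: v_def)
    then show False using yx x_closed by (simp add: conjugate_def)
  qed
  then have S0: "S = \<zero>" using mult_cancel_right[OF S _ v(1) one_closed] vS by blast
  have "v [^] (0::nat) = \<zero>"
  proof (rule powers_x_trivial)
    fix j :: nat
    have xp: "x [^] j \<in> E" by (induction j) (use x E_props in auto)
    have "conjugate (y [^] i) x [^] j \<otimes> v [^] i = v [^] i \<otimes> x [^] j" for i :: nat
    proof -
      have vi: "v [^] i \<in> carrier D" "v [^] i \<noteq> \<zero>" using v pow_nonzero by auto
      have "conjugate (y [^] i) x [^] j = conjugate (v [^] i) (x [^] j)"
        using conj_uy_pow[OF u(1,2) xp] conj_pow[OF pow_y x_closed] by (simp add: v_def)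
      then show ?thesis unfolding conjugate_def
        using vi nonzero_inv[OF vi] x_closed by (simp add: m_assoc)
    qed
    then have "(\<Oplus>i\<in>{..n}. conjugate (y [^] i) x [^] j \<otimes> v [^] i) = S \<otimes> x [^] j"
      unfolding S_def using v x_closed by (subst finsum_ldistr) auto
    then show "(\<Oplus>i\<in>{..n}. conjugate (y [^] i) x [^] j \<otimes> v [^] i) = \<zero>" using S0 x_closed by simp
  qed (use v in auto)
  then show False using one_not_zero by simp
qed

end

text \<open>\<open>y\<close> sends \<open>x\<close> to a power of \<open>x\<close> and fixes
  \<open>y^t\<close>, so the finite ring generated by these two is stable under conjugation by
  \<open>y\<close>. It is closed under inverses because inverses of torsion elements are
  powers.\<close>

lemma (in skew_field) torsion_imp_commutative:
  assumes p: "Factorial_Ring.prime p" "nmult p \<one> = \<zero>"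
    and tor: "\<And>d. d \<in> carrier D \<Longrightarrow> d \<noteq> \<zero> \<Longrightarrow> \<exists>n::nat. n > 0 \<and> d [^] n = \<one>"
  shows "carrier D \<subseteq> ring_center D"
proof (rule ccontr)
  assume "\<not> carrier D \<subseteq> ring_center D"
  then obtain x where x: "x \<in> carrier D" "x \<notin> ring_center D" by blast
  then have x0: "x \<noteq> \<zero>" using subringE(2)[OF subring_center] by auto
  obtain m :: nat where m: "m > 0" "x [^] m = \<one>" using tor[OF x(1) x0] by blast
  obtain y s where y: "y \<in> carrier D" "y \<noteq> \<zero>" "conjugate y x = x [^] (s::nat)" "conjugate y x \<noteq> x"
    using torsion_normalizing_element[OF x(1) x0 x(2) m] by blast
  define t where "t = (LEAST t::nat. t > 0 \<and> conjugate (y [^] t) x = x)"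
  obtain k :: nat where k: "k > 0" "y [^] k = \<one>" using tor[OF y(1,2)] by blast
  then have "k > 0 \<and> conjugate (y [^] k) x = x" using x by (simp add: conjugate_def)
  then have t: "t > 0" "conjugate (y [^] t) x = x" unfolding t_def by (metis (mono_tags, lifting) LeastI)+
  have least: "conjugate (y [^] i) x \<noteq> x" if "0 < i" "i < t" for i
    using that not_less_Least[of i "\<lambda>t. t > 0 \<and> conjugate (y [^] t) x = x"] unfolding t_def by auto
  obtain n where n: "t = Suc n" using t(1) by (cases t) auto
  define z where "z = y [^] t"
  have z: "z \<in> carrier D" "z \<noteq> \<zero>" using y pow_nonzero by (auto simp: z_def)
  obtain j :: nat where j: "j > 0" "z [^] j = \<one>" using tor[OF z] by blast
  have "x \<otimes> z = z \<otimes> x" using t(2) conj_eq_iff[OF z x(1,1)] by (simp add: z_def)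
  then obtain E where E: "subring E D" "finite E" "x \<in> E" "z \<in> E" "\<And>a b. a \<in> E \<Longrightarrow> b \<in> E \<Longrightarrow> a \<otimes> b = b \<otimes> a"
    "\<And>R. subring R D \<Longrightarrow> x \<in> R \<Longrightarrow> z \<in> R \<Longrightarrow> E \<subseteq> R"
    using finite_commuting_subring[OF p x(1) m z(1) j] by blast
  note Ep = subringE[OF E(1)]
  have E_pow: "a [^] i \<in> E" if "a \<in> E" for a and i :: nat by (induction i) (use that Ep in auto)
  have yE: "conjugate y a \<in> E" if "a \<in> E" for a
  proof -
    let ?R = "{a \<in> carrier D. conjugate y a \<in> E}"
    have y1: "conjugate y \<one> = \<one>" using y nonzero_inv[OF y(1,2)] by (simp add: conjugate_def)
    have "subring ?R D"
    proof (rule subringI)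
      fix h assume "h \<in> ?R"
      then show "\<ominus> h \<in> ?R" using Ep(5) additive_minus[OF additive_map_conj[OF y(1,2)]] by auto
    qed (use Ep y1 y conj_add conj_mult in auto)
    moreover have "x \<in> ?R" using x E_pow[OF E(3)] y(3) by simp
    moreover have "conjugate y z = z"
      using conj_eq_iff[OF y(1,2) z(1,1)] nat_pow_Suc2[OF y(1), of t] by (simp add: z_def)
    then have "z \<in> ?R" using z E(4) by simp
    ultimately show ?thesis using E(6) that by blast
  qed
  have inv: "inv a \<in> E" if a: "a \<in> E" "a \<noteq> \<zero>" for a
  proof -
    have ac: "a \<in> carrier D" using a Ep(1) by auto
    obtain i :: nat where i: "i > 0" "a [^] i = \<one>" using tor[OF ac a(2)] by blast
    then obtain l where "i = Suc l" by (cases i) auto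
    then have "a \<otimes> a [^] l = \<one>" using i nat_pow_Suc2[OF ac, of l] by simp
    then show ?thesis using inv_eqI[OF ac _] E_pow[OF a(1), of l] Ep(1) by auto
  qed
  have yt: "y [^] Suc n \<in> E" using E(4) by (simp only: z_def n)
  have least': "conjugate (y [^] i) x \<noteq> x" if "0 < i" "i \<le> n" for i using least that n by simp
  have "cyclic_pair D E x y n"
    by (intro cyclic_pair.intro cyclic_pair_axioms.intro)
      (fact skew_field_axioms E inv y yE yt least')+
  then show False by (rule cyclic_pair.cyclic_pair_impossible)
qed

section \<open>Subnormal subgroups radical over the center\<close>

lemma (in skew_field) radical_central_centrally_finite:
  assumes fin: "finite_dimension (ring_center D) (carrier D)"
    and N: "\<And>w. w \<in> N \<Longrightarrow> w \<in> carrier D" "\<And>w. w \<in> N \<Longrightarrow> w \<noteq> \<zero>"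
    and pow: "\<And>w n. w \<in> N \<Longrightarrow> w [^] (n::nat) \<in> N"
    and rad: "\<And>w. w \<in> N \<Longrightarrow> \<exists>n::nat. n > 0 \<and> w [^] n \<in> ring_center D"
    and comm: "\<And>x a. x \<in> N \<Longrightarrow> a \<in> carrier D \<Longrightarrow> a \<noteq> \<zero> \<Longrightarrow> iterated_commutator x a (Suc r) \<in> N"
  shows "N \<subseteq> ring_center D"
proof -
  have *: "N \<subseteq> ring_center D" if ex: "\<exists>V \<Lambda> \<delta>. valued_order D V \<Lambda> \<delta>"
  proof -
    obtain V \<Lambda> \<delta> where "valued_order D V \<Lambda> \<delta>" using ex by blast
    from valued_order.radical_central[OF this N pow rad comm] show ?thesis .
  qed
  show ?thesis
  proof (cases "\<exists>n>0. nmult n \<one> = \<zero>")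
    case False
    then show ?thesis using * valued_order_char_zero[OF fin] by blast
  next
    case True
    then obtain p where p: "Factorial_Ring.prime p" "nmult p \<one> = \<zero>" using characteristic_prime by blast
    show ?thesis
    proof (cases "\<exists>c\<in>ring_center D. c \<noteq> \<zero> \<and> (\<forall>n::nat. n > 0 \<longrightarrow> c [^] n \<noteq> \<one>)")
      case True
      then show ?thesis using * valued_order_char_p[OF fin p] by blast
    next
      case False
      then have "\<exists>n::nat. n > 0 \<and> d [^] n = \<one>" if "d \<in> carrier D" "d \<noteq> \<zero>" for d
        using torsion_of_central_torsion[OF fin p _ that] by blast
      then show ?thesis using torsion_imp_commutative[OF p] N(1) by blast
    qed
  qed
qed

section \<open>Subnormal series and generated division subrings\<close>

context skew_field
begin

lemma inv_units_of: "a \<in> carrier D \<Longrightarrow> a \<noteq> \<zero> \<Longrightarrow> inv\<^bsub>units_of D\<^esub> a = inv a"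
  using units_of_inv skew_field_Units by simp

text \<open>If the current term lies in \<open>H (i + 1)\<close>, it normalizes \<open>H i\<close>,
  which contains \<open>x\<close>; so its commutator with \<open>x\<close> lies in
  \<open>H i\<close>. Each commutator descends one level of the series.\<close>

lemma subnormal_iterated_commutator:
  assumes "subnormal_subgroup N (units_of D)"
  shows "\<exists>r. \<forall>x\<in>N. \<forall>a\<in>carrier D. a \<noteq> \<zero> \<longrightarrow> iterated_commutator x a (Suc r) \<in> N"
proof -
  interpret U: group "units_of D" by (rule units_group)
  obtain r H where H: "H 0 = N" "H r = carrier (units_of D)" "\<And>i. i \<le> (r::nat) \<Longrightarrow> subgroup (H i) (units_of D)"
    "\<And>i. i < r \<Longrightarrow> H i \<lhd> (units_of D)\<lparr>carrier := H (Suc i)\<rparr>"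
    using assms unfolding subnormal_subgroup_def by blast
  have Hnz: "a \<in> carrier D" "a \<noteq> \<zero>" if "a \<in> H i" "i \<le> r" for a i
    using subgroup.mem_carrier[OF H(3)[OF that(2)] that(1)] skew_field_Units by (auto simp: units_of_carrier)
  have Hinv: "inv a \<in> H i" if "a \<in> H i" "i \<le> r" for a i
    using subgroup.m_inv_closed[OF H(3)[OF that(2)] that(1)] inv_units_of[OF Hnz[OF that]] by simp
  have Hmult: "a \<otimes> b \<in> H i" if "a \<in> H i" "b \<in> H i" "i \<le> r" for a b i
    using subgroup.m_closed[OF H(3)[OF that(3)] that(1,2)] by (simp add: units_of_mult)
  have Hconj: "conjugate b a \<in> H i" if "a \<in> H i" "b \<in> H (Suc i)" "i < r" for a b i
  proof -
    have "subgroup (H (Suc i)) (units_of D)" using H(3) that by simp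
    then have "inv\<^bsub>(units_of D)\<lparr>carrier := H (Suc i)\<rparr>\<^esub> b = inv b"
      using U.m_inv_consistent[OF _ that(2)] inv_units_of[OF Hnz[OF that(2)]] that(3) by simp
    then show ?thesis
      using normal.inv_op_closed2[OF H(4)[OF that(3)], of b a] that by (simp add: conjugate_def units_of_mult)
  qed
  have Hsub: "H i \<subseteq> H (Suc i)" if "i < r" for i
    using subgroup.subset[OF normal_imp_subgroup[OF H(4)[OF that]]] by simp
  have NH: "N \<subseteq> H i" if "i \<le> r" for i
    using that
  proof (induction i)
    case (Suc i) then show ?case using Hsub[of i] by auto
  qed (simp add: H(1))
  have step: "iterated_commutator x a (Suc j) \<in> H i"
    if "x \<in> H i" "a \<in> carrier D" "a \<noteq> \<zero>" "conjugate (iterated_commutator x a j) x \<in> H i" "i \<le> r" for x a i j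
  proof -
    have x: "x \<in> carrier D" "x \<noteq> \<zero>" using Hnz that(1,5) by auto
    have "iterated_commutator x a (Suc j) = conjugate (iterated_commutator x a j) x \<otimes> inv x"
      unfolding iterated_commutator_Suc_mult[OF x that(2,3), of j, symmetric]
      using nonzero_inv[OF x] iterated_commutator_closed(1)[OF x that(2,3), of "Suc j"] x by (simp add: m_assoc)
    then show ?thesis using Hmult that Hinv by simp
  qed
  have "iterated_commutator x a (Suc r) \<in> N" if x: "x \<in> N" and a: "a \<in> carrier D" "a \<noteq> \<zero>" for x a
  proof -
    have "iterated_commutator x a j \<in> H (r - j)" if "j \<le> r" for j
      using that
    proof (induction j)
      case 0 then show ?case using a H(2) skew_field_Units by (simp add: units_of_carrier)
    next
      case (Suc j)
      then have "iterated_commutator x a j \<in> H (Suc (r - Suc j))" by (simp add: Suc_diff_Suc)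
      then have "conjugate (iterated_commutator x a j) x \<in> H (r - Suc j)"
        using Hconj NH[of "r - Suc j"] x Suc.prems by auto
      then show ?case using step[OF _ a] NH[of "r - Suc j"] x by auto
    qed
    from this[of r] have r: "iterated_commutator x a r \<in> H 0" by simp
    have xH: "x \<in> H 0" using x H(1) by simp
    \<comment> \<open>At the bottom no normality is used: \<open>N\<close> contains \<open>x\<close>
      and the last term, hence their commutator. This extra step makes the term in \<open>N\<close>
      a genuine commutator even if \<open>r = 0\<close>.\<close>
    have "conjugate (iterated_commutator x a r) x \<in> H 0"
      unfolding conjugate_def by (rule Hmult[OF Hmult[OF r xH le0] Hinv[OF r le0] le0])
    then show ?thesis using step[OF xH a _ le0] H(1) by blast
  qed
  then show ?thesis by blast
qed

lemma division_subring_inv: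
  assumes "division_subring K D" "k \<in> K" "k \<noteq> \<zero>"
  shows "inv k \<in> K" "inv\<^bsub>D\<lparr>carrier := K\<rparr>\<^esub> k = inv k"
proof -
  interpret K: skew_field "D\<lparr>carrier := K\<rparr>" using assms(1) by (simp add: division_subring_def)
  have sub: "K \<subseteq> carrier D" using assms(1) subringE(1) by (auto simp: division_subring_def)
  have "inv\<^bsub>D\<lparr>carrier := K\<rparr>\<^esub> k \<in> K" "k \<otimes> inv\<^bsub>D\<lparr>carrier := K\<rparr>\<^esub> k = \<one>"
    using K.nonzero_inv[of k] assms by auto
  moreover from this have "inv k = inv\<^bsub>D\<lparr>carrier := K\<rparr>\<^esub> k" using assms(2) sub by (intro inv_eqI) auto
  ultimately show "inv k \<in> K" "inv\<^bsub>D\<lparr>carrier := K\<rparr>\<^esub> k = inv k" by auto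
qed

lemma division_subring_generated:
  assumes "S \<subseteq> carrier D"
  shows "division_subring (generated_division_subring D S) D" "S \<subseteq> generated_division_subring D S"
proof -
  let ?G = "generated_division_subring D S"
  have "division_subring (carrier D) D"
    using carrier_is_subring skew_field_axioms by (simp add: division_subring_def)
  then have ne: "{K. division_subring K D \<and> S \<subseteq> K} \<noteq> {}" using assms by blast
  have sub: "subring ?G D"
    unfolding generated_division_subring_def using ne
    by (intro subring_Inter) (auto simp: division_subring_def)
  have "skew_field (D\<lparr>carrier := ?G\<rparr>)"
    using division_subring_inv(1) by (intro skew_field_subring[OF sub]) (auto simp: generated_division_subring_def)
  then show "division_subring ?G D" using sub by (simp add: division_subring_def)
  show "S \<subseteq> ?G" by (auto simp: generated_division_subring_def)
qed

end

theorem theorem3p4: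
  fixes D :: "('a, 'b) ring_scheme" and N :: "'a set"
  assumes "skew_field D"
    and "weakly_locally_finite D"
    and "subnormal_subgroup N (units_of D)"
    and "radical_over D N (ring_center D)"
  shows "N \<subseteq> ring_center D"
proof
  fix x assume xN: "x \<in> N"
  interpret D: skew_field D by fact
  have grp: "subgroup N (units_of D)"
    using assms(3) unfolding subnormal_subgroup_def by (metis le0)
  have N: "w \<in> carrier D" "w \<noteq> \<zero>\<^bsub>D\<^esub>" if "w \<in> N" for w
    using subgroup.mem_carrier[OF grp that] D.skew_field_Units by (auto simp: units_of_carrier)
  have N_pow: "w [^]\<^bsub>D\<^esub> (n::nat) \<in> N" if "w \<in> N" for w n
    using that subgroup.one_closed[OF grp] subgroup.m_closed[OF grp]
    by (induction n) (auto simp: units_of_mult units_of_one)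
  obtain r where r: "\<And>x a. x \<in> N \<Longrightarrow> a \<in> carrier D \<Longrightarrow> a \<noteq> \<zero>\<^bsub>D\<^esub> \<Longrightarrow> D.iterated_commutator x a (Suc r) \<in> N"
    using D.subnormal_iterated_commutator[OF assms(3)] by blast
  have "x \<otimes>\<^bsub>D\<^esub> y = y \<otimes>\<^bsub>D\<^esub> x" if y: "y \<in> carrier D" for y
  proof -
    \<comment> \<open>Centrality of \<open>x\<close> is tested against one \<open>y\<close> at a
      time, so two generators suffice.\<close>
    define K where "K = generated_division_subring D {x, y}"
    have K: "division_subring K D" "x \<in> K" "y \<in> K"
      using D.division_subring_generated[of "{x, y}"] y N(1)[OF xN] by (auto simp: K_def)
    have sub: "subring K D" using K by (simp add: division_subring_def)
    note Kc = subsetD[OF subringE(1)[OF sub]]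
    interpret K: skew_field "D\<lparr>carrier := K\<rparr>" using K(1) by (simp add: division_subring_def)
    have pow: "a [^]\<^bsub>D\<lparr>carrier := K\<rparr>\<^esub> (n::nat) = a [^]\<^bsub>D\<^esub> n" for a n by (simp add: nat_pow_def)
    have fin: "K.finite_dimension (ring_center (D\<lparr>carrier := K\<rparr>)) (carrier (D\<lparr>carrier := K\<rparr>))"
      using assms(2) y N(1)[OF xN] unfolding weakly_locally_finite_def centrally_finite_def K_def by auto
    have conjugate: "K.conjugate b a = D.conjugate b a" if "b \<in> K" "b \<noteq> \<zero>\<^bsub>D\<^esub>" for a b
      using D.division_subring_inv(2)[OF K(1) that] by (simp add: K.conjugate_def D.conjugate_def)
    have iter: "K.iterated_commutator w a n = D.iterated_commutator w a n \<and> D.iterated_commutator w a n \<in> K"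
      if w: "w \<in> K" "w \<noteq> \<zero>\<^bsub>D\<^esub>" and a: "a \<in> K" "a \<noteq> \<zero>\<^bsub>D\<^esub>" for w a n
    proof (induction n)
      case (Suc n)
      let ?b = "D.iterated_commutator w a n"
      have b: "?b \<in> K" "?b \<noteq> \<zero>\<^bsub>D\<^esub>" using Suc D.iterated_commutator_closed(2)[OF Kc[OF w(1)] w(2) Kc[OF a(1)] a(2)] by auto
      have c: "D.conjugate w ?b \<in> K" "D.conjugate w ?b \<noteq> \<zero>\<^bsub>D\<^esub>"
        using K.conj_closed[of w ?b] conjugate[OF w] w b D.conj_nonzero[OF Kc[OF w(1)] w(2) Kc[OF b(1)] b(2)] by auto
      show ?case
        using Suc b(1) D.division_subring_inv[OF K(1) c] subringE(6)[OF sub] conjugate[OF w]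
        by (simp add: K.iterated_commutator.simps(2) D.iterated_commutator.simps(2))
    qed (use a in simp)
    \<comment> \<open>The number \<open>r\<close> found in \<open>D\<close> serves in
      \<open>K\<close> as well, since commutators formed in \<open>K\<close> agree with those in
      \<open>D\<close>. A power lying in the center of \<open>D\<close> and in \<open>K\<close> is
      central in \<open>K\<close>.\<close>
    have "N \<inter> K \<subseteq> ring_center (D\<lparr>carrier := K\<rparr>)"
    proof (rule K.radical_central_centrally_finite[OF fin])
      fix w assume w: "w \<in> N \<inter> K"
      show "w \<in> carrier (D\<lparr>carrier := K\<rparr>)" "w \<noteq> \<zero>\<^bsub>D\<lparr>carrier := K\<rparr>\<^esub>" using w N by auto
      show wn: "w [^]\<^bsub>D\<lparr>carrier := K\<rparr>\<^esub> n \<in> N \<inter> K" for n :: nat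
        using w N_pow K.nat_pow_closed[of w n] by (simp add: pow)
      obtain n :: nat where n: "n > 0" "w [^]\<^bsub>D\<^esub> n \<in> ring_center D"
        using assms(4) w unfolding radical_over_def by blast
      have "w [^]\<^bsub>D\<lparr>carrier := K\<rparr>\<^esub> n \<in> ring_center (D\<lparr>carrier := K\<rparr>)"
        using n(2) wn[of n] Kc by (simp add: pow ring_center_def)
      then show "\<exists>n::nat. n > 0 \<and> w [^]\<^bsub>D\<lparr>carrier := K\<rparr>\<^esub> n \<in> ring_center (D\<lparr>carrier := K\<rparr>)"
        using n(1) by blast
    next
      fix w a assume "w \<in> N \<inter> K" "a \<in> carrier (D\<lparr>carrier := K\<rparr>)" "a \<noteq> \<zero>\<^bsub>D\<lparr>carrier := K\<rparr>\<^esub>"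
      then show "K.iterated_commutator w a (Suc r) \<in> N \<inter> K"
        using iter[of w a "Suc r"] r[of w a] N(2)[of w] Kc by auto
    qed
    then show ?thesis using xN K(2,3) by (auto simp: ring_center_def)
  qed
  then show "x \<in> ring_center D" using N(1)[OF xN] by (intro D.centerI)
qed

end
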